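(* Let $\Lambda$ be an affine monoid, let $\rho\in\Lambda$ be reducible, and let $r\ge 2$ be an integer. Then for every $\lambda\in\Lambda$ and every integer $k$ with $0\le k<r$, $$\mathcal F(\lambda+k\rho/r;\Lambda[\rho/r])\simeq\begin{cases}\displaystyle\bigvee_{\ell=0}^{\ell_\rho(\lambda)}\Sigma^{2\ell+k}\mathcal F(\lambda-\ell\rho;\Lambda)&\text{if }k\le 1,\\[2mm] \mathrm{pt}&\text{if }k\ge 2,\end{cases}$$ where $\simeq$ denotes homotopy equivalence and $\mathrm{pt}$ is the one-point space.
   Context: $\mathbb N$ is the additive monoid of non-negative integers. An affine monoid is a commutative monoid $\Lambda$, written additively, which is (1) cancellative ($\lambda+\nu=\mu+\nu$ implies $\lambda=\mu$), (2) without non-zero invertible elements ($\lambda+\mu=0$ implies $\lambda=\mu=0$), and (3) finitely generated. It is partially ordered by: $\lambda\le_\Lambda\mu$ iff there is $\nu\in\Lambda$ with $\lambda+\nu=\mu$; this $\nu$ is unique and is denoted $\mu-\lambda$. $<_\Lambda$ is the associated strict order and $\Lambda_+=\Lambda\setminus\{0\}$. An element $\rho$ is reducible if $\rho=\sigma+\tau$ for some $\sigma,\tau\in\Lambda_+$. For a poset $P$, $\|P\|$ denotes (the geometric realization of) its order complex, the simplicial complex whose simplices are the finite chains of $P$. Let $(0,\lambda)_\Lambda=\{x\in\Lambda\mid 0<_\Lambda x<_\Lambda\lambda\}$. The Frobenius complex is $\mathcal F(\lambda;\Lambda)=\|(0,\lambda)_\Lambda\|$ if $\lambda\in\Lambda_+$,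 and $\mathcal F(0;\Lambda)=S^{-2}$, where $S^{-2}$ is a formal symbol (regarded as homotopy equivalent only to itself). $S^{-1}$ is the empty space. $\Sigma X$ is the unreduced suspension of a space $X$; in particular $\Sigma S^{-1}= S^0$ (two points), and by definition $\Sigma S^{-2}=S^{-1}$. $\Sigma^n$ is the $n$-fold iterate, $\Sigma^0X=X$. Construction of $\Lambda[\rho/r]$: let $\Lambda\oplus\mathbb N\alpha$ be the direct sum of $\Lambda$ with the free additive monoid on one formal generator $\alpha$, and let $\sim$ be the equivalence relation generated by $(\lambda+\rho)+k\alpha\sim\lambda+(r+k)\alpha$ ($\lambda\in\Lambda$, $k\in\mathbb N$). It is a congruence, and $\Lambda[\rho/r]=(\Lambda\oplus\mathbb N\alpha)/\!\sim$ with the induced monoid structure; the class of $\lambda+k\alpha$ is written $\lambda+k\rho/r$. $\Lambda[\rho/r]$ is an affine monoid, and $(\lambda,k)\mapsto\lambda+k\rho/r$ is a bijection $\Lambda\times\{0,\dots,r-1\}\to\Lambda[\rho/r]$. $\ell_\rho(\lambda)=\max\{\ell\in\mathbb N\mid \ell\rho\le_\Lambda\lambda\}$ (a well-defined finite maximum). Wedge convention: a wedge with a single summand is that summand itself (which may be $S^{-2}$ or empty). If there are at least two summands (i.e. $\rho\le_\Lambda\lambda$), a summand $\Sigma^{m}\mathcal F(\cdot\,;\Lambda)$ with $m\ge 1$ is pointed at an end point of the last suspension (for $m=2$ and $\mathcal F=S^{-2}$, it is $S^0$ pointed at one of its points), and the unsuspended summand $\mathcal F(\lambda;\Lambda)$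 (occurring for $k=0,\ell=0$) is pointed at a vertex $\sigma$ with $0<_\Lambda\sigma<_\Lambda\rho$. *)

theory Defs
  imports "HOL-Analysis.Analysis" "HOL-Algebra.Divisibility"
begin

section \<open>Affine monoids\<close>

text \<open>Monoids are HOL-Algebra monoids, hence written multiplicatively: \<open>\<otimes>\<close>, \<open>\<one>\<close> and \<open>[^]\<close>
  stand for addition, zero and multiples. The order of an affine monoid is the library's
  \<open>divides\<close>: \<open>a divides b\<close> says that \<open>b = a \<otimes> c\<close> for some \<open>c\<close> in the carrier.\<close>

locale affine_monoid = comm_monoid_cancel +
  assumes reduced: "\<lbrakk>x \<in> carrier G; y \<in> carrier G; x \<otimes> y = \<one>\<rbrakk> \<Longrightarrow> x = \<one> \<and> y = \<one>"
    and finitely_generated: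
      "\<exists>S. finite S \<and> S \<subseteq> carrier G \<and> (\<forall>H. submonoid H G \<longrightarrow> S \<subseteq> H \<longrightarrow> H = carrier G)"

definition less_mon :: "('a, 'b) monoid_scheme \<Rightarrow> 'a \<Rightarrow> 'a \<Rightarrow> bool" where
  "less_mon G x y \<longleftrightarrow> x divides\<^bsub>G\<^esub> y \<and> x \<noteq> y"

definition reducible_mon :: "('a, 'b) monoid_scheme \<Rightarrow> 'a \<Rightarrow> bool" where
  "reducible_mon G \<rho> \<longleftrightarrow>
     \<rho> \<in> carrier G \<and>
     (\<exists>\<sigma> \<in> carrier G - {\<one>\<^bsub>G\<^esub>}. \<exists>\<tau> \<in> carrier G - {\<one>\<^bsub>G\<^esub>}. \<rho> = \<sigma> \<otimes>\<^bsub>G\<^esub> \<tau>)"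

text \<open>The difference \<open>y - x\<close>; unique by cancellation, and meaningful only if \<open>x divides y\<close>.\<close>

definition diff_mon :: "('a, 'b) monoid_scheme \<Rightarrow> 'a \<Rightarrow> 'a \<Rightarrow> 'a" where
  "diff_mon G y x = (THE z. z \<in> carrier G \<and> x \<otimes>\<^bsub>G\<^esub> z = y)"

definition ell :: "('a, 'b) monoid_scheme \<Rightarrow> 'a \<Rightarrow> 'a \<Rightarrow> nat" where
  "ell G \<rho> x = Max {l. (\<rho> [^]\<^bsub>G\<^esub> l) divides\<^bsub>G\<^esub> x}"


section \<open>Adjoining a fraction\<close>

definition nat_add_monoid :: "nat monoid" where
  "nat_add_monoid = \<lparr>carrier = UNIV, mult = (+), one = 0\<rparr>"

text \<open>The element \<open>(x, k)\<close> of \<open>G \<times>\<times> nat_add_monoid\<close> is the formal sum of \<open>x\<close> and \<open>k\<close> times the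
  new generator.\<close>

definition frac_gen :: "('a, 'b) monoid_scheme \<Rightarrow> 'a \<Rightarrow> nat \<Rightarrow> 'a \<times> nat \<Rightarrow> 'a \<times> nat \<Rightarrow> bool" where
  "frac_gen G \<rho> r p q \<longleftrightarrow> (\<exists>x \<in> carrier G. \<exists>k. p = (x \<otimes>\<^bsub>G\<^esub> \<rho>, k) \<and> q = (x, r + k))"

definition frac_rel :: "('a, 'b) monoid_scheme \<Rightarrow> 'a \<Rightarrow> nat \<Rightarrow> (('a \<times> nat) \<times> ('a \<times> nat)) set" where
  "frac_rel G \<rho> r = {(p, q). p \<in> carrier (G \<times>\<times> nat_add_monoid) \<and>
                             q \<in> carrier (G \<times>\<times> nat_add_monoid) \<and> equivclp (frac_gen G \<rho> r) p q}"

text \<open>\<open>frac_elem G \<rho> r x k\<close> is the class of \<open>(x, k)\<close>, i.e. the element \<open>x + k\<rho>/r\<close>.\<close>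

definition frac_elem :: "('a, 'b) monoid_scheme \<Rightarrow> 'a \<Rightarrow> nat \<Rightarrow> 'a \<Rightarrow> nat \<Rightarrow> ('a \<times> nat) set" where
  "frac_elem G \<rho> r x k = frac_rel G \<rho> r `` {(x, k)}"

definition adjoin_frac :: "('a, 'b) monoid_scheme \<Rightarrow> 'a \<Rightarrow> nat \<Rightarrow> ('a \<times> nat) set monoid" where
  "adjoin_frac G \<rho> r =
     \<lparr>carrier = carrier (G \<times>\<times> nat_add_monoid) // frac_rel G \<rho> r,
      mult = (\<lambda>A B. \<Union>p\<in>A. \<Union>q\<in>B. frac_rel G \<rho> r `` {p \<otimes>\<^bsub>G \<times>\<times> nat_add_monoid\<^esub> q}),
      one = frac_rel G \<rho> r `` {\<one>\<^bsub>G \<times>\<times> nat_add_monoid\<^esub>}\<rparr>"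

lemma nat_add_monoid_simps [simp]:
  "carrier nat_add_monoid = UNIV" "mult nat_add_monoid = (+)" "one nat_add_monoid = 0"
  by (simp_all add: nat_add_monoid_def)

lemma equiv_frac_rel:
  "equiv (carrier (G \<times>\<times> nat_add_monoid)) (frac_rel G \<rho> r)"
  by (rule equivI)
     (auto simp: frac_rel_def refl_on_def sym_def trans_def
           intro: equivclp_refl equivclp_sym equivclp_trans)

lemma (in comm_monoid) frac_gen_mult:
  assumes "frac_gen G \<rho> r p q" "\<rho> \<in> carrier G" "y \<in> carrier G"
  shows "frac_gen G \<rho> r (p \<otimes>\<^bsub>G \<times>\<times> nat_add_monoid\<^esub> (y, l)) (q \<otimes>\<^bsub>G \<times>\<times> nat_add_monoid\<^esub> (y, l))"
proof -
  obtain x k where *: "x \<in> carrier G" "p = (x \<otimes> \<rho>, k)" "q = (x, r + k)"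
    using assms(1) by (auto simp: frac_gen_def)
  then show ?thesis
    using assms by (auto simp: frac_gen_def m_ac add.assoc intro!: bexI[of _ "x \<otimes> y"])
qed

lemma (in comm_monoid) equivclp_frac_gen_mult:
  assumes "equivclp (frac_gen G \<rho> r) p q" "\<rho> \<in> carrier G" "y \<in> carrier G"
  shows "equivclp (frac_gen G \<rho> r) (p \<otimes>\<^bsub>G \<times>\<times> nat_add_monoid\<^esub> (y, l))
                                   (q \<otimes>\<^bsub>G \<times>\<times> nat_add_monoid\<^esub> (y, l))"
  using assms(1)
proof (induction rule: equivclp_induct)
  case base
  show ?case by simp
next
  case (step u v)
  then have "equivclp (frac_gen G \<rho> r) (u \<otimes>\<^bsub>G \<times>\<times> nat_add_monoid\<^esub> (y, l))
                                       (v \<otimes>\<^bsub>G \<times>\<times> nat_add_monoid\<^esub> (y, l))"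
    using frac_gen_mult[OF _ assms(2,3)] by (blast intro: r_into_equivclp equivclp_sym)
  with step.IH show ?case by (rule equivclp_trans)
qed

lemma (in comm_monoid) congruent2_frac_rel:
  assumes "\<rho> \<in> carrier G"
  shows "congruent2 (frac_rel G \<rho> r) (frac_rel G \<rho> r)
           (\<lambda>p q. frac_rel G \<rho> r `` {p \<otimes>\<^bsub>G \<times>\<times> nat_add_monoid\<^esub> q})"
proof (rule congruent2_commuteI[OF equiv_frac_rel])
  show "frac_rel G \<rho> r `` {p \<otimes>\<^bsub>G \<times>\<times> nat_add_monoid\<^esub> q}
      = frac_rel G \<rho> r `` {q \<otimes>\<^bsub>G \<times>\<times> nat_add_monoid\<^esub> p}"
    if "p \<in> carrier (G \<times>\<times> nat_add_monoid)" "q \<in> carrier (G \<times>\<times> nat_add_monoid)" for p q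
    using that by (cases p; cases q) (simp add: m_comm add.commute)
next
  fix p q w
  assume w: "w \<in> carrier (G \<times>\<times> nat_add_monoid)" and pq: "(p, q) \<in> frac_rel G \<rho> r"
  obtain y l where yl: "w = (y, l)" "y \<in> carrier G"
    using w by (cases w) (auto)
  have com: "w \<otimes>\<^bsub>G \<times>\<times> nat_add_monoid\<^esub> u = u \<otimes>\<^bsub>G \<times>\<times> nat_add_monoid\<^esub> w"
    if "u \<in> carrier (G \<times>\<times> nat_add_monoid)" for u
    using that yl by (cases u) (simp add: m_comm add.commute)
  have pqC: "p \<in> carrier (G \<times>\<times> nat_add_monoid)" "q \<in> carrier (G \<times>\<times> nat_add_monoid)"
    and e: "equivclp (frac_gen G \<rho> r) p q"
    using pq by (auto simp: frac_rel_def)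
  have "u \<otimes>\<^bsub>G \<times>\<times> nat_add_monoid\<^esub> w \<in> carrier (G \<times>\<times> nat_add_monoid)"
    if "u \<in> carrier (G \<times>\<times> nat_add_monoid)" for u
    using that yl by (cases u) simp
  then have "(p \<otimes>\<^bsub>G \<times>\<times> nat_add_monoid\<^esub> w, q \<otimes>\<^bsub>G \<times>\<times> nat_add_monoid\<^esub> w) \<in> frac_rel G \<rho> r"
    using pqC equivclp_frac_gen_mult[OF e assms yl(2), of l] yl(1) by (simp add: frac_rel_def)
  then show "frac_rel G \<rho> r `` {w \<otimes>\<^bsub>G \<times>\<times> nat_add_monoid\<^esub> p}
           = frac_rel G \<rho> r `` {w \<otimes>\<^bsub>G \<times>\<times> nat_add_monoid\<^esub> q}"
    using com pqC equiv_class_eq[OF equiv_frac_rel] by metis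
qed

lemma (in comm_monoid) mult_adjoin_frac:
  assumes "\<rho> \<in> carrier G" "x \<in> carrier G" "y \<in> carrier G"
  shows "frac_elem G \<rho> r x k \<otimes>\<^bsub>adjoin_frac G \<rho> r\<^esub> frac_elem G \<rho> r y l
       = frac_elem G \<rho> r (x \<otimes> y) (k + l)"
  using UN_equiv_class2[OF equiv_frac_rel equiv_frac_rel congruent2_frac_rel[OF assms(1)],
      of "(x, k)" "(y, l)" r] assms
  by (simp add: adjoin_frac_def frac_elem_def)


section \<open>Order complexes and their geometric realization\<close>

definition order_complex :: "('a \<Rightarrow> 'a \<Rightarrow> bool) \<Rightarrow> 'a set \<Rightarrow> 'a set set" where
  "order_complex leq P = {C. finite C \<and> C \<subseteq> P \<and> Complete_Partial_Order.chain leq C}"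

text \<open>Points are given by barycentric coordinates. The empty simplex, if present, contributes no
  point.\<close>

definition closed_simplex :: "'a set \<Rightarrow> ('a \<Rightarrow> real) set" where
  "closed_simplex C = {f. (\<forall>v. 0 \<le> f v) \<and> (\<forall>v. v \<notin> C \<longrightarrow> f v = 0) \<and> sum f C = 1}"

text \<open>The usual weak topology, coherent with the Euclidean topology of the closed simplices.\<close>

definition geom_realization :: "'a set set \<Rightarrow> ('a \<Rightarrow> real) topology" where
  "geom_realization K = topology (\<lambda>U. U \<subseteq> (\<Union>C\<in>K. closed_simplex C) \<and>
     (\<forall>C\<in>K. openin (subtopology (powertop_real UNIV) (closed_simplex C)) (U \<inter> closed_simplex C)))"

lemma openin_geom_realization:
  "openin (geom_realization K) U \<longleftrightarrow> U \<subseteq> (\<Union>C\<in>K. closed_simplex C) \<and>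
     (\<forall>C\<in>K. openin (subtopology (powertop_real UNIV) (closed_simplex C)) (U \<inter> closed_simplex C))"
proof -
  have "istopology (\<lambda>U. U \<subseteq> (\<Union>C\<in>K. closed_simplex C) \<and>
     (\<forall>C\<in>K. openin (subtopology (powertop_real UNIV) (closed_simplex C)) (U \<inter> closed_simplex C)))"
    (is "istopology (\<lambda>U. U \<subseteq> ?S \<and> (\<forall>C\<in>K. ?open C (U \<inter> closed_simplex C)))")
    unfolding istopology_def
  proof (rule conjI; intro allI impI; rule conjI)
    fix U V
    assume UV: "U \<subseteq> ?S \<and> (\<forall>C\<in>K. ?open C (U \<inter> closed_simplex C))"
      "V \<subseteq> ?S \<and> (\<forall>C\<in>K. ?open C (V \<inter> closed_simplex C))"
    then show "U \<inter> V \<subseteq> ?S" by blast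
    have "U \<inter> V \<inter> closed_simplex C = (U \<inter> closed_simplex C) \<inter> (V \<inter> closed_simplex C)" for C
      by blast
    moreover have "?open C ((U \<inter> closed_simplex C) \<inter> (V \<inter> closed_simplex C))" if "C \<in> K" for C
      using UV that by (intro openin_Int[of _ "U \<inter> _" "V \<inter> _"]) blast+
    ultimately show "\<forall>C\<in>K. ?open C (U \<inter> V \<inter> closed_simplex C)"
      by simp
  next
    fix \<K>
    assume *: "\<forall>U\<in>\<K>. U \<subseteq> ?S \<and> (\<forall>C\<in>K. ?open C (U \<inter> closed_simplex C))"
    then show "\<Union>\<K> \<subseteq> ?S" by blast
    have "\<Union>\<K> \<inter> closed_simplex C = \<Union>((\<lambda>U. U \<inter> closed_simplex C) ` \<K>)" for C
      by blast
    moreover have "?open C (\<Union>((\<lambda>U. U \<inter> closed_simplex C) ` \<K>))" if "C \<in> K" for C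
      using * that by (intro openin_Union) blast
    ultimately show "\<forall>C\<in>K. ?open C (\<Union>\<K> \<inter> closed_simplex C)"
      by simp
  qed
  then show ?thesis
    by (simp add: geom_realization_def)
qed


section \<open>Suspensions and wedges\<close>

text \<open>The finest topology on \<open>S\<close> making \<open>q\<close> continuous. It is the quotient topology if
  \<open>q\<close> maps onto \<open>S\<close>; points of \<open>S\<close> outside the image become isolated.\<close>

definition coinduced_topology :: "'b set \<Rightarrow> 'a topology \<Rightarrow> ('a \<Rightarrow> 'b) \<Rightarrow> 'b topology" where
  "coinduced_topology S X q =
     topology (\<lambda>U. U \<subseteq> S \<and> openin X {x \<in> topspace X. q x \<in> U})"

lemma openin_coinduced_topology:
  "openin (coinduced_topology S X q) U \<longleftrightarrow> U \<subseteq> S \<and> openin X {x \<in> topspace X. q x \<in> U}"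
proof -
  have "istopology (\<lambda>U. U \<subseteq> S \<and> openin X {x \<in> topspace X. q x \<in> U})"
    unfolding istopology_def
  proof (intro conjI allI impI)
    fix U V
    assume "U \<subseteq> S \<and> openin X {x \<in> topspace X. q x \<in> U}"
      and "V \<subseteq> S \<and> openin X {x \<in> topspace X. q x \<in> V}"
    moreover have "{x \<in> topspace X. q x \<in> U \<inter> V}
                 = {x \<in> topspace X. q x \<in> U} \<inter> {x \<in> topspace X. q x \<in> V}"
      by blast
    ultimately show "U \<inter> V \<subseteq> S" "openin X {x \<in> topspace X. q x \<in> U \<inter> V}"
      by (auto simp only: intro: openin_Int)
  next
    fix \<K>
    assume *: "\<forall>U\<in>\<K>. U \<subseteq> S \<and> openin X {x \<in> topspace X. q x \<in> U}"
    then show "\<Union>\<K> \<subseteq> S" by blast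
    have "{x \<in> topspace X. q x \<in> \<Union>\<K>} = (\<Union>U\<in>\<K>. {x \<in> topspace X. q x \<in> U})"
      by blast
    then show "openin X {x \<in> topspace X. q x \<in> \<Union>\<K>}"
      using * by (auto simp only: intro: openin_Union)
  qed
  then show ?thesis
    by (simp add: coinduced_topology_def)
qed

lemma topspace_coinduced_topology:
  assumes "q ` topspace X \<subseteq> S"
  shows "topspace (coinduced_topology S X q) = S"
proof -
  have "{x \<in> topspace X. q x \<in> S} = topspace X"
    using assms by blast
  then have "openin (coinduced_topology S X q) S"
    by (simp add: openin_coinduced_topology)
  then show ?thesis
    by (metis openin_coinduced_topology openin_subset openin_topspace subset_antisym)
qed

lemma quotient_map_coinduced_topology:
  "quotient_map X (coinduced_topology (q ` topspace X) X q) q"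
  by (auto simp: quotient_map_def topspace_coinduced_topology openin_coinduced_topology)

text \<open>A type of points closed under suspension, so that suspension can be iterated: \<open>Base p\<close> is a
  point of the original space, \<open>Mid x t\<close> lies at height \<open>t\<close> strictly between the end points
  \<open>South\<close> (height 0) and \<open>North\<close> (height 1).\<close>

datatype 'p susp_point = Base (unBase: 'p) | South | North | Mid "'p susp_point" real

definition base_space :: "'p topology \<Rightarrow> 'p susp_point topology" where
  "base_space X = pullback_topology (Base ` topspace X) unBase X"

fun susp_proj :: "'p susp_point \<times> real \<Rightarrow> 'p susp_point" where
  "susp_proj (x, t) = (if t = 0 then South else if t = 1 then North else Mid x t)"

text \<open>The quotient of the disjoint union of \<open>X \<times> [0,1]\<close> and two points that collapses each end of
  the cylinder to one of the two points. In particular, both end points exist for empty \<open>X\<close>.\<close>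

definition suspension :: "'p susp_point topology \<Rightarrow> 'p susp_point topology" where
  "suspension X =
     coinduced_topology ({South, North} \<union> susp_proj ` (topspace X \<times> {0..1}))
       (prod_topology X (top_of_set {0..1})) susp_proj"

text \<open>The one-point union of \<open>X 0, ..., X n\<close>: all base points \<open>(i, p i)\<close> are identified with
  \<open>(0, p 0)\<close>. For \<open>n = 0\<close> nothing is identified, so that \<open>p\<close> is irrelevant and the result is
  (a copy of) \<open>X 0\<close>.\<close>

definition wedge_proj :: "(nat \<Rightarrow> 'b) \<Rightarrow> nat \<times> 'b \<Rightarrow> nat \<times> 'b" where
  "wedge_proj p = (\<lambda>(i, x). if x = p i then (0, p 0) else (i, x))"

definition wedge :: "nat \<Rightarrow> (nat \<Rightarrow> 'b topology) \<Rightarrow> (nat \<Rightarrow> 'b) \<Rightarrow> (nat \<times> 'b) topology" where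
  "wedge n X p =
     coinduced_topology (wedge_proj p ` topspace (sum_topology X {0..n}))
       (sum_topology X {0..n}) (wedge_proj p)"


section \<open>Spaces together with the formal (-2)-sphere\<close>

datatype 'p ext_space = SphereMinus2 | Space "'p topology"

fun ext_homotopy_eq :: "'p ext_space \<Rightarrow> 'q ext_space \<Rightarrow> bool" (infix \<open>\<simeq>\<^sub>e\<close> 50) where
  "SphereMinus2 \<simeq>\<^sub>e SphereMinus2 \<longleftrightarrow> True"
| "Space X \<simeq>\<^sub>e Space Y \<longleftrightarrow> X homotopy_equivalent_space Y"
| "SphereMinus2 \<simeq>\<^sub>e Space Y \<longleftrightarrow> False"
| "Space X \<simeq>\<^sub>e SphereMinus2 \<longleftrightarrow> False"

fun ext_base :: "'p ext_space \<Rightarrow> 'p susp_point ext_space" where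
  "ext_base SphereMinus2 = SphereMinus2"
| "ext_base (Space X) = Space (base_space X)"

fun ext_suspension :: "'p susp_point ext_space \<Rightarrow> 'p susp_point ext_space" where
  "ext_suspension SphereMinus2 = Space trivial_topology"
| "ext_suspension (Space X) = Space (suspension X)"

definition iter_suspension :: "nat \<Rightarrow> 'p ext_space \<Rightarrow> 'p susp_point ext_space" where
  "iter_suspension n X = (ext_suspension ^^ n) (ext_base X)"

text \<open>A wedge of a single summand is that summand, which may be \<open>SphereMinus2\<close>. The value is a
  dummy if \<open>SphereMinus2\<close> occurs among at least two summands.\<close>

definition ext_wedge :: "nat \<Rightarrow> (nat \<Rightarrow> 'b ext_space) \<Rightarrow> (nat \<Rightarrow> 'b) \<Rightarrow> (nat \<times> 'b) ext_space" where
  "ext_wedge n X p =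
     (if \<exists>i\<le>n. X i = SphereMinus2 then SphereMinus2
      else Space (wedge n (\<lambda>i. case X i of Space Y \<Rightarrow> Y) p))"


section \<open>Frobenius complexes\<close>

definition frobenius_complex :: "('a, 'b) monoid_scheme \<Rightarrow> 'a \<Rightarrow> ('a \<Rightarrow> real) ext_space" where
  "frobenius_complex G x =
     (if x = \<one>\<^bsub>G\<^esub> then SphereMinus2
      else Space (geom_realization (order_complex (\<lambda>a b. a divides\<^bsub>G\<^esub> b)
             {y \<in> carrier G. less_mon G \<one>\<^bsub>G\<^esub> y \<and> less_mon G y x})))"

text \<open>The admissible base points of a summand that is an \<open>m\<close>-fold suspension: an end point of the
  last suspension, or, if there is no suspension, a vertex strictly between 0 and \<open>\<rho>\<close>.\<close>

definition admissible_base_point ::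
  "('a, 'b) monoid_scheme \<Rightarrow> 'a \<Rightarrow> nat \<Rightarrow> ('a \<Rightarrow> real) susp_point \<Rightarrow> bool" where
  "admissible_base_point G \<rho> m p \<longleftrightarrow>
     (if m = 0
      then \<exists>\<sigma> \<in> carrier G. less_mon G \<one>\<^bsub>G\<^esub> \<sigma> \<and> less_mon G \<sigma> \<rho> \<and> p = Base (indicator {\<sigma>})
      else p = South \<or> p = North)"

end

theory Submission
  imports Defs "HOL-Algebra.FiniteProduct"
begin

text \<open>In normal form \<open>x + i\<rho>/r\<close> with \<open>i < r\<close>, the order of \<open>\<Lambda>[\<rho>/r]\<close> reads: \<open>(x, i) \<le> (y, j)\<close> iff \<open>x \<le> y\<close> if
  \<open>i \<le> j\<close>, and iff \<open>x + \<rho> \<le> y\<close> otherwise. Write \<open>X(\<lambda>)\<close> and \<open>V(\<lambda>)\<close> for the open intervals below \<open>\<lambda>\<close> and below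
  \<open>\<lambda> + \<rho>/r\<close>. For \<open>k \<ge> 2\<close> the interval is contractible, as \<open>(x, i) \<le> (x, max i 1) \<ge> (0, 1)\<close>. The same maps contract
  \<open>V(\<lambda>)\<close> without the element \<open>(\<lambda>, 0)\<close>, whose link is \<open>X(\<lambda>)\<close>, so \<open>V(\<lambda>)\<close> is the suspension of \<open>X(\<lambda>)\<close>. Lowering \<open>i\<close>
  to \<open>min i 1\<close> reduces \<open>X(\<lambda>)\<close> to the case \<open>r = 2\<close>; there, deleting \<open>(\<lambda> - \<rho>, 1)\<close> leaves a poset that retracts onto
  the open interval of \<open>\<Lambda>\<close> below \<open>\<lambda>\<close>, by \<open>(x, 1) \<mapsto> x + \<rho>\<close>. The link of the deleted element is \<open>V(\<lambda> - \<rho>)\<close>, and for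
  \<open>\<rho> = \<sigma> + \<tau>\<close> its inclusion is null-homotopic by \<open>x + i\<rho> \<ge> x + i\<sigma> \<le> x + \<sigma> \<ge> \<sigma>\<close>. Hence, up to homotopy, \<open>X(\<lambda>)\<close> is the wedge of
  \<open>F(\<lambda>; \<Lambda>)\<close> and the double suspension of \<open>X(\<lambda> - \<rho>)\<close>.

  To iterate this without commuting suspensions with wedges of arbitrary spaces, the successive wedges and
  joins are realized inside one finite clique complex, the tower. Deleting its apexes from the bottom up
  identifies it with \<open>X(\<lambda>)\<close>, and deleting them from the top down identifies it with the wedge.\<close>

section \<open>Homotopy equivalences\<close>

text \<open>Suspensions, wedges and complexes with a vertex restored are all mapping cones, and two
  facts carry every comparison: the base matters only up to equivalence and the attaching map up to
  homotopy; if that map is constant, the attached space matters only up to homotopy equivalence.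
  Three things shape the set-up. The attached space may be empty, since the suspension of S^{-2} is
  empty. So a cone keeps its apex even over the empty space, and the poles of a level are left out
  exactly when the next summand is S^{-2}. Base points are prescribed: a vertex \<sigma> for an
  unsuspended summand, either end point for a suspended one. The first dictates the factorization of
  \<rho>. In the second case it is not known which point an equivalence sends to the base point, so
  the wedge induction controls only the path component of a reference vertex. Finally, comparable
  order-preserving maps are joined only through finitely many contiguous ones, and realizations
  carry the weak topology. Both are handled by finiteness of the intervals, which finite generation
  provides through Dickson's lemma.\<close>

abbreviation unit_interval :: "real topology" where
  "unit_interval \<equiv> top_of_set {0..1}"

abbreviation homotopic :: "'a topology \<Rightarrow> 'b topology \<Rightarrow> ('a \<Rightarrow> 'b) \<Rightarrow> ('a \<Rightarrow> 'b) \<Rightarrow> bool" where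
  "homotopic \<equiv> homotopic_with (\<lambda>_. True)"

lemma homotopicI:
  assumes "continuous_map (prod_topology unit_interval X) Y h"
    "\<And>x. x \<in> topspace X \<Longrightarrow> h (0, x) = f x" "\<And>x. x \<in> topspace X \<Longrightarrow> h (1, x) = g x"
  shows "homotopic X Y f g"
  using assms by (subst homotopic_with) auto

lemma homotopicE:
  assumes "homotopic X Y f g"
  obtains h where "continuous_map (prod_topology unit_interval X) Y h"
    "\<And>x. h (0, x) = f x" "\<And>x. h (1, x) = g x"
  using assms unfolding homotopic_with_def by blast

lemma homotopic_eqI:
  assumes "continuous_map X Y f" "\<And>x. x \<in> topspace X \<Longrightarrow> f x = g x"
  shows "homotopic X Y f g"
  using assms by (intro homotopic_with_equal) auto

definition homotopy_equivalence :: "'a topology \<Rightarrow> 'b topology \<Rightarrow> ('a \<Rightarrow> 'b) \<Rightarrow> bool" where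
  "homotopy_equivalence X Y f \<longleftrightarrow> continuous_map X Y f \<and>
     (\<exists>g. continuous_map Y X g \<and> homotopic X X (g \<circ> f) id \<and> homotopic Y Y (f \<circ> g) id)"

lemma homotopy_equivalenceI:
  assumes "continuous_map X Y f" "continuous_map Y X g"
    "homotopic X X (g \<circ> f) id" "homotopic Y Y (f \<circ> g) id"
  shows "homotopy_equivalence X Y f"
  using assms unfolding homotopy_equivalence_def by blast

lemma homotopy_equivalence_continuous: "homotopy_equivalence X Y f \<Longrightarrow> continuous_map X Y f"
  by (simp add: homotopy_equivalence_def)

lemma homotopy_equivalent_space_iff_equivalence:
  "X homotopy_equivalent_space Y \<longleftrightarrow> (\<exists>f. homotopy_equivalence X Y f)"
  unfolding homotopy_equivalent_space_def homotopy_equivalence_def by blast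

lemma homotopy_equivalence_compose:
  assumes f: "homotopy_equivalence X Y f" and g: "homotopy_equivalence Y Z g"
  shows "homotopy_equivalence X Z (g \<circ> f)"
proof -
  obtain f' where f': "continuous_map Y X f'" "homotopic X X (f' \<circ> f) id" "homotopic Y Y (f \<circ> f') id"
    and cf: "continuous_map X Y f"
    using f by (auto simp: homotopy_equivalence_def)
  obtain g' where g': "continuous_map Z Y g'" "homotopic Y Y (g' \<circ> g) id" "homotopic Z Z (g \<circ> g') id"
    and cg: "continuous_map Y Z g"
    using g by (auto simp: homotopy_equivalence_def)
  have "homotopic X X (f' \<circ> (g' \<circ> g) \<circ> f) (f' \<circ> id \<circ> f)"
    by (intro homotopic_with_compose_continuous_map_left[where p="\<lambda>_. True", OF _ f'(1)]
        homotopic_with_compose_continuous_map_right[where p="\<lambda>_. True", OF _ cf] g'(2)) auto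
  then have 1: "homotopic X X ((f' \<circ> g') \<circ> (g \<circ> f)) id"
    using homotopic_with_trans[OF _ f'(2)] by (simp add: o_assoc)
  have "homotopic Z Z (g \<circ> (f \<circ> f') \<circ> g') (g \<circ> id \<circ> g')"
    by (intro homotopic_with_compose_continuous_map_left[where p="\<lambda>_. True", OF _ cg]
        homotopic_with_compose_continuous_map_right[where p="\<lambda>_. True", OF _ g'(1)] f'(3)) auto
  then have 2: "homotopic Z Z ((g \<circ> f) \<circ> (f' \<circ> g')) id"
    using homotopic_with_trans[OF _ g'(3)] by (simp add: o_assoc)
  show ?thesis
    by (rule homotopy_equivalenceI[OF _ _ 1 2]) (auto intro: continuous_map_compose cf cg f' g')
qed

lemma homotopy_equivalence_of_contractible:
  assumes "contractible_space X" "x \<in> topspace X" "topspace Y = {y}"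
  shows "homotopy_equivalence X Y (\<lambda>_. y)"
proof (rule homotopy_equivalenceI[where g="\<lambda>_. x"])
  have "homotopic X X id (\<lambda>_. x)"
    using assms by (simp add: contractible_space_alt)
  then show "homotopic X X ((\<lambda>_. x) \<circ> (\<lambda>_. y)) id"
    by (simp add: o_def homotopic_with_symD)
  show "homotopic Y Y ((\<lambda>_. y) \<circ> (\<lambda>_. x)) id"
    using assms by (intro homotopic_eqI) auto
qed (use assms in auto)


section \<open>Spaces with a cone attached\<close>

text \<open>\<open>cone_attached Z Y f W i q a\<close> says that \<open>W\<close> is the mapping cone of \<open>f : Z \<rightarrow> Y\<close>: \<open>i\<close> embeds
  \<open>Y\<close>, \<open>q\<close> parametrizes the cylinder on \<open>Z\<close> with \<open>Z \<times> {0}\<close> glued along \<open>f\<close>, and \<open>Z \<times> {1}\<close>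
  is collapsed to the apex \<open>a\<close>, which is a point of \<open>W\<close> even if \<open>Z\<close> is empty.\<close>

definition cone_attached ::
  "'z topology \<Rightarrow> 'y topology \<Rightarrow> ('z \<Rightarrow> 'y) \<Rightarrow> 'w topology \<Rightarrow> ('y \<Rightarrow> 'w) \<Rightarrow> ('z \<times> real \<Rightarrow> 'w) \<Rightarrow> 'w \<Rightarrow> bool"
  where
  "cone_attached Z Y f W i q a \<longleftrightarrow>
     continuous_map Z Y f \<and> inj_on i (topspace Y) \<and> inj_on q (topspace Z \<times> {0<..<1}) \<and>
     a \<notin> i ` topspace Y \<and> q ` (topspace Z \<times> {0<..<1}) \<inter> insert a (i ` topspace Y) = {} \<and>
     (\<forall>z\<in>topspace Z. q (z, 0) = i (f z) \<and> q (z, 1) = a) \<and>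
     topspace W = insert a (i ` topspace Y) \<union> q ` (topspace Z \<times> {0<..<1}) \<and>
     (\<forall>U \<subseteq> topspace W. openin W U \<longleftrightarrow> openin Y {y \<in> topspace Y. i y \<in> U} \<and>
        openin (prod_topology Z unit_interval) {p \<in> topspace Z \<times> {0..1}. q p \<in> U})"

lemma cone_attachedD:
  assumes "cone_attached Z Y f W i q a"
  shows "continuous_map Z Y f" "continuous_map Y W i"
    "continuous_map (prod_topology Z unit_interval) W q"
    "a \<in> topspace W" "\<And>z. z \<in> topspace Z \<Longrightarrow> q (z, 0) = i (f z)" "\<And>z. z \<in> topspace Z \<Longrightarrow> q (z, 1) = a"
proof -
  show *: "continuous_map Z Y f" "a \<in> topspace W" "\<And>z. z \<in> topspace Z \<Longrightarrow> q (z, 0) = i (f z)"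
     "\<And>z. z \<in> topspace Z \<Longrightarrow> q (z, 1) = a"
    using assms by (auto simp: cone_attached_def)
  have op: "openin W U \<Longrightarrow> openin Y {y \<in> topspace Y. i y \<in> U} \<and>
        openin (prod_topology Z unit_interval) {p \<in> topspace Z \<times> {0..1}. q p \<in> U}" for U
    using assms openin_subset[of W U] unfolding cone_attached_def by blast
  show "continuous_map Y W i"
    unfolding continuous_map_def
    using assms op by (auto simp: cone_attached_def)
  have "q (z, t) \<in> topspace W" if zt: "z \<in> topspace Z" "t \<in> {0..1}" for z t
  proof -
    consider "t = 0" | "t = 1" | "t \<in> {0<..<1}" using zt by fastforce
    then show ?thesis
      using assms zt continuous_map_image_subset_topspace[OF *(1)]
      by cases (auto simp: cone_attached_def)
  qed
  then show "continuous_map (prod_topology Z unit_interval) W q"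
    unfolding continuous_map_def
    using op by auto
qed

lemma cone_attached_openin:
  assumes "cone_attached Z Y f W i q a" "U \<subseteq> topspace W"
  shows "openin W U \<longleftrightarrow> openin Y {y \<in> topspace Y. i y \<in> U} \<and>
        openin (prod_topology Z unit_interval) {p \<in> topspace Z \<times> {0..1}. q p \<in> U}"
  using assms unfolding cone_attached_def by blast

lemma cone_attached_cases:
  assumes "cone_attached Z Y f W i q a" "w \<in> topspace W"
  obtains (base) y where "y \<in> topspace Y" "w = i y" | (apex) "w = a"
    | (cyl) z t where "z \<in> topspace Z" "0 < t" "t < 1" "w = q (z, t)"
  using assms by (auto simp: cone_attached_def)

text \<open>Compactness of small parameter intervals makes it possible to test continuity on the pieces.\<close>

lemma cone_attached_continuous_homotopy:
  assumes W: "cone_attached Z Y f W i q a"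
    and h1: "continuous_map (prod_topology unit_interval Y) S (\<lambda>(s, y). h (s, i y))"
    and h2: "continuous_map (prod_topology unit_interval (prod_topology Z unit_interval)) S (\<lambda>(s, p). h (s, q p))"
    and h3: "continuous_map unit_interval S (\<lambda>s. h (s, a))"
  shows "continuous_map (prod_topology unit_interval W) S h"
proof -
  note WD = cone_attachedD[OF W]
  let ?C = "prod_topology Z unit_interval"
  have slice: "continuous_map unit_interval S (\<lambda>s. h (s, w))" if w: "w \<in> topspace W" for w
    using W w
  proof (cases rule: cone_attached_cases)
    case (base y)
    have "continuous_map unit_interval S ((\<lambda>(s, y). h (s, i y)) \<circ> (\<lambda>s. (s, y)))"
      by (rule continuous_map_compose[OF _ h1]) (auto intro!: continuous_map_pairedI simp: base)
    then show ?thesis by (simp add: o_def base)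
  next
    case (cyl z t)
    have "continuous_map unit_interval S ((\<lambda>(s, p). h (s, q p)) \<circ> (\<lambda>s. (s, (z, t))))"
      by (rule continuous_map_compose[OF _ h2]) (use cyl in \<open>auto intro!: continuous_map_pairedI\<close>)
    then show ?thesis by (simp add: o_def cyl)
  qed (simp add: h3)
  \<comment> \<open>\<open>J\<close> is compact, so the projection of \<open>J \<times> X\<close> to
    \<open>X\<close> is closed. The points whose whole slice over \<open>J\<close> is mapped into
    \<open>O'\<close> are the complement of such a projection.\<close>
  have tube: "openin X {x \<in> topspace X. \<forall>s\<in>J. k (s, x) \<in> O'}"
    if "continuous_map (prod_topology unit_interval X) S k" "compact J" "J \<subseteq> {0..1}" "openin S O'"
    for X :: "'x topology" and k J O'
  proof -
    let ?JX = "prod_topology (top_of_set J) X"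
    have "continuous_map ?JX unit_interval fst"
      using that(3) continuous_map_fst[of "top_of_set J" X]
      by (auto simp: continuous_map_in_subtopology)
    then have "continuous_map ?JX (prod_topology unit_interval X) (\<lambda>p. (fst p, snd p))"
      by (intro continuous_map_pairedI continuous_map_snd)
    from continuous_map_compose[OF this that(1)] have ck: "continuous_map ?JX S k"
      by (simp add: o_def)
    have "closedin ?JX {p \<in> topspace ?JX. k p \<in> topspace S - O'}"
      by (rule closedin_continuous_map_preimage[OF ck]) (use that in auto)
    moreover have "compact_space (top_of_set J)"
      using that by (simp add: compact_space_subtopology)
    ultimately have "closedin X (snd ` {p \<in> topspace ?JX. k p \<in> topspace S - O'})"
      using closed_map_snd closed_map_def by blast
    moreover have "{x \<in> topspace X. \<forall>s\<in>J. k (s, x) \<in> O'} = topspace X - snd ` {p \<in> topspace ?JX. k p \<in> topspace S - O'}"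
      using continuous_map_image_subset_topspace[OF ck] by (auto simp: image_iff image_subset_iff)
    ultimately show ?thesis by auto
  qed
  show ?thesis
    unfolding continuous_map_def
  proof (intro conjI allI impI)
    show "h \<in> topspace (prod_topology unit_interval W) \<rightarrow> topspace S"
      using slice continuous_map_image_subset_topspace by fastforce
  next
    fix O' assume O': "openin S O'"
    show "openin (prod_topology unit_interval W) {x \<in> topspace (prod_topology unit_interval W). h x \<in> O'}"
    proof (subst openin_prod_topology_alt, intro allI impI)
      fix s0 w0 assume "(s0, w0) \<in> {x \<in> topspace (prod_topology unit_interval W). h x \<in> O'}"
      then have s0: "s0 \<in> {0..1}" and w0: "w0 \<in> topspace W" and hO: "h (s0, w0) \<in> O'" by simp_all
      have "openin unit_interval {s \<in> {0..1}. h (s, w0) \<in> O'}"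
        using openin_continuous_map_preimage[OF slice[OF w0] O'] by simp
      then have "\<exists>e>0. \<forall>s\<in>{0..1}. dist s s0 < e \<longrightarrow> s \<in> {s \<in> {0..1}. h (s, w0) \<in> O'}"
        using s0 hO by (simp only: openin_euclidean_subtopology_iff) simp
      then obtain e where e: "e > 0" "\<And>s. s \<in> {0..1} \<Longrightarrow> dist s s0 < e \<Longrightarrow> h (s, w0) \<in> O'"
        by blast
      \<comment> \<open>Half the radius: the closed ball is compact and \<open>w0\<close> is still
        mapped into \<open>O'\<close> during all of it, while the open ball of the same radius
        serves as the neighbourhood of \<open>s0\<close>.\<close>
      define J where "J = {0..1} \<inter> cball s0 (e/2)"
      define V where "V = {w \<in> topspace W. \<forall>s\<in>J. h (s, w) \<in> O'}"
      have J: "compact J" "J \<subseteq> {0..1}" by (auto simp: J_def compact_Int)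
      have "openin Y {y \<in> topspace Y. \<forall>s\<in>J. h (s, i y) \<in> O'}"
        using tube[OF h1 J O'] by simp
      moreover have "openin ?C {p \<in> topspace ?C. \<forall>s\<in>J. h (s, q p) \<in> O'}"
        using tube[OF h2 J O'] by simp
      moreover have "V \<subseteq> topspace W" by (auto simp: V_def)
      moreover have "{y \<in> topspace Y. i y \<in> V} = {y \<in> topspace Y. \<forall>s\<in>J. h (s, i y) \<in> O'}"
        using continuous_map_image_subset_topspace[OF WD(2)] by (auto simp: V_def)
      moreover have "{p \<in> topspace Z \<times> {0..1}. q p \<in> V} = {p \<in> topspace ?C. \<forall>s\<in>J. h (s, q p) \<in> O'}"
        using continuous_map_image_subset_topspace[OF WD(3)] by (auto simp: V_def image_subset_iff)
      ultimately have "openin W V"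
        by (simp add: cone_attached_openin[OF W])
      moreover have "openin unit_interval ({0..1} \<inter> ball s0 (e/2))"
        by (simp add: openin_open_Int)
      moreover have "w0 \<in> V"
        using w0 e by (auto simp: V_def J_def dist_commute)
      ultimately show "\<exists>U V. openin unit_interval U \<and> openin W V \<and> s0 \<in> U \<and> w0 \<in> V \<and>
          U \<times> V \<subseteq> {x \<in> topspace (prod_topology unit_interval W). h x \<in> O'}"
        using s0 e(1) by (intro exI[of _ "{0..1} \<inter> ball s0 (e/2)"] exI[of _ V])
          (auto simp: V_def J_def)
    qed
  qed
qed

text \<open>The universal property of the mapping cone as an explicit function. Only the open
  cylinder is inverted, because \<open>q\<close> is injective there; the two ends are covered by the
  values on the base and at the apex.\<close>

definition cone_map ::
  "'z topology \<Rightarrow> 'y topology \<Rightarrow> ('y \<Rightarrow> 'w) \<Rightarrow> ('z \<times> real \<Rightarrow> 'w) \<Rightarrow> 'w \<Rightarrow> ('y \<Rightarrow> 's) \<Rightarrow> ('z \<times> real \<Rightarrow> 's) \<Rightarrow> 's \<Rightarrow> 'w \<Rightarrow> 's"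
  where
  "cone_map Z Y i q a u G v w =
     (if w \<in> i ` topspace Y then u (inv_into (topspace Y) i w)
      else if w = a then v else G (inv_into (topspace Z \<times> {0<..<1}) q w))"

lemma cone_map_simps:
  assumes W: "cone_attached Z Y f W i q a"
    and G: "\<And>z. z \<in> topspace Z \<Longrightarrow> G (z, 0) = u (f z)" "\<And>z. z \<in> topspace Z \<Longrightarrow> G (z, 1) = v"
  shows "y \<in> topspace Y \<Longrightarrow> cone_map Z Y i q a u G v (i y) = u y"
    and "cone_map Z Y i q a u G v a = v"
    and "p \<in> topspace Z \<times> {0..1} \<Longrightarrow> cone_map Z Y i q a u G v (q p) = G p"
proof -
  show *: "cone_map Z Y i q a u G v (i y) = u y" if "y \<in> topspace Y" for y
    using W that by (simp add: cone_map_def cone_attached_def)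
  show **: "cone_map Z Y i q a u G v a = v"
    using W by (simp add: cone_map_def cone_attached_def)
  assume p: "p \<in> topspace Z \<times> {0..1}"
  then obtain z t where zt: "p = (z, t)" "z \<in> topspace Z" "t \<in> {0..1}" by auto
  then consider "t = 0" | "t = 1" | "t \<in> {0<..<1}" by fastforce
  then show "cone_map Z Y i q a u G v (q p) = G p"
  proof cases
    case 1
    then show ?thesis using *[of "f z"] cone_attachedD(1,5)[OF W] zt G continuous_map_image_subset_topspace by fastforce
  next
    case 2
    then show ?thesis using ** cone_attachedD(6)[OF W] zt G by simp
  next
    case 3
    then have "p \<in> topspace Z \<times> {0<..<1}" using zt by auto
    moreover from this have "q p \<in> q ` (topspace Z \<times> {0<..<1})" by blast
    then have "q p \<notin> i ` topspace Y" "q p \<noteq> a"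
      using W unfolding cone_attached_def by auto
    moreover have "inj_on q (topspace Z \<times> {0<..<1})"
      using W by (simp add: cone_attached_def)
    ultimately show ?thesis by (simp add: cone_map_def inv_into_f_f)
  qed
qed

lemma cone_map_continuous:
  assumes W: "cone_attached Z Y f W i q a"
    and u: "continuous_map Y S u" and cG: "continuous_map (prod_topology Z unit_interval) S G" and v: "v \<in> topspace S"
    and G: "\<And>z. z \<in> topspace Z \<Longrightarrow> G (z, 0) = u (f z)" "\<And>z. z \<in> topspace Z \<Longrightarrow> G (z, 1) = v"
  shows "continuous_map W S (cone_map Z Y i q a u G v)" (is "continuous_map _ _ ?h")
proof -
  note simps = cone_map_simps[OF W, of G u v, OF G]
  \<comment> \<open>A single map is a homotopy that ignores its parameter, so the product criterion
    applies; afterwards time 0 is singled out.\<close>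
  have 1: "continuous_map (prod_topology unit_interval W) S (?h \<circ> snd)"
  proof (rule cone_attached_continuous_homotopy[OF W])
    show "continuous_map (prod_topology unit_interval Y) S (\<lambda>(s, y). (?h \<circ> snd) (s, i y))"
      by (rule continuous_map_eq[OF continuous_map_compose[OF continuous_map_snd u]]) (auto simp: simps)
    show "continuous_map (prod_topology unit_interval (prod_topology Z unit_interval)) S
        (\<lambda>(s, p). (?h \<circ> snd) (s, q p))"
      by (rule continuous_map_eq[OF continuous_map_compose[OF continuous_map_snd cG]]) (auto simp: simps)
    show "continuous_map unit_interval S (\<lambda>s. (?h \<circ> snd) (s, a))"
      using v by (simp add: simps)
  qed
  have "continuous_map W (prod_topology unit_interval W) (\<lambda>w. (0::real, w))"
    by (auto intro!: continuous_map_pairedI)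
  from continuous_map_compose[OF this 1]
  have "continuous_map W S ((?h \<circ> snd) \<circ> (\<lambda>w. (0::real, w)))" .
  then show ?thesis by (simp add: o_def)
qed

lemma cone_attached_homotopic:
  assumes W: "cone_attached Z Y f W i q a"
    and U: "continuous_map (prod_topology unit_interval Y) S U"
    and cG: "continuous_map (prod_topology unit_interval (prod_topology Z unit_interval)) S G"
    and V: "continuous_map unit_interval S V"
    and G: "\<And>s z. s \<in> {0..1} \<Longrightarrow> z \<in> topspace Z \<Longrightarrow> G (s, z, 0) = U (s, f z)"
      "\<And>s z. s \<in> {0..1} \<Longrightarrow> z \<in> topspace Z \<Longrightarrow> G (s, z, 1) = V s"
    and w0: "\<And>y. y \<in> topspace Y \<Longrightarrow> w0 (i y) = U (0, y)" "w0 a = V 0"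
      "\<And>z t. z \<in> topspace Z \<Longrightarrow> t \<in> {0..1} \<Longrightarrow> w0 (q (z, t)) = G (0, z, t)"
    and w1: "\<And>y. y \<in> topspace Y \<Longrightarrow> w1 (i y) = U (1, y)" "w1 a = V 1"
      "\<And>z t. z \<in> topspace Z \<Longrightarrow> t \<in> {0..1} \<Longrightarrow> w1 (q (z, t)) = G (1, z, t)"
  shows "homotopic W S w0 w1"
proof -
  define h where "h = (\<lambda>(s, w). cone_map Z Y i q a (\<lambda>y. U (s, y)) (\<lambda>p. G (s, p)) (V s) w)"
  have h: "h (s, i y) = U (s, y)" "h (s, a) = V s" "p \<in> topspace Z \<times> {0..1} \<Longrightarrow> h (s, q p) = G (s, p)"
    if "s \<in> {0..1}" "y \<in> topspace Y" for s y p
    using cone_map_simps[OF W, of "\<lambda>p. G (s, p)" "\<lambda>y. U (s, y)" "V s"] that G by (simp_all add: h_def)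
  have h3: "h (s, a) = V s" "p \<in> topspace Z \<times> {0..1} \<Longrightarrow> h (s, q p) = G (s, p)" if "s \<in> {0..1}" for s p
    using cone_map_simps[OF W, of "\<lambda>p. G (s, p)" "\<lambda>y. U (s, y)" "V s"] that G by (simp_all add: h_def)
  show ?thesis
  proof (rule homotopicI[of _ _ h])
    show "continuous_map (prod_topology unit_interval W) S h"
    proof (rule cone_attached_continuous_homotopy[OF W])
      show "continuous_map (prod_topology unit_interval Y) S (\<lambda>(s, y). h (s, i y))"
        by (rule continuous_map_eq[OF U]) (auto simp: h)
      show "continuous_map (prod_topology unit_interval (prod_topology Z unit_interval)) S (\<lambda>(s, p). h (s, q p))"
        by (rule continuous_map_eq[OF cG]) (auto simp: h3)
      show "continuous_map unit_interval S (\<lambda>s. h (s, a))"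
        by (rule continuous_map_eq[OF V]) (auto simp: h3)
    qed
    show "h (0, w) = w0 w" "h (1, w) = w1 w" if "w \<in> topspace W" for w
      using W that
      by (cases rule: cone_attached_cases; simp add: h h3 w0 w1)+
  qed
qed

section \<open>Continuity of piecewise reparametrized maps\<close>

lemma continuous_map_comp1:
  assumes "continuous_map A C h" "continuous_map X A u"
  shows "continuous_map X C (\<lambda>x. h (u x))"
  using continuous_map_compose[OF assms(2,1)] by (simp add: o_def)

lemma continuous_map_comp2:
  assumes "continuous_map (prod_topology A B) C h" "continuous_map X A u" "continuous_map X B v"
  shows "continuous_map X C (\<lambda>x. h (u x, v x))"
  using continuous_map_compose[OF continuous_map_pairedI[OF assms(2,3)] assms(1)] by (simp add: o_def)

lemma continuous_map_if_le:
  assumes "continuous_map X euclideanreal p" "continuous_map X euclideanreal r"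
    "continuous_map X Y u" "continuous_map X Y v" "\<And>x. x \<in> topspace X \<Longrightarrow> p x = r x \<Longrightarrow> u x = v x"
  shows "continuous_map X Y (\<lambda>x. if p x \<le> r x then u x else v x)"
  using assms by (intro continuous_map_cases_le continuous_map_from_subtopology) auto

lemma preimage_Int: "{x \<in> T. k x \<in> U \<inter> V} = {x \<in> T. k x \<in> U} \<inter> {x \<in> T. k x \<in> V}"
  by blast

lemma preimage_Union: "{x \<in> T. k x \<in> \<Union>\<K>} = (\<Union>U\<in>\<K>. {x \<in> T. k x \<in> U})"
  by blast

text \<open>Reparametrizations such as \<open>2 * t\<close> leave the unit interval outside their
  own branch of a case distinction. Clamping makes each branch continuous on the whole domain, as
  the gluing rule demands.\<close>

definition clamp01 :: "real \<Rightarrow> real" where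
  "clamp01 x = max 0 (min 1 x)"

lemma clamp01_simps [simp]: "0 \<le> x \<Longrightarrow> x \<le> 1 \<Longrightarrow> clamp01 x = x"
  by (simp add: clamp01_def)

lemma clamp01_in [simp]: "0 \<le> clamp01 x" "clamp01 x \<le> 1"
  by (simp_all add: clamp01_def)

lemma continuous_map_clamp01:
  assumes "continuous_map X euclideanreal r"
  shows "continuous_map X unit_interval (\<lambda>x. clamp01 (r x))"
  using assms unfolding clamp01_def
  by (intro continuous_map_into_subtopology continuous_map_real_max continuous_map_real_min) auto

lemma continuous_map_prod_projections:
  "continuous_map (prod_topology unit_interval Y) euclideanreal fst"
  "continuous_map (prod_topology Y unit_interval) euclideanreal snd"
  "continuous_map (prod_topology unit_interval (prod_topology Y unit_interval)) Y (\<lambda>x. fst (snd x))"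
  "continuous_map (prod_topology unit_interval (prod_topology Y unit_interval)) euclideanreal (\<lambda>x. snd (snd x))"
proof -
  show *: "continuous_map (prod_topology unit_interval Y) euclideanreal fst"
    "continuous_map (prod_topology Y unit_interval) euclideanreal snd" for Y :: "'c topology"
    by (rule continuous_map_into_fulltopology[OF continuous_map_fst] continuous_map_into_fulltopology[OF continuous_map_snd])+
  show "continuous_map (prod_topology unit_interval (prod_topology Y unit_interval)) Y (\<lambda>x. fst (snd x))"
    by (rule continuous_map_comp1[OF continuous_map_fst continuous_map_snd])
  show "continuous_map (prod_topology unit_interval (prod_topology Y unit_interval)) euclideanreal (\<lambda>x. snd (snd x))"
    by (rule continuous_map_comp1[OF *(2) continuous_map_snd])
qed

lemmas real_continuity = continuous_map_real_mult continuous_map_diff continuous_map_add continuous_map_minus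
  continuous_map_canonical_const continuous_map_prod_projections continuous_map_fst continuous_map_snd

text \<open>A map of mapping cones that extends \<open>\<phi>\<close> and runs through the homotopy \<open>H\<close> from \<open>\<phi> \<circ> f\<close> to
  \<open>f'\<close> on the lower half of the cylinder.\<close>

definition cone_extension ::
  "'z topology \<Rightarrow> 'y topology \<Rightarrow> ('y \<Rightarrow> 'w) \<Rightarrow> ('z \<times> real \<Rightarrow> 'w) \<Rightarrow> 'w \<Rightarrow> ('x \<Rightarrow> 'v) \<Rightarrow> ('z \<times> real \<Rightarrow> 'v) \<Rightarrow> 'v
    \<Rightarrow> ('y \<Rightarrow> 'x) \<Rightarrow> (real \<times> 'z \<Rightarrow> 'x) \<Rightarrow> ('w \<Rightarrow> 'v) \<Rightarrow> bool" where
  "cone_extension Z Y i q a i' q' a' \<phi> H \<Phi> \<longleftrightarrow>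
     (\<forall>y\<in>topspace Y. \<Phi> (i y) = i' (\<phi> y)) \<and> \<Phi> a = a' \<and>
     (\<forall>z\<in>topspace Z. \<forall>t\<in>{0..1}. \<Phi> (q (z, t)) = (if 2 * t \<le> 1 then i' (H (2 * t, z)) else q' (z, 2 * t - 1)))"

lemma cone_extension_exists:
  assumes W: "cone_attached Z Y f W i q a" and W': "cone_attached Z Y' f' W' i' q' a'"
    and \<phi>: "continuous_map Y Y' \<phi>" and H: "continuous_map (prod_topology unit_interval Z) Y' H"
    and H01: "\<And>z. z \<in> topspace Z \<Longrightarrow> H (0, z) = \<phi> (f z)" "\<And>z. z \<in> topspace Z \<Longrightarrow> H (1, z) = f' z"
  obtains \<Phi> where "continuous_map W W' \<Phi>" "cone_extension Z Y i q a i' q' a' \<phi> H \<Phi>"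
proof -
  note D = cone_attachedD[OF W] and D' = cone_attachedD[OF W']
  define G where "G = (\<lambda>p. if 2 * snd p \<le> 1 then i' (H (clamp01 (2 * snd p), fst p)) else q' (fst p, clamp01 (2 * snd p - 1)))"
  have G: "continuous_map (prod_topology Z unit_interval) W' G" unfolding G_def
    by (intro continuous_map_if_le continuous_map_comp1[OF D'(2)] continuous_map_comp2[OF D'(3)]
        continuous_map_comp2[OF H] continuous_map_clamp01 real_continuity) (auto simp: H01 D')
  have G0: "G (z, 0) = (i' \<circ> \<phi>) (f z)" "G (z, 1) = a'" if "z \<in> topspace Z" for z
    using that by (auto simp: G_def H01 D')
  let ?\<Phi> = "cone_map Z Y i q a (i' \<circ> \<phi>) G a'"
  have 1: "continuous_map W W' ?\<Phi>"
    by (rule cone_map_continuous[OF W continuous_map_compose[OF \<phi> D'(2)] G D'(4)]) (use G0 in auto)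
  have "cone_extension Z Y i q a i' q' a' \<phi> H ?\<Phi>"
    unfolding cone_extension_def using cone_map_simps[OF W, of G "i' \<circ> \<phi>" a', OF G0] by (simp add: G_def)
  with 1 show ?thesis by (rule that)
qed

text \<open>Only one of the two composites is controlled. \<open>K\<close> is built from
  \<open>A\<close> and from \<open>H\<close> reversed, so that on the cylinder
  \<open>\<Psi> \<circ> \<Phi>\<close> makes a detour that cancels. The other composite is reached
  by applying the lemma again to \<open>\<Psi>\<close>, which yields a possibly different map on its
  other side.\<close>

lemma cone_extension_left_inverse:
  assumes W: "cone_attached Z Y f W i q a" and W': "cone_attached Z Y' f' W' i' q' a'"
    and \<phi>: "continuous_map Y Y' \<phi>" and \<phi>': "continuous_map Y' Y \<phi>'" and hom: "homotopic Y Y (\<phi>' \<circ> \<phi>) id"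
    and H: "continuous_map (prod_topology unit_interval Z) Y' H"
    and H01: "\<And>z. z \<in> topspace Z \<Longrightarrow> H (0, z) = \<phi> (f z)" "\<And>z. z \<in> topspace Z \<Longrightarrow> H (1, z) = f' z"
    and ext: "cone_extension Z Y i q a i' q' a' \<phi> H \<Phi>"
  obtains \<Psi> K where "continuous_map W' W \<Psi>" "cone_extension Z Y' i' q' a' i q a \<phi>' K \<Psi>"
    "continuous_map (prod_topology unit_interval Z) Y K"
    "\<forall>z\<in>topspace Z. K (0, z) = \<phi>' (f' z)" "\<forall>z\<in>topspace Z. K (1, z) = f z"
    "homotopic W W (\<Psi> \<circ> \<Phi>) id"
proof -
  note D = cone_attachedD[OF W] and D' = cone_attachedD[OF W']
  obtain A where A: "continuous_map (prod_topology unit_interval Y) Y A"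
    "\<And>y. A (0, y) = \<phi>' (\<phi> y)" "\<And>y. A (1, y) = y"
    using hom by (auto elim!: homotopicE)
  \<comment> \<open>From \<open>\<phi>' \<circ> f'\<close> back along the image of \<open>H\<close>
    to \<open>\<phi>' \<circ> \<phi> \<circ> f\<close>, then along \<open>A\<close> to
    \<open>f\<close>.\<close>
  define K where "K = (\<lambda>p. if 2 * fst p \<le> 1 then \<phi>' (H (clamp01 (1 - 2 * fst p), snd p))
      else A (clamp01 (2 * fst p - 1), f (snd p)))"
  have K: "continuous_map (prod_topology unit_interval Z) Y K" unfolding K_def
    by (intro continuous_map_if_le continuous_map_comp1[OF \<phi>'] continuous_map_comp2[OF H]
        continuous_map_comp2[OF A(1)] continuous_map_comp1[OF D(1)] continuous_map_clamp01 real_continuity)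
      (auto simp: H01 A)
  have K01: "K (0, z) = \<phi>' (f' z)" "K (1, z) = f z" if "z \<in> topspace Z" for z
    using that by (auto simp: K_def H01 A)
  obtain \<Psi> where \<Psi>: "continuous_map W' W \<Psi>" and ext': "cone_extension Z Y' i' q' a' i q a \<phi>' K \<Psi>"
    using cone_extension_exists[OF W' W \<phi>' K K01] by blast
  \<comment> \<open>For fixed \<open>z\<close>, one path over the parameters from -1 to 2: the image
    of \<open>H\<close> reversed, then \<open>A\<close>, then the cylinder line up to the apex. On
    the cylinder both \<open>\<Psi> \<circ> \<Phi>\<close> and the identity are reparametrizations
    of it.\<close>
  define \<Gamma> where "\<Gamma> = (\<lambda>p. if snd p \<le> 0 then i (\<phi>' (H (clamp01 (- snd p), fst p)))
      else if snd p \<le> 1 then i (A (clamp01 (snd p), f (fst p))) else q (fst p, clamp01 (snd p - 1)))"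
  have \<Gamma>: "continuous_map (prod_topology Z euclideanreal) W \<Gamma>" unfolding \<Gamma>_def
    by (intro continuous_map_if_le continuous_map_comp1[OF D(2)] continuous_map_comp1[OF \<phi>'] continuous_map_comp2[OF H]
        continuous_map_comp2[OF A(1)] continuous_map_comp2[OF D(3)] continuous_map_comp1[OF D(1)] continuous_map_clamp01 real_continuity)
      (auto simp: H01 A D)
  \<comment> \<open>The parameter at which \<open>\<Psi> \<circ> \<Phi>\<close> meets this path.
    Composing the halvings puts the break points at 1/2, 5/8 and 3/4; \<open>8 * t - 5\<close>
    covers the middle two pieces, since \<open>\<Gamma>\<close> changes branch at 0. Interpolating
    linearly to \<open>1 + t\<close> cancels the detour and leaves \<open>A\<close> at
    \<open>t = 0\<close>.\<close>
  define \<theta> where "\<theta> = (\<lambda>t::real. if t \<le> 1/2 then - 2 * t else if t \<le> 3/4 then 8 * t - 5 else 4 * t - 2)"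
  have \<theta>: "continuous_map X euclideanreal (\<lambda>x. \<theta> (r x))" if "continuous_map X euclideanreal r" for X :: "'xx topology" and r
    unfolding \<theta>_def using that by (intro continuous_map_if_le real_continuity) auto
  define G where "G = (\<lambda>p. \<Gamma> (fst (snd p), (1 - fst p) * \<theta> (snd (snd p)) + fst p * (1 + snd (snd p))))"
  have G: "continuous_map (prod_topology unit_interval (prod_topology Z unit_interval)) W G"
    unfolding G_def by (intro continuous_map_comp2[OF \<Gamma>] real_continuity \<theta>)
  have fZ: "f z \<in> topspace Y" if "z \<in> topspace Z" for z
    using D(1) that continuous_map_image_subset_topspace by fastforce
  have HY: "H (s, z) \<in> topspace Y'" if "s \<in> {0..1}" "z \<in> topspace Z" for s z
    using H that continuous_map_image_subset_topspace by fastforce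
  have "homotopic W W (\<Psi> \<circ> \<Phi>) id"
  proof (rule cone_attached_homotopic[OF W _ G])
    show "continuous_map (prod_topology unit_interval Y) W (i \<circ> A)"
      by (rule continuous_map_compose[OF A(1) D(2)])
    show "continuous_map unit_interval W (\<lambda>_. a)" using D by simp
    show "G (s, z, 0) = (i \<circ> A) (s, f z)" "G (s, z, 1) = a" if "s \<in> {0..1}" "z \<in> topspace Z" for s z
      using that by (auto simp: G_def \<Gamma>_def \<theta>_def H01 A D algebra_simps)
    show "(\<Psi> \<circ> \<Phi>) (i y) = (i \<circ> A) (0, y)" if "y \<in> topspace Y" for y
      using ext ext' that continuous_map_image_subset_topspace[OF \<phi>] by (auto simp: cone_extension_def A)
    show "(\<Psi> \<circ> \<Phi>) a = a" using ext ext' by (simp add: cone_extension_def)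
    show "(\<Psi> \<circ> \<Phi>) (q (z, t)) = G (0, z, t)" if z: "z \<in> topspace Z" and t: "t \<in> {0..1}" for z t
    proof -
      consider "t \<le> 1/2" | "1/2 < t" "t \<le> 5/8" | "5/8 < t" "t \<le> 3/4" | "3/4 < t" by linarith
      then show ?thesis
      proof cases
        case 1
        then show ?thesis
          using ext ext' z t HY[of "2 * t" z] by (simp add: cone_extension_def G_def \<Gamma>_def \<theta>_def)
      next
        case 2
        then show ?thesis
          using ext ext' z t by (simp add: cone_extension_def G_def \<Gamma>_def \<theta>_def K_def algebra_simps)
      next
        case 3
        then show ?thesis
          using ext ext' z t by (simp add: cone_extension_def G_def \<Gamma>_def \<theta>_def K_def algebra_simps)
      next
        case 4
        then show ?thesis
          using ext ext' z t by (simp add: cone_extension_def G_def \<Gamma>_def \<theta>_def K_def algebra_simps)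
      qed
    qed
    show "id (q (z, t)) = G (1, z, t)" if z: "z \<in> topspace Z" and t: "t \<in> {0..1}" for z t
      using z t by (cases "t = 0") (simp_all add: G_def \<Gamma>_def A D)
  qed (simp_all add: A)
  then show ?thesis using that[of \<Psi> K] \<Psi> ext' K K01 by blast
qed

theorem cone_attached_equivalence_base:
  assumes W: "cone_attached Z Y f W i q a" and W': "cone_attached Z Y' f' W' i' q' a'"
    and \<phi>: "homotopy_equivalence Y Y' \<phi>" and H: "homotopic Z Y' (\<phi> \<circ> f) f'"
  obtains \<Phi> where "homotopy_equivalence W W' \<Phi>" "\<And>y. y \<in> topspace Y \<Longrightarrow> \<Phi> (i y) = i' (\<phi> y)"
proof -
  obtain \<phi>' where c: "continuous_map Y Y' \<phi>" "continuous_map Y' Y \<phi>'"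
    and h: "homotopic Y Y (\<phi>' \<circ> \<phi>) id" "homotopic Y' Y' (\<phi> \<circ> \<phi>') id"
    using \<phi> by (auto simp: homotopy_equivalence_def)
  obtain H' where H': "continuous_map (prod_topology unit_interval Z) Y' H'"
    "\<And>z. z \<in> topspace Z \<Longrightarrow> H' (0, z) = \<phi> (f z)" "\<And>z. z \<in> topspace Z \<Longrightarrow> H' (1, z) = f' z"
    using H by (auto elim!: homotopicE)
  obtain \<Phi> where \<Phi>: "continuous_map W W' \<Phi>" "cone_extension Z Y i q a i' q' a' \<phi> H' \<Phi>"
    by (rule cone_extension_exists[OF W W' c(1) H'])
  obtain \<Psi> K where \<Psi>: "continuous_map W' W \<Psi>" "cone_extension Z Y' i' q' a' i q a \<phi>' K \<Psi>"
    and K: "continuous_map (prod_topology unit_interval Z) Y K"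
    and K01: "\<forall>z\<in>topspace Z. K (0, z) = \<phi>' (f' z)" "\<forall>z\<in>topspace Z. K (1, z) = f z"
    and inv: "homotopic W W (\<Psi> \<circ> \<Phi>) id"
    by (rule cone_extension_left_inverse[OF W W' c h(1) H' \<Phi>(2)])
  obtain \<Phi>' K' where \<Phi>': "continuous_map W W' \<Phi>'" "cone_extension Z Y i q a i' q' a' \<phi> K' \<Phi>'"
    "continuous_map (prod_topology unit_interval Z) Y' K'"
    "\<forall>z\<in>topspace Z. K' (0, z) = \<phi> (f z)" "\<forall>z\<in>topspace Z. K' (1, z) = f' z"
    and inv': "homotopic W' W' (\<Phi>' \<circ> \<Psi>) id"
    by (rule cone_extension_left_inverse[OF W' W c(2,1) h(2) K K01[THEN bspec] \<Psi>(2)])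
  \<comment> \<open>\<open>\<Psi>\<close> has a right inverse \<open>\<Phi>\<close> and a left inverse \<open>\<Phi>'\<close> up to homotopy, so the two agree\<close>
  have 1: "homotopic W W' ((\<Phi>' \<circ> \<Psi>) \<circ> \<Phi>) (id \<circ> \<Phi>)"
    by (rule homotopic_with_compose_continuous_map_right[where p="\<lambda>_. True", OF inv' \<Phi>(1)]) simp
  have 2: "homotopic W W' (\<Phi>' \<circ> (\<Psi> \<circ> \<Phi>)) (\<Phi>' \<circ> id)"
    by (rule homotopic_with_compose_continuous_map_left[where p="\<lambda>_. True", OF inv \<Phi>'(1)]) simp
  have "homotopic W W' \<Phi> \<Phi>'"
    using homotopic_with_trans[OF homotopic_with_symD[OF 1] 2[unfolded o_assoc]] by (simp only: id_comp comp_id)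
  then have "homotopic W' W' (\<Phi> \<circ> \<Psi>) (\<Phi>' \<circ> \<Psi>)"
    by (rule homotopic_with_compose_continuous_map_right[where p="\<lambda>_. True", OF _ \<Psi>(1)]) simp
  then have "homotopic W' W' (\<Phi> \<circ> \<Psi>) id"
    by (rule homotopic_with_trans[OF _ inv'])
  then have "homotopy_equivalence W W' \<Phi>"
    by (rule homotopy_equivalenceI[OF \<Phi>(1) \<Psi>(1) inv])
  then show ?thesis
    using that \<Phi>(2) by (auto simp: cone_extension_def)
qed

lemma cone_attached_const_map:
  assumes W: "cone_attached Z Y (\<lambda>_. y0) W i q a" and W': "cone_attached Z' Y (\<lambda>_. y0) W' i' q' a'"
    and \<psi>: "continuous_map Z Z' \<psi>" and y0: "y0 \<in> topspace Y"
  obtains \<Phi> where "continuous_map W W' \<Phi>" "\<And>y. y \<in> topspace Y \<Longrightarrow> \<Phi> (i y) = i' y" "\<Phi> a = a'"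
    "\<And>z t. z \<in> topspace Z \<Longrightarrow> t \<in> {0..1} \<Longrightarrow> \<Phi> (q (z, t)) = q' (\<psi> z, t)"
proof -
  note D' = cone_attachedD[OF W']
  let ?G = "\<lambda>p. q' (\<psi> (fst p), clamp01 (snd p))"
  have pZ: "\<psi> z \<in> topspace Z'" if "z \<in> topspace Z" for z
    using that \<psi> continuous_map_image_subset_topspace by fastforce
  have G: "continuous_map (prod_topology Z unit_interval) W' ?G"
    by (intro continuous_map_comp2[OF D'(3)] continuous_map_comp1[OF \<psi>] continuous_map_clamp01 real_continuity)
  have G0: "?G (z, 0) = i' y0" "?G (z, 1) = a'" if "z \<in> topspace Z" for z
    using that pZ by (auto simp: D')
  show ?thesis
    using that[of "cone_map Z Y i q a i' ?G a'"] cone_map_continuous[OF W D'(2) G D'(4)] G0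
      cone_map_simps[OF W, of ?G i' a'] by auto
qed

text \<open>Both ends of the cylinder are mapped to single points, so a homotopy on \<open>Z\<close>
  can be applied at every height at once while the base stays pointwise fixed.\<close>

theorem cone_attached_equivalence_const:
  assumes W: "cone_attached Z Y (\<lambda>_. y0) W i q a" and W': "cone_attached Z' Y (\<lambda>_. y0) W' i' q' a'"
    and y0: "y0 \<in> topspace Y" and Z: "Z homotopy_equivalent_space Z'"
  obtains \<Phi> where "homotopy_equivalence W W' \<Phi>" "\<And>y. y \<in> topspace Y \<Longrightarrow> \<Phi> (i y) = i' y"
proof -
  have inverse: "homotopic W W (\<Psi> \<circ> \<Phi>) id"
    if W: "cone_attached Z Y (\<lambda>_. y0) W i q a"
      and \<psi>: "continuous_map Z Z' \<psi>" and hom: "homotopic Z Z (\<psi>' \<circ> \<psi>) id"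
      and \<Phi>: "\<And>y. y \<in> topspace Y \<Longrightarrow> \<Phi> (i y) = i' y" "\<Phi> a = a'"
        "\<And>z t. z \<in> topspace Z \<Longrightarrow> t \<in> {0..1} \<Longrightarrow> \<Phi> (q (z, t)) = q' (\<psi> z, t)"
      and \<Psi>: "\<And>y. y \<in> topspace Y \<Longrightarrow> \<Psi> (i' y) = i y" "\<Psi> a' = a"
        "\<And>z t. z \<in> topspace Z' \<Longrightarrow> t \<in> {0..1} \<Longrightarrow> \<Psi> (q' (z, t)) = q (\<psi>' z, t)"
    for Z :: "'p topology" and Z' :: "'q topology" and \<psi> \<psi>' \<Phi> \<Psi> i q a i' q' a' and W :: "'s topology"
  proof -
    note D = cone_attachedD[OF W]
    obtain B where B: "continuous_map (prod_topology unit_interval Z) Z B"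
      "\<And>z. B (0, z) = \<psi>' (\<psi> z)" "\<And>z. B (1, z) = z"
      using hom by (auto elim!: homotopicE)
    have BZ: "B (s, z) \<in> topspace Z" if "s \<in> {0..1}" "z \<in> topspace Z" for s z
      using B(1) that continuous_map_image_subset_topspace by fastforce
    have pZ: "\<psi> z \<in> topspace Z'" if "z \<in> topspace Z" for z
      using that \<psi> continuous_map_image_subset_topspace by fastforce
    let ?G = "\<lambda>p. q (B (clamp01 (fst p), fst (snd p)), clamp01 (snd (snd p)))"
    show ?thesis
    proof (rule cone_attached_homotopic[OF W])
      show "continuous_map (prod_topology unit_interval (prod_topology Z unit_interval)) W ?G"
        by (intro continuous_map_comp2[OF D(3)] continuous_map_comp2[OF B(1)] continuous_map_clamp01 real_continuity)
      show "continuous_map (prod_topology unit_interval Y) W (\<lambda>p. i (snd p))"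
        by (rule continuous_map_comp1[OF D(2) continuous_map_snd])
      show "continuous_map unit_interval W (\<lambda>_. a)" using D by simp
    qed (use D B BZ pZ \<Phi> \<Psi> in simp_all)
  qed
  obtain \<psi> \<psi>' where c: "continuous_map Z Z' \<psi>" "continuous_map Z' Z \<psi>'"
    and h: "homotopic Z Z (\<psi>' \<circ> \<psi>) id" "homotopic Z' Z' (\<psi> \<circ> \<psi>') id"
    using Z by (auto simp: homotopy_equivalent_space_def)
  obtain \<Phi> where \<Phi>: "continuous_map W W' \<Phi>" "\<And>y. y \<in> topspace Y \<Longrightarrow> \<Phi> (i y) = i' y" "\<Phi> a = a'"
    "\<And>z t. z \<in> topspace Z \<Longrightarrow> t \<in> {0..1} \<Longrightarrow> \<Phi> (q (z, t)) = q' (\<psi> z, t)"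
    using cone_attached_const_map[OF W W' c(1) y0] by blast
  obtain \<Psi> where \<Psi>: "continuous_map W' W \<Psi>" "\<And>y. y \<in> topspace Y \<Longrightarrow> \<Psi> (i' y) = i y" "\<Psi> a' = a"
    "\<And>z t. z \<in> topspace Z' \<Longrightarrow> t \<in> {0..1} \<Longrightarrow> \<Psi> (q' (z, t)) = q (\<psi>' z, t)"
    using cone_attached_const_map[OF W' W c(2) y0] by blast
  have "homotopy_equivalence W W' \<Phi>"
    by (rule homotopy_equivalenceI[OF \<Phi>(1) \<Psi>(1) inverse[OF W c(1) h(1) \<Phi>(2-4) \<Psi>(2-4)]
          inverse[OF W' c(2) h(2) \<Psi>(2-4) \<Phi>(2-4)]])
  then show ?thesis using that \<Phi> by blast
qed

text \<open>Provides the intermediate cone when base and link are exchanged one after the other. The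
  sum type keeps the pieces disjoint, and \<open>None\<close> is the apex.\<close>

lemma cone_attached_exists:
  fixes Z :: "'z topology" and Y :: "'y topology"
  assumes f: "continuous_map Z Y f"
  obtains W :: "('y + 'z \<times> real) option topology" and i q a where "cone_attached Z Y f W i q a"
proof -
  define i :: "'y \<Rightarrow> ('y + 'z \<times> real) option" where "i = (\<lambda>y. Some (Inl y))"
  define q :: "'z \<times> real \<Rightarrow> ('y + 'z \<times> real) option" where
    "q = (\<lambda>(z, t). if t = 0 then Some (Inl (f z)) else if t = 1 then None else Some (Inr (z, t)))"
  let ?C = "prod_topology Z unit_interval"
  define S where "S = insert None (i ` topspace Y) \<union> q ` (topspace Z \<times> {0<..<1})"
  define P where "P = (\<lambda>U. U \<subseteq> S \<and> openin Y {y \<in> topspace Y. i y \<in> U} \<and> openin ?C {p \<in> topspace ?C. q p \<in> U})"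
  have "istopology P"
    unfolding istopology_def
  proof (intro conjI allI impI)
    fix U V assume "P U" "P V"
    then show "P (U \<inter> V)" by (auto simp only: P_def preimage_Int intro: openin_Int)
  next
    fix \<K> assume *: "\<forall>U\<in>\<K>. P U"
    then show "P (\<Union>\<K>)" by (auto simp only: P_def preimage_Union intro!: openin_Union)
  qed
  then have op: "openin (topology P) U \<longleftrightarrow> P U" for U by (simp add: topology_inverse')
  have fY: "f z \<in> topspace Y" if "z \<in> topspace Z" for z
    using that f continuous_map_image_subset_topspace by fastforce
  have qS: "q p \<in> S" if p: "p \<in> topspace ?C" for p
  proof -
    obtain z t where zt: "p = (z, t)" "z \<in> topspace Z" "t \<in> {0..1}" using p by auto
    then consider "t = 0" | "t = 1" | "(z, t) \<in> topspace Z \<times> {0<..<1}" by fastforce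
    then show ?thesis
    proof cases
      case 3
      then show ?thesis unfolding S_def zt by blast
    qed (use zt fY in \<open>auto simp: S_def q_def i_def\<close>)
  qed
  have "{y \<in> topspace Y. i y \<in> S} = topspace Y" "{p \<in> topspace ?C. q p \<in> S} = topspace ?C"
    using qS by (auto simp only: S_def)
  then have "P S" by (simp only: P_def openin_topspace order_refl simp_thms)
  then have top: "topspace (topology P) = S"
    using op by (metis P_def openin_subset openin_topspace subset_antisym)
  have "\<forall>U\<subseteq>topspace (topology P). openin (topology P) U \<longleftrightarrow> openin Y {y \<in> topspace Y. i y \<in> U} \<and>
      openin ?C {p \<in> topspace Z \<times> {0..1}. q p \<in> U}"
  proof (intro allI impI)
    fix U assume "U \<subseteq> topspace (topology P)"
    then have "U \<subseteq> S" by (simp only: top)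
    then show "openin (topology P) U \<longleftrightarrow> openin Y {y \<in> topspace Y. i y \<in> U} \<and>
        openin ?C {p \<in> topspace Z \<times> {0..1}. q p \<in> U}"
      unfolding op by (simp add: P_def)
  qed
  moreover have "topspace (topology P) = insert None (i ` topspace Y) \<union> q ` (topspace Z \<times> {0<..<1})"
    unfolding top S_def ..
  moreover have "inj_on i (topspace Y)" "inj_on q (topspace Z \<times> {0<..<1})" "None \<notin> i ` topspace Y"
    "q ` (topspace Z \<times> {0<..<1}) \<inter> insert None (i ` topspace Y) = {}"
    "\<forall>z\<in>topspace Z. q (z, 0) = i (f z) \<and> q (z, 1) = None"
    by (auto simp: i_def q_def inj_on_def split: if_splits)
  ultimately have "cone_attached Z Y f (topology P) i q None"
    using f unfolding cone_attached_def by blast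
  then show ?thesis by (rule that)
qed

text \<open>The null-homotopy first makes the attaching map constant over the new base; only then
  can the link be exchanged. The values on \<open>Y\<close> are recorded because base points have to
  be followed through later steps.\<close>

theorem cone_attached_equivalence:
  fixes Z :: "'z topology" and Y' :: "'y topology"
  assumes W: "cone_attached Z Y f W i q a" and W': "cone_attached Z' Y' (\<lambda>_. y0) W' i' q' a'"
    and y0: "y0 \<in> topspace Y'" and \<phi>: "homotopy_equivalence Y Y' \<phi>"
    and null: "homotopic Z Y' (\<phi> \<circ> f) (\<lambda>_. y0)" and Z: "Z homotopy_equivalent_space Z'"
  obtains \<Phi> where "homotopy_equivalence W W' \<Phi>" "\<And>y. y \<in> topspace Y \<Longrightarrow> \<Phi> (i y) = i' (\<phi> y)"
proof -
  have "continuous_map Z Y' (\<lambda>_. y0)" using y0 by simp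
  then obtain V :: "('y + 'z \<times> real) option topology" and j p b where V: "cone_attached Z Y' (\<lambda>_. y0) V j p b"
    by (rule cone_attached_exists)
  obtain \<Phi> where \<Phi>: "homotopy_equivalence W V \<Phi>" "\<And>y. y \<in> topspace Y \<Longrightarrow> \<Phi> (i y) = j (\<phi> y)"
    using cone_attached_equivalence_base[OF W V \<phi> null] by blast
  obtain \<Psi> where \<Psi>: "homotopy_equivalence V W' \<Psi>" "\<And>y. y \<in> topspace Y' \<Longrightarrow> \<Psi> (j y) = i' y"
    using cone_attached_equivalence_const[OF V W' y0 Z] by blast
  have "\<phi> y \<in> topspace Y'" if "y \<in> topspace Y" for y
    using \<phi> that continuous_map_image_subset_topspace by (fastforce simp: homotopy_equivalence_def)
  then show ?thesis
    using that[OF homotopy_equivalence_compose[OF \<Phi>(1) \<Psi>(1)]] \<Phi>(2) \<Psi>(2) by simp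
qed

text \<open>Each cone is compared with a third one, on \<open>Z\<close> and attached to the common
  base \<open>Y\<close> by a constant map. For this both null-homotopies have to end at the same
  point \<open>y0\<close>.\<close>

corollary cone_attached_equivalent_spaces:
  fixes Z :: "'z topology" and Y :: "'y topology"
  assumes "cone_attached Z1 Y1 f1 W1 i1 q1 a1" "cone_attached Z2 Y2 f2 W2 i2 q2 a2" "y0 \<in> topspace Y"
    and "homotopy_equivalence Y1 Y \<phi>1" "homotopic Z1 Y (\<phi>1 \<circ> f1) (\<lambda>_. y0)"
    and "homotopy_equivalence Y2 Y \<phi>2" "homotopic Z2 Y (\<phi>2 \<circ> f2) (\<lambda>_. y0)"
    and "Z1 homotopy_equivalent_space Z" "Z2 homotopy_equivalent_space Z"
  shows "W1 homotopy_equivalent_space W2"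
proof -
  have "continuous_map Z Y (\<lambda>_. y0)" using assms(3) by simp
  then obtain V :: "('y + 'z \<times> real) option topology" and j p b where V: "cone_attached Z Y (\<lambda>_. y0) V j p b"
    by (rule cone_attached_exists)
  have "W1 homotopy_equivalent_space V" "W2 homotopy_equivalent_space V"
    unfolding homotopy_equivalent_space_iff_equivalence
    by (rule cone_attached_equivalence[OF assms(1) V assms(3,4,5,8)], rule exI, assumption)
       (rule cone_attached_equivalence[OF assms(2) V assms(3,6,7,9)], rule exI, assumption)
  then show ?thesis
    using homotopy_eqv_trans homotopy_equivalent_space_sym[of W2 V] by blast
qed

section \<open>Clique complexes of finite graphs\<close>

text \<open>The order complex of a merely reflexive relation is the clique complex of its comparability graph.
  This extra generality is what makes joins and wedges expressible.\<close>

abbreviation comparable :: "('v \<Rightarrow> 'v \<Rightarrow> bool) \<Rightarrow> 'v \<Rightarrow> 'v \<Rightarrow> bool" where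
  "comparable R x y \<equiv> R x y \<or> R y x"

text \<open>Conditions on the support replace the choice of a simplex, so the realization becomes
  one subset of the function space and its topology a subspace topology.\<close>

definition clique_points :: "('v \<Rightarrow> 'v \<Rightarrow> bool) \<Rightarrow> 'v set \<Rightarrow> ('v \<Rightarrow> real) set" where
  "clique_points R P = {u. (\<forall>v. 0 \<le> u v) \<and> (\<forall>v. u v \<noteq> 0 \<longrightarrow> v \<in> P) \<and> sum u P = 1 \<and>
     (\<forall>x y. u x \<noteq> 0 \<longrightarrow> u y \<noteq> 0 \<longrightarrow> comparable R x y)}"

abbreviation clique_space :: "('v \<Rightarrow> 'v \<Rightarrow> bool) \<Rightarrow> 'v set \<Rightarrow> ('v \<Rightarrow> real) topology" where
  "clique_space R P \<equiv> top_of_set (clique_points R P)"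

lemma closed_simplex_finite:
  assumes "finite P" "C \<subseteq> P"
  shows "closed_simplex C = {u. (\<forall>v. 0 \<le> u v) \<and> (\<forall>v. v \<notin> C \<longrightarrow> u v = 0) \<and> sum u P = 1}"
proof -
  have "sum u C = sum u P" if "\<forall>v. v \<notin> C \<longrightarrow> u v = 0" for u :: "'a \<Rightarrow> real"
    using that assms by (intro sum.mono_neutral_left) auto
  then show ?thesis by (auto simp: closed_simplex_def)
qed

lemma continuous_on_coordinate: "continuous_on S (\<lambda>u::'v \<Rightarrow> real. u v)"
  using continuous_on_product_coordinates[of v] continuous_on_subset by blast

lemma closed_closed_simplex:
  assumes "finite C" shows "closed (closed_simplex C)"
proof -
  have "closed_simplex C = {u. \<forall>v. 0 \<le> u v} \<inter> {u. \<forall>v. v \<notin> C \<longrightarrow> u v = 0} \<inter> {u. sum u C = 1}"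
    by (auto simp: closed_simplex_def)
  moreover have "closed {u::'a \<Rightarrow> real. \<forall>v. 0 \<le> u v}"
    by (intro closed_Collect_all closed_Collect_le continuous_on_coordinate continuous_on_const)
  moreover have "closed {u::'a \<Rightarrow> real. \<forall>v. v \<notin> C \<longrightarrow> u v = 0}"
    by (intro closed_Collect_all closed_Collect_imp open_Collect_const closed_Collect_eq
        continuous_on_coordinate continuous_on_const)
  moreover have "closed {u::'a \<Rightarrow> real. sum u C = 1}"
    by (intro closed_Collect_eq continuous_on_sum continuous_on_coordinate continuous_on_const)
  ultimately show ?thesis by (simp add: closed_Int)
qed

lemma compact_closed_simplex:
  fixes C :: "'v set"
  assumes "finite C" shows "compact (closed_simplex C)"
proof -
  have "compactin (product_topology (\<lambda>i::'v. euclideanreal) UNIV) (PiE UNIV (\<lambda>_. {0..1}))"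
    by (simp add: compactin_PiE)
  then have "compact (PiE (UNIV::'v set) (\<lambda>_. {0..1::real}))"
    by (simp add: euclidean_product_topology)
  moreover have "closed_simplex C \<subseteq> PiE UNIV (\<lambda>_. {0..1})"
  proof
    fix u assume u: "u \<in> closed_simplex C"
    have "u v \<le> 1" for v
    proof (cases "v \<in> C")
      case True
      then have "u v \<le> sum u C"
        using u assms by (intro member_le_sum) (auto simp: closed_simplex_def)
      then show ?thesis using u by (simp add: closed_simplex_def)
    qed (use u in \<open>auto simp: closed_simplex_def\<close>)
    then show "u \<in> PiE UNIV (\<lambda>_. {0..1})" using u by (auto simp: closed_simplex_def)
  qed
  ultimately show ?thesis
    using compact_Int_closed[OF _ closed_closed_simplex[OF assms]] by (metis inf.absorb2)
qed

lemma clique_points_eq_Union: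
  assumes "finite P"
  shows "clique_points R P = (\<Union>C\<in>order_complex R P. closed_simplex C)"
proof
  show "clique_points R P \<subseteq> (\<Union>C\<in>order_complex R P. closed_simplex C)"
  proof
    fix u assume u: "u \<in> clique_points R P"
    let ?C = "{v. u v \<noteq> 0}"
    have C: "?C \<subseteq> P" using u by (auto simp: clique_points_def)
    then have "?C \<in> order_complex R P"
      using u finite_subset[OF _ assms] by (auto simp: clique_points_def order_complex_def Complete_Partial_Order.chain_def)
    moreover have "u \<in> closed_simplex ?C"
      unfolding closed_simplex_finite[OF assms C] using u by (auto simp: clique_points_def)
    ultimately show "u \<in> (\<Union>C\<in>order_complex R P. closed_simplex C)" by blast
  qed
  show "(\<Union>C\<in>order_complex R P. closed_simplex C) \<subseteq> clique_points R P"
  proof clarify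
    fix C u assume C: "C \<in> order_complex R P" and u: "u \<in> closed_simplex C"
    then have "C \<subseteq> P" by (auto simp: order_complex_def)
    with u have "(\<forall>v. 0 \<le> u v) \<and> (\<forall>v. v \<notin> C \<longrightarrow> u v = 0) \<and> sum u P = 1"
      by (simp add: closed_simplex_finite[OF assms])
    then show "u \<in> clique_points R P"
      using C unfolding clique_points_def order_complex_def Complete_Partial_Order.chain_def by blast
  qed
qed

lemma finite_order_complex: "finite P \<Longrightarrow> finite (order_complex R P)"
  by (rule finite_subset[of _ "Pow P"]) (auto simp: order_complex_def)

lemma compact_clique_points:
  assumes "finite P" shows "compact (clique_points R P)"
  unfolding clique_points_eq_Union[OF assms]
  by (intro compact_UN finite_order_complex assms compact_closed_simplex) (auto simp: order_complex_def)

text \<open>There are finitely many simplices, each compact and hence closed in the function space.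
  A set that is relatively closed in every simplex is then a finite union of closed sets.\<close>

theorem geom_realization_order_complex:
  assumes "finite P"
  shows "geom_realization (order_complex R P) = clique_space R P"
proof (rule topology_eq[THEN iffD2], intro allI)
  fix U :: "('a \<Rightarrow> real) set"
  let ?K = "order_complex R P"
  let ?S = "clique_points R P"
  have fin: "finite C" if "C \<in> ?K" for C using that by (simp add: order_complex_def)
  have "openin (geom_realization ?K) U \<longleftrightarrow> U \<subseteq> ?S \<and>
      (\<forall>C\<in>?K. openin (top_of_set (closed_simplex C)) (U \<inter> closed_simplex C))"
    unfolding openin_geom_realization clique_points_eq_Union[OF assms] euclidean_product_topology ..
  also have "\<dots> \<longleftrightarrow> openin (top_of_set ?S) U"
  proof safe
    assume U: "U \<subseteq> ?S" and op: "\<forall>C\<in>?K. openin (top_of_set (closed_simplex C)) (U \<inter> closed_simplex C)"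
    have "closedin (top_of_set ?S) (closed_simplex C - U)" if C: "C \<in> ?K" for C
    proof -
      have "closedin (top_of_set (closed_simplex C)) (closed_simplex C - U \<inter> closed_simplex C)"
        using op C by (metis closedin_diff closedin_topspace topspace_euclidean_subtopology)
      then have "closedin (top_of_set (closed_simplex C)) (closed_simplex C - U)"
        by (simp add: Diff_Int_distrib2 Diff_Int2 Diff_Int)
      then have "closed (closed_simplex C - U)"
        using closedin_closed_trans closed_closed_simplex fin C by blast
      moreover have "closed_simplex C - U \<subseteq> ?S"
        using C by (auto simp: clique_points_eq_Union[OF assms])
      ultimately show ?thesis by (simp add: closed_subset)
    qed
    then have "closedin (top_of_set ?S) (\<Union>C\<in>?K. closed_simplex C - U)"
      using finite_order_complex[OF assms] by (intro closedin_Union) auto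
    moreover have "?S - U = (\<Union>C\<in>?K. closed_simplex C - U)"
      by (auto simp: clique_points_eq_Union[OF assms])
    ultimately show "openin (top_of_set ?S) U"
      using U by (simp add: openin_closedin_eq)
  next
    fix C assume "openin (top_of_set ?S) U" "C \<in> ?K"
    then obtain T where T: "open T" "U = ?S \<inter> T" by (auto simp: openin_open)
    have "closed_simplex C \<subseteq> ?S" using \<open>C \<in> ?K\<close> by (auto simp: clique_points_eq_Union[OF assms])
    then have "U \<inter> closed_simplex C = closed_simplex C \<inter> T" using T by blast
    then show "openin (top_of_set (closed_simplex C)) (U \<inter> closed_simplex C)"
      using T by (simp add: openin_open_Int)
  next
    fix u assume "openin (top_of_set ?S) U" "u \<in> U"
    then show "u \<in> ?S" using openin_imp_subset by blast
  qed
  finally show "openin (geom_realization ?K) U = openin (top_of_set ?S) U" .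
qed

lemma indicator_in_clique_points:
  assumes "finite P" "v \<in> P" "R v v"
  shows "indicator {v} \<in> clique_points R P"
proof -
  have "sum (indicator {v}) P = (1::real)"
    using assms by (simp add: indicator_def)
  then show ?thesis using assms by (auto simp: clique_points_def indicator_def split: if_splits)
qed

lemma clique_points_empty [simp]: "clique_points R {} = {}"
  by (simp add: clique_points_def)

lemma clique_points_mono:
  assumes "finite P" "Q \<subseteq> P" "\<And>x y. x \<in> Q \<Longrightarrow> y \<in> Q \<Longrightarrow> R x y \<Longrightarrow> R' x y"
  shows "clique_points R Q \<subseteq> clique_points R' P"
proof
  fix u assume u: "u \<in> clique_points R Q"
  then have "sum u Q = sum u P"
    using assms(1,2) by (intro sum.mono_neutral_left) (auto simp: clique_points_def)
  moreover have supp: "x \<in> Q" if "u x \<noteq> 0" for x using u that by (simp add: clique_points_def)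
  moreover have "comparable R' x y" if "u x \<noteq> 0" "u y \<noteq> 0" for x y
  proof -
    have "comparable R x y" using u that by (simp add: clique_points_def)
    then show ?thesis using assms(3) supp that by blast
  qed
  ultimately show "u \<in> clique_points R' P"
    using u assms(2) by (auto simp: clique_points_def)
qed

section \<open>Simplicial maps in barycentric coordinates\<close>

definition push_forward :: "'v set \<Rightarrow> ('v \<Rightarrow> 'w) \<Rightarrow> ('v \<Rightarrow> real) \<Rightarrow> 'w \<Rightarrow> real" where
  "push_forward P f u = (\<lambda>w. \<Sum>v\<in>P. if f v = w then u v else 0)"

lemma push_forward_nonzero:
  assumes "push_forward P f u w \<noteq> 0"
  obtains v where "v \<in> P" "f v = w" "u v \<noteq> 0"
proof -
  obtain v where v: "v \<in> P" "(if f v = w then u v else 0) \<noteq> 0"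
    using assms unfolding push_forward_def by (rule sum.not_neutral_contains_not_neutral)
  show ?thesis by (rule that[OF v(1)]) (use v(2) in \<open>auto split: if_splits\<close>)
qed

lemma sum_push_forward:
  assumes "finite P" "finite P'" "f ` P \<subseteq> P'"
  shows "sum (push_forward P f u) P' = sum u P"
proof -
  have "sum (push_forward P f u) P' = (\<Sum>v\<in>P. \<Sum>w\<in>P'. if f v = w then u v else 0)"
    unfolding push_forward_def by (rule sum.swap)
  also have "\<dots> = sum u P"
    using assms by (intro sum.cong refl) (auto simp: sum.delta)
  finally show ?thesis .
qed

lemma push_forward_nonneg: "(\<And>v. 0 \<le> u v) \<Longrightarrow> 0 \<le> push_forward P f u w"
  unfolding push_forward_def by (intro sum_nonneg) auto

lemma push_forward_compose:
  assumes "finite P" "finite P'" "f ` P \<subseteq> P'"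
  shows "push_forward P' g (push_forward P f u) = push_forward P (g \<circ> f) u"
proof
  fix w
  have "push_forward P' g (push_forward P f u) w
      = (\<Sum>v\<in>P'. \<Sum>x\<in>P. if g v = w then (if f x = v then u x else 0) else 0)"
    unfolding push_forward_def by (intro sum.cong refl) auto
  also have "\<dots> = (\<Sum>x\<in>P. \<Sum>v\<in>P'. if f x = v then (if g v = w then u x else 0) else 0)"
    by (subst sum.swap) (intro sum.cong refl; auto)
  also have "\<dots> = push_forward P (g \<circ> f) u w"
    unfolding push_forward_def using assms by (intro sum.cong refl) (auto simp: sum.delta)
  finally show "push_forward P' g (push_forward P f u) w = push_forward P (g \<circ> f) u w" .
qed

lemma push_forward_id:
  assumes "finite P" "u \<in> clique_points R P" "\<And>v. v \<in> P \<Longrightarrow> f v = v"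
  shows "push_forward P f u = u"
proof
  fix w
  have "push_forward P f u w = (\<Sum>v\<in>P. if v = w then u v else 0)"
    unfolding push_forward_def using assms(3) by (intro sum.cong) auto
  then show "push_forward P f u w = u w"
    using assms(1,2) by (auto simp: clique_points_def)
qed

lemma push_forward_const:
  assumes "finite P" "u \<in> clique_points R P" "\<And>v. v \<in> P \<Longrightarrow> f v = c"
  shows "push_forward P f u = indicator {c}"
proof
  fix w
  have "push_forward P f u w = (\<Sum>v\<in>P. if c = w then u v else 0)"
    unfolding push_forward_def using assms(3) by (intro sum.cong) auto
  then show "push_forward P f u w = indicator {c} w"
    using assms(2) by (auto simp: clique_points_def indicator_def)
qed

lemma push_forward_indicator:
  assumes "finite P" "v \<in> P"
  shows "push_forward P f (indicator {v}) = indicator {f v}"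
proof
  fix w
  have "push_forward P f (indicator {v}) w = (\<Sum>x\<in>P. if x = v then (if f v = w then 1 else 0) else 0)"
    unfolding push_forward_def by (intro sum.cong) (auto simp: indicator_def)
  then show "push_forward P f (indicator {v}) w = indicator {f v} w"
    using assms by (auto simp: indicator_def)
qed

lemma push_forward_cong:
  assumes "\<And>v. v \<in> P \<Longrightarrow> f v = g v" shows "push_forward P f = push_forward P g"
  unfolding push_forward_def using assms by (intro ext sum.cong) auto

lemma push_forward_restrict:
  assumes "finite P" "Q \<subseteq> P" "u \<in> clique_points R Q"
  shows "push_forward P f u = push_forward Q f u"
  unfolding push_forward_def
  using assms by (intro ext sum.mono_neutral_right) (auto simp: clique_points_def)

lemma continuous_on_push_forward: "continuous_on S (\<lambda>u. push_forward P f u w)"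
  unfolding push_forward_def
proof (rule continuous_on_sum)
  show "continuous_on S (\<lambda>u. if f v = w then u v else 0)" for v
    by (cases "f v = w") (simp_all add: continuous_on_coordinate)
qed

text \<open>For contiguous maps the straight-line homotopy stays inside the complex.\<close>

lemma homotopic_push_forward_contiguous:
  assumes fin: "finite P" "finite P'" and f: "f ` P \<subseteq> P'" and g: "g ` P \<subseteq> P'"
    and ff: "\<And>x y. x \<in> P \<Longrightarrow> y \<in> P \<Longrightarrow> R x y \<Longrightarrow> comparable R' (f x) (f y)"
    and gg: "\<And>x y. x \<in> P \<Longrightarrow> y \<in> P \<Longrightarrow> R x y \<Longrightarrow> comparable R' (g x) (g y)"
    and fg: "\<And>x y. x \<in> P \<Longrightarrow> y \<in> P \<Longrightarrow> comparable R x y \<Longrightarrow> comparable R' (f x) (g y)"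
  shows "homotopic (clique_space R P) (clique_space R' P') (push_forward P f) (push_forward P g)"
proof -
  let ?h = "\<lambda>p w. (1 - fst p) * push_forward P f (snd p) w + fst p * push_forward P g (snd p) w"
  have "continuous_on ({0..1} \<times> clique_points R P) ?h"
    by (intro continuous_on_coordinatewise_then_product continuous_on_add continuous_on_mult continuous_on_diff
        continuous_on_const continuous_on_fst continuous_on_id
        continuous_on_compose2[OF continuous_on_push_forward[of UNIV] continuous_on_snd]) auto
  moreover have "?h p \<in> clique_points R' P'" if "p \<in> {0..1} \<times> clique_points R P" for p
  proof -
    obtain t u where p: "p = (t, u)" "0 \<le> t" "t \<le> 1" and u: "u \<in> clique_points R P" using \<open>p \<in> _\<close> by auto
    define k where "k = ?h p"
    have k: "k w = (1 - t) * push_forward P f u w + t * push_forward P g u w" for w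
      by (simp add: k_def p)
    have nonneg: "0 \<le> push_forward P f u w" "0 \<le> push_forward P g u w" for w
      using u by (auto intro!: push_forward_nonneg simp: clique_points_def)
    have "sum (k) P' = (1 - t) * sum (push_forward P f u) P' + t * sum (push_forward P g u) P'"
      by (simp add: k sum.distrib sum_distrib_left)
    also have "\<dots> = 1" using u by (simp add: sum_push_forward fin f g clique_points_def)
    finally have "sum (k) P' = 1" .
    moreover have supp: "\<exists>v\<in>P. u v \<noteq> 0 \<and> (w = f v \<or> w = g v)" if "k w \<noteq> 0" for w
    proof -
      have "push_forward P f u w \<noteq> 0 \<or> push_forward P g u w \<noteq> 0" using that by (auto simp: k)
      then show ?thesis by (elim disjE push_forward_nonzero) blast+
    qed
    have cmp: "comparable R x y" if "u x \<noteq> 0" "u y \<noteq> 0" for x y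
      using u that by (simp add: clique_points_def)
    have "comparable R' w w'" if ww: "k w \<noteq> 0" "k w' \<noteq> 0" for w w'
    proof -
      obtain v where v: "v \<in> P" "u v \<noteq> 0" "w = f v \<or> w = g v" using supp[OF ww(1)] by blast
      obtain v' where v': "v' \<in> P" "u v' \<noteq> 0" "w' = f v' \<or> w' = g v'" using supp[OF ww(2)] by blast
      have "comparable R v v'" using cmp v(2) v'(2) .
      then show ?thesis
        using v v' ff[of v v'] ff[of v' v] gg[of v v'] gg[of v' v] fg[of v v'] fg[of v' v] by metis
    qed
    moreover have "w \<in> P'" if "k w \<noteq> 0" for w
      using supp[OF that] f g by auto
    moreover have "0 \<le> k w" for w using nonneg p by (simp add: k)
    ultimately show ?thesis unfolding clique_points_def k_def by blast
  qed
  ultimately have "continuous_map (top_of_set ({0..1} \<times> clique_points R P)) (clique_space R' P') ?h"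
    unfolding continuous_map_subtopology_eu by blast
  then have "continuous_map (prod_topology unit_interval (clique_space R P)) (clique_space R' P') ?h"
    unfolding prod_topology_subtopology_eu .
  then show ?thesis
    by (rule homotopicI) simp_all
qed

lemma continuous_map_push_forward:
  assumes "finite P" "finite P'" "f ` P \<subseteq> P'"
    and "\<And>x y. x \<in> P \<Longrightarrow> y \<in> P \<Longrightarrow> R x y \<Longrightarrow> comparable R' (f x) (f y)"
  shows "continuous_map (clique_space R P) (clique_space R' P') (push_forward P f)"
proof -
  have "comparable R' (f x) (f y)" if "x \<in> P" "y \<in> P" "comparable R x y" for x y
    using assms(4)[of x y] assms(4)[of y x] that by auto
  then have "homotopic (clique_space R P) (clique_space R' P') (push_forward P f) (push_forward P f)"
    using assms(4) by (intro homotopic_push_forward_contiguous[OF assms(1,2,3,3)]) auto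
  then show ?thesis by (rule conjunct1[OF homotopic_with_imp_continuous_maps])
qed

text \<open>Comparable monotone maps need not be contiguous, but one gets from one to the other by changing the
  values at single elements from the top down, and each such step is contiguous.\<close>

lemma homotopic_push_forward_le:
  assumes fin: "finite P" "finite P'"
    and R: "antisymp_on P R" "transp_on P R" "reflp_on P R"
    and R': "reflp_on P' R'" "transp_on P' R'"
    and f: "f ` P \<subseteq> P'" "monotone_on P R R' f" and g: "g ` P \<subseteq> P'" "monotone_on P R R' g"
    and le: "\<And>x. x \<in> P \<Longrightarrow> R' (f x) (g x)"
  shows "homotopic (clique_space R P) (clique_space R' P') (push_forward P f) (push_forward P g)"
proof -
  have tr: "R' x z" if "R' x y" "R' y z" "x \<in> P'" "y \<in> P'" "z \<in> P'" for x y z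
    by (rule transp_onD[OF R'(2) that(3,4,5,1,2)])
  have fP: "f x \<in> P'" "g x \<in> P'" if "x \<in> P" for x using f g that by auto
  have mono: "R' (f x) (f y)" "R' (g x) (g y)" if "x \<in> P" "y \<in> P" "R x y" for x y
    using monotone_onD[OF f(2) that] monotone_onD[OF g(2) that] by blast+
  \<comment> \<open>\<open>U\<close> will range over the up-sets of \<open>P\<close>: on
    \<open>U\<close> the values are already those of \<open>g\<close>, elsewhere still those of
    \<open>f\<close>.\<close>
  define h where "h = (\<lambda>U x. if x \<in> U then g x else f x)"
  have hP: "h U ` P \<subseteq> P'" for U using fP by (auto simp: h_def)
  have "homotopic (clique_space R P) (clique_space R' P') (push_forward P f) (push_forward P (h U))"
    if "finite U" "U \<subseteq> P" "\<And>x y. x \<in> U \<Longrightarrow> y \<in> P \<Longrightarrow> R x y \<Longrightarrow> y \<in> U" for U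
    using that
  proof (induction "card U" arbitrary: U)
    case 0
    then have "h U = f" by (auto simp: h_def)
    have "continuous_map (clique_space R P) (clique_space R' P') (push_forward P f)"
      by (rule continuous_map_push_forward[OF fin f(1)]) (simp add: mono)
    then show ?case unfolding \<open>h U = f\<close> homotopic_with_refl by blast
  next
    case (Suc n)
    then have "U \<noteq> {}" by auto
    \<comment> \<open>Counting the elements below makes \<open>x0\<close> minimal in
      \<open>U\<close>, so that removing it leaves an up-set again.\<close>
    then obtain x0 where x0: "x0 \<in> U" "\<And>x. x \<in> U \<Longrightarrow> card {y \<in> U. R y x0} \<le> card {y \<in> U. R y x}"
      using ex_has_least_nat[of "\<lambda>x. x \<in> U" _ "\<lambda>x. card {y \<in> U. R y x}"] by blast
    have min: "x = x0" if x: "x \<in> U" "R x x0" for x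
    proof (rule ccontr)
      assume "x \<noteq> x0"
      have P: "x \<in> P" "x0 \<in> P" using x x0(1) Suc.prems(2) by auto
      have "\<not> R x0 x" using antisymp_onD[OF R(1) P x(2)] \<open>x \<noteq> x0\<close> by blast
      moreover have "{y \<in> U. R y x} \<subseteq> {y \<in> U. R y x0}"
      proof clarify
        fix y assume "y \<in> U" "R y x"
        then show "R y x0" using transp_onD[OF R(2) _ P _ x(2)] Suc.prems(2) by blast
      qed
      moreover have "R x0 x0" by (rule reflp_onD[OF R(3) P(2)])
      ultimately have "{y \<in> U. R y x} \<subset> {y \<in> U. R y x0}" using x0(1) by blast
      then have "card {y \<in> U. R y x} < card {y \<in> U. R y x0}"
        using Suc.prems(1) by (intro psubset_card_mono) auto
      then show False using x0(2)[OF x(1)] by simp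
    qed
    define V where "V = U - {x0}"
    have "homotopic (clique_space R P) (clique_space R' P') (push_forward P f) (push_forward P (h V))"
      using Suc.prems Suc.hyps(2) x0(1) min by (intro Suc.hyps(1)) (auto simp: V_def)
    moreover have "homotopic (clique_space R P) (clique_space R' P') (push_forward P (h V)) (push_forward P (h U))"
    proof (rule homotopic_push_forward_contiguous[OF fin hP hP])
      have hmono: "R' (h A x) (h A y)" if "x \<in> P" "y \<in> P" "R x y" "x \<in> A \<longrightarrow> y \<in> A" for A x y
        using that mono[OF that(1-3)] tr[OF mono(1)[OF that(1-3)] le[OF that(2)]] fP[OF that(1)] fP[OF that(2)]
        by (simp add: h_def)
      show "comparable R' (h V x) (h V y)" if "x \<in> P" "y \<in> P" "R x y" for x y
      proof -
        have "y \<in> V" if "x \<in> V"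
          using Suc.prems(3)[of x y] min[of x] \<open>y \<in> P\<close> \<open>R x y\<close> that unfolding V_def by blast
        then show ?thesis using hmono[OF that, of V] by blast
      qed
      show "comparable R' (h U x) (h U y)" if "x \<in> P" "y \<in> P" "R x y" for x y
        using hmono[OF that, of U] Suc.prems(3)[OF _ that(2,3)] by blast
      \<comment> \<open>The two maps differ only at \<open>x0\<close>. There a comparable
        \<open>y\<close> in \<open>U\<close> lies above \<open>x0\<close>, so \<open>f x0\<close> is
        below \<open>g x0\<close> and hence below \<open>g y\<close>; a comparable \<open>y\<close>
        outside \<open>U\<close> lies below \<open>x0\<close>, so \<open>f y\<close> is below
        \<open>f x0\<close>.\<close>
      show "comparable R' (h V x) (h U y)" if "x \<in> P" "y \<in> P" "comparable R x y" for x y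
      proof (cases "x = x0")
        case True
        then have [simp]: "h V x = f x0" "x0 \<in> P" using x0(1) Suc.prems(2) by (auto simp: h_def V_def)
        show ?thesis
        proof (cases "y \<in> U")
          case True
          then have "R x0 y" using min[of y] that \<open>x = x0\<close> reflp_onD[OF R(3), of x0] by auto
          then have "R' (f x0) (g y)" using tr[OF le[of x0] mono(2)[of x0 y]] that fP by simp
          moreover have "h U y = g y" using True by (simp add: h_def)
          ultimately show ?thesis by simp
        next
          case False
          then have "R y x0" using Suc.prems(3)[OF x0(1)] that \<open>x = x0\<close> by auto
          then have "R' (f y) (f x0)" using mono(1)[of y x0] that by simp
          moreover have "h U y = f y" using False by (simp add: h_def)
          ultimately show ?thesis by simp
        qed
      next
        case False
        then have "h V x = h U x" by (simp add: h_def V_def)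
        then show ?thesis using hmono[of x y U] hmono[of y x U] that Suc.prems(3) by auto
      qed
    qed
    ultimately show ?case by (rule homotopic_with_trans)
  qed
  from this[of P] have "homotopic (clique_space R P) (clique_space R' P') (push_forward P f) (push_forward P (h P))"
    using fin by auto
  moreover have "push_forward P (h P) = push_forward P g"
    by (rule push_forward_cong) (simp add: h_def)
  ultimately show ?thesis by simp
qed

section \<open>Adding a vertex as attaching a cone\<close>

lemma Hausdorff_space_real_functions: "Hausdorff_space (euclidean :: ('v \<Rightarrow> real) topology)"
proof -
  have "Hausdorff_space (product_topology (\<lambda>_::'v. euclideanreal) UNIV)"
    by (simp add: Hausdorff_space_product_topology)
  then show ?thesis by (simp only: euclidean_product_topology)
qed

lemma compact_imp_closed_real_functions:
  fixes A :: "('v \<Rightarrow> real) set"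
  assumes "compact A" shows "closed A"
  using compactin_imp_closedin[OF Hausdorff_space_real_functions, of A] assms by simp

definition cone_point :: "'v \<Rightarrow> ('v \<Rightarrow> real) \<times> real \<Rightarrow> 'v \<Rightarrow> real" where
  "cone_point m = (\<lambda>(z, t) v. (1 - t) * z v + t * indicator {m} v)"

lemma clique_points_insert_cases:
  assumes fin: "finite P" and m: "m \<notin> P" and w: "w \<in> clique_points R (insert m P)"
  obtains (base) "w \<in> clique_points R P" | (apex) "w = indicator {m}"
    | (cone) z t where "z \<in> clique_points R {x \<in> P. comparable R x m}" "0 < t" "t < 1" "w = cone_point m (z, t)"
proof -
  have nonneg: "0 \<le> w v" for v using w by (simp add: clique_points_def)
  have supp: "v = m \<or> v \<in> P" if "w v \<noteq> 0" for v using w that by (auto simp: clique_points_def)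
  have cmp: "comparable R x y" if "w x \<noteq> 0" "w y \<noteq> 0" for x y using w that by (auto simp: clique_points_def)
  have sum1: "w m + sum w P = 1" using w fin m by (simp add: clique_points_def)
  have le: "w v \<le> sum w P" if "v \<in> P" for v
    using that fin nonneg by (intro member_le_sum) auto
  have "0 \<le> sum w P" by (intro sum_nonneg) (simp add: nonneg)
  then consider "w m = 0" | "w m = 1" | "0 < w m" "w m < 1"
    using nonneg[of m] sum1 by linarith
  then show thesis
  proof cases
    case 1
    have "v \<in> P" if "w v \<noteq> 0" for v using supp[OF that] 1 that by auto
    then have "w \<in> clique_points R P" using 1 sum1 nonneg cmp by (simp add: clique_points_def)
    then show thesis by (rule base)
  next
    case 2
    have "w v = indicator {m} v" for v
    proof (cases "v = m")
      case False
      then show ?thesis using supp[of v] le[of v] nonneg[of v] sum1 2 by (cases "v \<in> P") auto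
    qed (simp add: 2)
    then show thesis by (intro apex) auto
  next
    case 3
    \<comment> \<open>The weight of \<open>m\<close> is the height in the cone. The remaining
      weights are rescaled to sum 1; their support lies in the link because every vertex of the
      support of \<open>w\<close> is comparable with \<open>m\<close>.\<close>
    define z where "z = (\<lambda>v. if v = m then 0 else w v / (1 - w m))"
    let ?L = "{x \<in> P. comparable R x m}"
    have zw: "w v \<noteq> 0" "v \<noteq> m" if "z v \<noteq> 0" for v using that by (auto simp: z_def split: if_splits)
    have "v \<in> ?L" if "z v \<noteq> 0" for v
      using zw[OF that] supp[of v] cmp[of v m] 3 by auto
    moreover have "sum z ?L = 1"
    proof -
      have "sum z ?L = sum z P"
        using calculation fin by (intro sum.mono_neutral_left) auto
      also have "\<dots> = (\<Sum>v\<in>P. w v / (1 - w m))"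
        using m by (intro sum.cong) (auto simp: z_def)
      also have "\<dots> = sum w P / (1 - w m)" by (simp add: sum_divide_distrib)
      also have "\<dots> = 1" using sum1 3 by simp
      finally show ?thesis .
    qed
    moreover have "0 \<le> z v" for v using nonneg 3 by (simp add: z_def)
    moreover have "comparable R x y" if "z x \<noteq> 0" "z y \<noteq> 0" for x y using zw that cmp by blast
    ultimately have "z \<in> clique_points R ?L" unfolding clique_points_def by blast
    moreover have "w = cone_point m (z, w m)"
      using 3 by (auto simp: cone_point_def z_def indicator_def fun_eq_iff)
    ultimately show thesis using 3 by (intro cone)
  qed
qed

lemma cone_point_in_clique_points:
  assumes fin: "finite P" and m: "m \<notin> P" and "R m m"
    and z: "z \<in> clique_points R {x \<in> P. comparable R x m}" and t: "0 \<le> t" "t \<le> 1"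
  shows "cone_point m (z, t) \<in> clique_points R (insert m P)"
proof -
  let ?w = "cone_point m (z, t)"
  have zL: "v \<in> P" "v \<noteq> m" "comparable R v m" if "z v \<noteq> 0" for v
    using z that m by (auto simp: clique_points_def)
  have supp: "v = m \<or> z v \<noteq> 0" if "?w v \<noteq> 0" for v
    using that by (auto simp: cone_point_def indicator_def split: if_splits)
  have "z m = 0" using zL(2)[of m] by auto
  have cmpz: "comparable R x y" if "z x \<noteq> 0" "z y \<noteq> 0" for x y
    using z that by (simp add: clique_points_def)
  have "sum z {x \<in> P. comparable R x m} = sum z P"
    using fin zL by (intro sum.mono_neutral_left) auto
  then have "sum z P = 1" using z by (simp add: clique_points_def)
  moreover have "sum ?w P = (\<Sum>v\<in>P. (1 - t) * z v)"
    using m by (intro sum.cong) (auto simp: cone_point_def indicator_def)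
  ultimately have "sum ?w (insert m P) = 1"
    using fin m \<open>z m = 0\<close> by (simp add: cone_point_def flip: sum_distrib_left)
  moreover have "0 \<le> ?w v" for v
    using z t by (simp add: cone_point_def clique_points_def)
  moreover have "v \<in> insert m P" if "?w v \<noteq> 0" for v
    using supp[OF that] zL by blast
  moreover have "comparable R x y" if "?w x \<noteq> 0" "?w y \<noteq> 0" for x y
    using supp[OF that(1)] supp[OF that(2)] zL(3)[of x] zL(3)[of y] cmpz[of x y] \<open>R m m\<close> by auto
  ultimately show ?thesis unfolding clique_points_def by blast
qed

text \<open>The closed star of a vertex is the cone over its link and meets the rest of the complex
  in that link. So restoring \<open>m\<close> attaches a cone along the inclusion of the link, and
  an isolated apex if the link is empty.\<close>

theorem cone_attached_clique_space:
  assumes fin: "finite P" and m: "m \<notin> P" and "R m m"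
  shows "cone_attached (clique_space R {x \<in> P. comparable R x m}) (clique_space R P) id
    (clique_space R (insert m P)) id (cone_point m) (indicator {m})"
proof -
  let ?L = "{x \<in> P. comparable R x m}"
  let ?Y = "clique_points R P" and ?Z = "clique_points R ?L" and ?W = "clique_points R (insert m P)"
  have finL: "finite ?L" using fin by simp
  have ZY: "?Z \<subseteq> ?Y" by (rule clique_points_mono) (use fin in auto)
  have YW: "?Y \<subseteq> ?W" by (rule clique_points_mono) (use fin in auto)
  have apexW: "indicator {m} \<in> ?W" using fin \<open>R m m\<close> by (intro indicator_in_clique_points) auto
  have Ym: "y m = 0" if "y \<in> ?Y" for y using that m by (auto simp: clique_points_def)
  have Zm: "z m = 0" if "z \<in> ?Z" for z using that ZY Ym by blast
  have qm: "cone_point m (z, t) m = t" if "z \<in> ?Z" for z t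
    using Zm[OF that] by (simp add: cone_point_def)
  have qW: "cone_point m p \<in> ?W" if "p \<in> ?Z \<times> {0..1}" for p
    using cone_point_in_clique_points[where R = R, OF fin m \<open>R m m\<close>] that by (cases p) auto
  have cq: "continuous_on (?Z \<times> {0..1}) (cone_point m)"
    unfolding cone_point_def case_prod_unfold
    by (intro continuous_on_coordinatewise_then_product continuous_on_add continuous_on_mult continuous_on_diff
        continuous_on_const continuous_on_snd continuous_on_id
        continuous_on_compose2[OF continuous_on_coordinate[of UNIV] continuous_on_fst]) auto
  have "inj_on (cone_point m) (?Z \<times> {0<..<1})"
  proof (rule inj_onI, clarify)
    fix z t z' t' assume z: "z \<in> ?Z" "z' \<in> ?Z" and t: "t \<in> {0<..<1::real}" "t' \<in> {0<..<1::real}"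
      and eq: "cone_point m (z, t) = cone_point m (z', t')"
    then have "t = t'" using qm by metis
    moreover have "z v = z' v" for v
      using fun_cong[OF eq, of v] Zm z t \<open>t = t'\<close> by (cases "v = m") (auto simp: cone_point_def)
    ultimately show "z = z' \<and> t = t'" by auto
  qed
  moreover have "indicator {m} \<notin> ?Y" using Ym by fastforce
  moreover have "cone_point m ` (?Z \<times> {0<..<1}) \<inter> insert (indicator {m}) ?Y = {}"
  proof -
    have "cone_point m (z, t) \<noteq> indicator {m}" "cone_point m (z, t) \<notin> ?Y"
      if "z \<in> ?Z" "t \<in> {0<..<1}" for z t
      using qm[OF that(1), of t] Ym[of "cone_point m (z, t)"] that(2) by auto
    then have "cone_point m p \<notin> insert (indicator {m}) ?Y" if "p \<in> ?Z \<times> {0<..<1}" for p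
      using that by (cases p) auto
    then show ?thesis by blast
  qed
  moreover have "cone_point m (z, 0) = z" "cone_point m (z, 1) = indicator {m}" for z
    by (auto simp: cone_point_def)
  moreover have "?W = insert (indicator {m}) ?Y \<union> cone_point m ` (?Z \<times> {0<..<1})"
  proof (intro equalityI subsetI)
    fix w assume "w \<in> ?W"
    with fin m show "w \<in> insert (indicator {m}) ?Y \<union> cone_point m ` (?Z \<times> {0<..<1})"
      by (cases rule: clique_points_insert_cases) auto
  qed (use apexW YW qW in auto)
  moreover have "openin (top_of_set ?W) U \<longleftrightarrow> openin (top_of_set ?Y) {y \<in> ?Y. y \<in> U} \<and>
      openin (top_of_set (?Z \<times> {0..1})) {p \<in> ?Z \<times> {0..1}. cone_point m p \<in> U}" if U: "U \<subseteq> ?W" for U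
  proof
    assume op: "openin (top_of_set ?W) U"
    have "continuous_map (top_of_set (?Z \<times> {0..1})) (top_of_set ?W) (cone_point m)"
      using cq qW by auto
    from openin_continuous_map_preimage[OF this op]
    have "openin (top_of_set (?Z \<times> {0..1})) {p \<in> ?Z \<times> {0..1}. cone_point m p \<in> U}" by simp
    moreover have "continuous_map (top_of_set ?Y) (top_of_set ?W) id" using YW by auto
    from openin_continuous_map_preimage[OF this op]
    have "openin (top_of_set ?Y) {y \<in> ?Y. y \<in> U}" by simp
    ultimately show "openin (top_of_set ?Y) {y \<in> ?Y. y \<in> U} \<and>
      openin (top_of_set (?Z \<times> {0..1})) {p \<in> ?Z \<times> {0..1}. cone_point m p \<in> U}" by simp
  next
    assume op: "openin (top_of_set ?Y) {y \<in> ?Y. y \<in> U} \<and>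
      openin (top_of_set (?Z \<times> {0..1})) {p \<in> ?Z \<times> {0..1}. cone_point m p \<in> U}"
    \<comment> \<open>The complement of \<open>U\<close> consists of three compact pieces: a closed
      part of the base, the image of a closed part of the compact cylinder, and at most the apex.
      Compact sets are closed here, so \<open>U\<close> is open.\<close>
    let ?A = "{y \<in> ?Y. y \<notin> U}" and ?B = "{p \<in> ?Z \<times> {0..1}. cone_point m p \<notin> U}"
    have A: "?A = ?Y - {y \<in> ?Y. y \<in> U}" and B: "?B = ?Z \<times> {0..1} - {p \<in> ?Z \<times> {0..1}. cone_point m p \<in> U}"
      by auto
    have "closedin (top_of_set ?Y) ?A"
      unfolding A by (rule closedin_diff[OF closedin_topspace conjunct1[OF op], unfolded topspace_euclidean_subtopology])
    then have "compact ?A" using compact_clique_points[OF fin] closedin_compact by blast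
    moreover have "closedin (top_of_set (?Z \<times> {0..1})) ?B"
      unfolding B by (rule closedin_diff[OF closedin_topspace conjunct2[OF op], unfolded topspace_euclidean_subtopology])
    then have "compact ?B"
      by (rule closedin_compact[OF compact_Times[OF compact_clique_points[OF finL] compact_Icc]])
    then have "compact (cone_point m ` ?B)"
      by (rule compact_continuous_image[rotated]) (rule continuous_on_subset[OF cq], auto)
    moreover have "compact ({indicator {m}} - U)" by (rule finite_imp_compact) auto
    ultimately have "compact (?A \<union> cone_point m ` ?B \<union> ({indicator {m}} - U))"
      by (intro compact_Un)
    moreover have "?A \<union> cone_point m ` ?B \<union> ({indicator {m}} - U) = ?W - U"
    proof (intro equalityI subsetI)
      fix w assume w: "w \<in> ?W - U"
      then have "w \<in> ?W" by simp
      with fin m show "w \<in> ?A \<union> cone_point m ` ?B \<union> ({indicator {m}} - U)"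
        by (cases rule: clique_points_insert_cases) (use w in auto)
    qed (use apexW YW qW in auto)
    ultimately have "closed (?W - U)" by (metis compact_imp_closed_real_functions)
    then have "closedin (top_of_set ?W) (?W - U)" by (simp add: closed_subset)
    then show "openin (top_of_set ?W) U" using U by (simp add: openin_closedin_eq)
  qed
  moreover have "id \<in> ?Z \<rightarrow> ?Y" using ZY by auto
  ultimately show ?thesis
    unfolding cone_attached_def by simp
qed

lemma contractible_clique_space_cone:
  assumes fin: "finite P" and y: "y \<in> P" and R: "\<And>x. x \<in> P \<Longrightarrow> R x x"
    and cmp: "\<And>x. x \<in> P \<Longrightarrow> comparable R x y"
  shows "contractible_space (clique_space R P)"
proof -
  have "homotopic (clique_space R P) (clique_space R P) (push_forward P id) (push_forward P (\<lambda>_. y))"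
    using R[OF y] cmp y by (intro homotopic_push_forward_contiguous[OF fin fin]) auto
  then have "homotopic (clique_space R P) (clique_space R P) id (\<lambda>_. indicator {y})"
    by (rule homotopic_with_eq) (auto simp: push_forward_id[OF fin] push_forward_const[OF fin])
  then show ?thesis unfolding contractible_space_def by blast
qed

text \<open>Fits retractions onto a subcomplex and isomorphisms alike: \<open>f \<circ> g\<close> is
  the identity already on vertices, so only the other composite asks for a homotopy.\<close>

lemma push_forward_equivalence:
  assumes fin: "finite P" "finite P'" and f: "f ` P \<subseteq> P'" and g: "g ` P' \<subseteq> P"
    and ff: "\<And>x y. x \<in> P \<Longrightarrow> y \<in> P \<Longrightarrow> R x y \<Longrightarrow> comparable R' (f x) (f y)"
    and gg: "\<And>x y. x \<in> P' \<Longrightarrow> y \<in> P' \<Longrightarrow> R' x y \<Longrightarrow> comparable R (g x) (g y)"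
    and gf: "homotopic (clique_space R P) (clique_space R P) (push_forward P (g \<circ> f)) (push_forward P id)"
    and fg: "\<And>y. y \<in> P' \<Longrightarrow> f (g y) = y"
  shows "homotopy_equivalence (clique_space R P) (clique_space R' P') (push_forward P f)"
proof (rule homotopy_equivalenceI)
  show cf: "continuous_map (clique_space R P) (clique_space R' P') (push_forward P f)"
    by (rule continuous_map_push_forward[OF fin f]) (rule ff)
  show cg: "continuous_map (clique_space R' P') (clique_space R P) (push_forward P' g)"
    by (rule continuous_map_push_forward[OF fin(2,1) g]) (rule gg)
  show "homotopic (clique_space R P) (clique_space R P) (push_forward P' g \<circ> push_forward P f) id"
    using gf by (rule homotopic_with_eq)
      (auto simp: push_forward_compose[OF fin f] push_forward_id[OF fin(1)])
  show "homotopic (clique_space R' P') (clique_space R' P') (push_forward P f \<circ> push_forward P' g) id"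
    by (rule homotopic_eqI[OF continuous_map_compose[OF cg cf]])
      (simp add: push_forward_compose[OF fin(2,1) g] push_forward_id[OF fin(2)] fg)
qed

lemma push_forward_isomorphism:
  assumes fin: "finite P" "finite P'" and f: "f ` P \<subseteq> P'" and g: "g ` P' \<subseteq> P"
    and ff: "\<And>x y. x \<in> P \<Longrightarrow> y \<in> P \<Longrightarrow> R x y \<Longrightarrow> comparable R' (f x) (f y)"
    and gg: "\<And>x y. x \<in> P' \<Longrightarrow> y \<in> P' \<Longrightarrow> R' x y \<Longrightarrow> comparable R (g x) (g y)"
    and inv: "\<And>x. x \<in> P \<Longrightarrow> g (f x) = x" "\<And>x. x \<in> P' \<Longrightarrow> f (g x) = x"
  shows "homotopy_equivalence (clique_space R P) (clique_space R' P') (push_forward P f)"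
proof (rule push_forward_equivalence[OF fin f g])
  have "push_forward P (g \<circ> f) = push_forward P id"
    using inv(1) by (intro push_forward_cong) simp
  moreover have "continuous_map (clique_space R P) (clique_space R P) (push_forward P id)"
    by (rule continuous_map_push_forward[OF fin(1,1)]) auto
  ultimately show "homotopic (clique_space R P) (clique_space R P) (push_forward P (g \<circ> f)) (push_forward P id)"
    by (simp only: homotopic_with_refl simp_thms)
qed (use ff gg inv in auto)


section \<open>Suspensions and wedges as mapping cones\<close>

lemma openin_suspension:
  "openin (suspension X) U \<longleftrightarrow> U \<subseteq> {South, North} \<union> susp_proj ` (topspace X \<times> {0..1}) \<and>
     openin (prod_topology X unit_interval) {p \<in> topspace X \<times> {0..1}. susp_proj p \<in> U}"
  by (simp add: suspension_def openin_coinduced_topology)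

lemma topspace_suspension: "topspace (suspension X) = {South, North} \<union> susp_proj ` (topspace X \<times> {0..1})"
  unfolding suspension_def by (rule topspace_coinduced_topology) auto

lemma openin_cylinder_flip:
  assumes "openin (prod_topology X unit_interval) A"
  shows "openin (prod_topology X unit_interval) {p \<in> topspace X \<times> {0..1}. (fst p, 1 - snd p) \<in> A}"
proof -
  let ?C = "prod_topology X unit_interval"
  have "continuous_map ?C euclideanreal (\<lambda>p. 1 - snd p)"
    by (intro real_continuity)
  then have "continuous_map ?C unit_interval (\<lambda>p. 1 - snd p)"
    by (rule continuous_map_into_subtopology) auto
  then have "continuous_map ?C ?C (\<lambda>p. (fst p, 1 - snd p))"
    by (intro continuous_map_pairedI continuous_map_fst)
  from openin_continuous_map_preimage[OF this assms] show ?thesis by simp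
qed

lemma cone_attached_suspension:
  assumes "p = South \<or> p = North"
  obtains q a where "cone_attached Z (discrete_topology {p}) (\<lambda>_. p) (suspension Z) id q a"
proof -
  let ?C = "prod_topology Z unit_interval"
  have proj: "{South, North} \<union> susp_proj ` (topspace Z \<times> {0..1}) =
      {South, North} \<union> susp_proj ` (topspace Z \<times> {0<..<1})"
  proof -
    have "susp_proj x \<in> {South, North} \<union> susp_proj ` (topspace Z \<times> {0<..<1})"
      if x: "x \<in> topspace Z \<times> {0..1}" for x
    proof -
      obtain z t where zt: "x = (z, t)" "z \<in> topspace Z" "t \<in> {0..1}" using x by auto
      then consider "t = 0" | "t = 1" | "(z, t) \<in> topspace Z \<times> {0<..<1}" by fastforce
      then show ?thesis
      proof cases
        case 3
        from imageI[OF this, of susp_proj] show ?thesis unfolding zt by blast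
      qed (simp_all add: zt)
    qed
    moreover have "susp_proj ` (topspace Z \<times> {0<..<1}) \<subseteq> susp_proj ` (topspace Z \<times> {0..1})"
      by (intro image_mono) auto
    ultimately show ?thesis by blast
  qed
  have top: "topspace (suspension Z) = {South, North} \<union> susp_proj ` (topspace Z \<times> {0<..<1})"
    unfolding topspace_suspension by (rule proj)
  have op_susp: "openin (suspension Z) U \<longleftrightarrow> openin ?C {p \<in> topspace Z \<times> {0..1}. susp_proj p \<in> U}"
    if "U \<subseteq> topspace (suspension Z)" for U
    using that unfolding openin_suspension topspace_suspension by blast
  have inj: "inj_on susp_proj (topspace Z \<times> {0<..<1})"
    by (auto simp: inj_on_def)
  have disj: "South \<notin> susp_proj ` (topspace Z \<times> {0<..<1})" "North \<notin> susp_proj ` (topspace Z \<times> {0<..<1})"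
    by auto
  have sub: "{y. y = c \<and> y \<in> U} \<subseteq> {c}" for c :: "'a susp_point" and U by auto
  show thesis
  proof (cases "p = South")
    case True
    have "cone_attached Z (discrete_topology {South}) (\<lambda>_. South) (suspension Z) id susp_proj North"
      unfolding cone_attached_def using inj disj op_susp sub by (simp add: top insert_commute)
    then show thesis using that True by blast
  next
    case False
    \<comment> \<open>Seen from \<open>North\<close> the cylinder runs downwards, so its parameter
      is reversed and \<open>South\<close> becomes the apex.\<close>
    let ?q = "\<lambda>p. susp_proj (fst p, 1 - snd p)"
    have q: "?q ` (topspace Z \<times> {0<..<1}) = susp_proj ` (topspace Z \<times> {0<..<1})"
    proof (intro equalityI subsetI)
      fix w assume "w \<in> susp_proj ` (topspace Z \<times> {0<..<1})"
      then obtain z t where "z \<in> topspace Z" "0 < t" "t < 1" "w = susp_proj (z, t)" by auto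
      then have "w = ?q (z, 1 - t)" "(z, 1 - t) \<in> topspace Z \<times> {0<..<1}" by auto
      then show "w \<in> ?q ` (topspace Z \<times> {0<..<1})" by blast
    next
      fix w assume "w \<in> ?q ` (topspace Z \<times> {0<..<1})"
      then obtain z t where "z \<in> topspace Z" "0 < t" "t < 1" "w = susp_proj (z, 1 - t)" by auto
      then have "(z, 1 - t) \<in> topspace Z \<times> {0<..<1}" by auto
      from imageI[OF this, of susp_proj] show "w \<in> susp_proj ` (topspace Z \<times> {0<..<1})"
        unfolding \<open>w = susp_proj (z, 1 - t)\<close> .
    qed
    have op: "openin ?C {p \<in> topspace Z \<times> {0..1}. susp_proj p \<in> U}
        \<longleftrightarrow> openin ?C {p \<in> topspace Z \<times> {0..1}. ?q p \<in> U}" for U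
    proof
      assume "openin ?C {p \<in> topspace Z \<times> {0..1}. susp_proj p \<in> U}"
      from openin_cylinder_flip[OF this]
      show "openin ?C {p \<in> topspace Z \<times> {0..1}. ?q p \<in> U}"
        by (rule back_subst[where P="openin ?C"]) auto
    next
      assume "openin ?C {p \<in> topspace Z \<times> {0..1}. ?q p \<in> U}"
      from openin_cylinder_flip[OF this]
      show "openin ?C {p \<in> topspace Z \<times> {0..1}. susp_proj p \<in> U}"
        by (rule back_subst[where P="openin ?C"]) auto
    qed
    have "inj_on ?q (topspace Z \<times> {0<..<1})" by (auto simp: inj_on_def)
    then have "cone_attached Z (discrete_topology {North}) (\<lambda>_. North) (suspension Z) id ?q South"
      unfolding cone_attached_def q using disj op_susp op sub by (simp add: top)
    then show thesis using that False assms by blast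
  qed
qed

text \<open>The contractible part \<open>P\<close> can be shrunk to a point, and the cone on the
  link over a point is its suspension. If the link is empty, \<open>P\<close> and the isolated
  vertex \<open>m\<close> account for the two end points.\<close>

theorem clique_space_suspension_link:
  fixes Z :: "'p susp_point topology"
  assumes fin: "finite P" and m: "m \<notin> P" "R m m" and u: "u \<in> clique_points R P"
    and c: "contractible_space (clique_space R P)"
    and Z: "clique_space R {x \<in> P. comparable R x m} homotopy_equivalent_space Z"
  shows "clique_space R (insert m P) homotopy_equivalent_space suspension Z"
proof -
  obtain q a where S: "cone_attached Z (discrete_topology {South}) (\<lambda>_. South) (suspension Z) id q a"
    using cone_attached_suspension by blast
  have \<phi>: "homotopy_equivalence (clique_space R P) (discrete_topology {South}) (\<lambda>_. South :: 'p susp_point)"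
    using u by (intro homotopy_equivalence_of_contractible[OF c]) auto
  have "homotopic (clique_space R {x \<in> P. comparable R x m}) (discrete_topology {South})
      ((\<lambda>_. South :: 'p susp_point) \<circ> id) (\<lambda>_. South)"
    by (rule homotopic_eqI) auto
  from cone_attached_equivalence[OF cone_attached_clique_space[where R = R, OF fin m] S _ \<phi> this Z]
  show ?thesis
    unfolding homotopy_equivalent_space_iff_equivalence by auto
qed

text \<open>\<open>P\<close> and \<open>y\<close> span a cone with vertex \<open>y\<close>, which is
  contractible; \<open>x\<close> is not adjacent to \<open>y\<close>, so the link of
  \<open>x\<close> is \<open>P\<close> itself.\<close>

theorem clique_space_join_two_points:
  assumes fin: "finite P" and xy: "x \<notin> P" "y \<notin> P" "\<not> comparable R x y" "R x x" "R y y"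
    and R: "\<And>v. v \<in> P \<Longrightarrow> R v v" "\<And>v. v \<in> P \<Longrightarrow> comparable R v x" "\<And>v. v \<in> P \<Longrightarrow> comparable R v y"
    and Z: "clique_space R P homotopy_equivalent_space Z"
  shows "clique_space R (insert x (insert y P)) homotopy_equivalent_space suspension Z"
proof (rule clique_space_suspension_link)
  have L: "{v \<in> insert y P. comparable R v x} = P" using xy R by auto
  show "clique_space R {v \<in> insert y P. comparable R v x} homotopy_equivalent_space Z"
    unfolding L by (rule Z)
  show "contractible_space (clique_space R (insert y P))"
    by (rule contractible_clique_space_cone[of _ y]) (use fin xy R in auto)
  show "indicator {y} \<in> clique_points R (insert y P)"
    using indicator_in_clique_points[of "insert y P" y R] fin xy by simp
qed (use fin xy in auto)

section \<open>The wedge as an iterated mapping cone\<close>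

lemma topspace_wedge: "topspace (wedge n X p) = {wedge_proj p (i, x) | i x. i \<le> n \<and> x \<in> topspace (X i)}"
  unfolding wedge_def by (subst topspace_coinduced_topology) force+

lemma openin_wedge:
  "openin (wedge n X p) U \<longleftrightarrow> U \<subseteq> topspace (wedge n X p) \<and>
     (\<forall>i\<le>n. openin (X i) {x \<in> topspace (X i). wedge_proj p (i, x) \<in> U})"
proof -
  have "openin (sum_topology X {0..n}) {x \<in> topspace (sum_topology X {0..n}). wedge_proj p x \<in> U} \<longleftrightarrow>
     (\<forall>i\<le>n. openin (X i) {x \<in> topspace (X i). wedge_proj p (i, x) \<in> U})"
    by (subst openin_sum_topology) (auto cong: conj_cong)
  moreover have "topspace (wedge n X p) = wedge_proj p ` topspace (sum_topology X {0..n})"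
    unfolding wedge_def by (rule topspace_coinduced_topology) auto
  ultimately show ?thesis
    unfolding wedge_def by (simp add: openin_coinduced_topology)
qed

text \<open>A suspended summand is a cone over its own base point. Once this point is identified
  with the common one, the summand is a cone attached to the smaller wedge by a constant map. Wedges
  thus grow by the same operation as clique complexes.\<close>

theorem cone_attached_wedge:
  assumes p0: "p 0 \<in> topspace (X 0)"
    and S: "cone_attached Z (discrete_topology {p (Suc n)}) (\<lambda>_. p (Suc n)) (X (Suc n)) id q a"
  shows "cone_attached Z (wedge n X p) (\<lambda>_. (0, p 0)) (wedge (Suc n) X p) id (\<lambda>z. wedge_proj p (Suc n, q z)) (Suc n, a)"
proof -
  let ?q = "\<lambda>z. wedge_proj p (Suc n, q z)"
  let ?I = "topspace Z \<times> {0<..<1::real}"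
  have topS: "topspace (X (Suc n)) = insert a (insert (p (Suc n)) (q ` ?I))" "a \<noteq> p (Suc n)"
    "q ` ?I \<inter> {a, p (Suc n)} = {}" "inj_on q ?I"
    using S unfolding cone_attached_def by auto
  have proj_base: "wedge_proj p (i, p i) = (0, p 0)" for i by (simp add: wedge_proj_def)
  have proj: "wedge_proj p (Suc n, x) = (Suc n, x)" if "x \<noteq> p (Suc n)" for x
    using that by (simp add: wedge_proj_def)
  have q: "?q z = (Suc n, q z)" if "z \<in> ?I" for z
    using topS(3) that by (intro proj) blast
  have base: "(0, p 0) \<in> topspace (wedge n X p)"
    unfolding topspace_wedge using p0 proj_base[of 0] by force
  have fst_le: "fst w \<le> n" if "w \<in> topspace (wedge n X p)" for w
    using that by (auto simp: topspace_wedge wedge_proj_def split: if_splits)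
  have top: "topspace (wedge (Suc n) X p) = insert (Suc n, a) (topspace (wedge n X p)) \<union> ?q ` ?I"
  proof -
    have "topspace (wedge (Suc n) X p) = topspace (wedge n X p) \<union> (\<lambda>x. wedge_proj p (Suc n, x)) ` topspace (X (Suc n))"
      by (auto simp: topspace_wedge le_Suc_eq)
    also have "\<dots> = topspace (wedge n X p) \<union> insert (Suc n, a) (insert (0, p 0) (?q ` ?I))"
      unfolding topS(1) using proj_base topS(2) proj by (auto simp: image_image)
    finally show ?thesis using base by auto
  qed
  have "openin (wedge (Suc n) X p) U \<longleftrightarrow> openin (wedge n X p) {y \<in> topspace (wedge n X p). id y \<in> U} \<and>
      openin (prod_topology Z unit_interval) {z \<in> topspace Z \<times> {0..1}. ?q z \<in> U}"
    if U: "U \<subseteq> topspace (wedge (Suc n) X p)" for U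
  proof -
    have "openin (wedge (Suc n) X p) U \<longleftrightarrow>
        (\<forall>i\<le>n. openin (X i) {x \<in> topspace (X i). wedge_proj p (i, x) \<in> U}) \<and>
        openin (X (Suc n)) {x \<in> topspace (X (Suc n)). wedge_proj p (Suc n, x) \<in> U}"
      unfolding openin_wedge using U by (auto simp: le_Suc_eq)
    moreover have "{x \<in> topspace (X i). wedge_proj p (i, x) \<in> {y \<in> topspace (wedge n X p). id y \<in> U}}
        = {x \<in> topspace (X i). wedge_proj p (i, x) \<in> U}" if "i \<le> n" for i
      using that by (auto simp: topspace_wedge)
    then have "openin (wedge n X p) {y \<in> topspace (wedge n X p). id y \<in> U} \<longleftrightarrow>
        (\<forall>i\<le>n. openin (X i) {x \<in> topspace (X i). wedge_proj p (i, x) \<in> U})"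
      unfolding openin_wedge by auto
    moreover have "{x \<in> topspace Z \<times> {0..1}. q x \<in> {x \<in> topspace (X (Suc n)). wedge_proj p (Suc n, x) \<in> U}}
        = {x \<in> topspace Z \<times> {0..1}. ?q x \<in> U}"
      using continuous_map_image_subset_topspace[OF cone_attachedD(3)[OF S]] by (auto simp: image_subset_iff)
    then have "openin (X (Suc n)) {x \<in> topspace (X (Suc n)). wedge_proj p (Suc n, x) \<in> U} \<longleftrightarrow>
        openin (prod_topology Z unit_interval) {z \<in> topspace Z \<times> {0..1}. ?q z \<in> U}"
      by (subst cone_attached_openin[OF S]) auto
    ultimately show ?thesis by blast
  qed
  moreover have "inj_on ?q ?I"
    using topS(4) q by (auto simp: inj_on_def)
  moreover have "?q ` ?I \<inter> insert (Suc n, a) (id ` topspace (wedge n X p)) = {}"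
    using q topS(3) fst_le by (auto simp: image_iff) force+
  moreover have "(Suc n, a) \<notin> id ` topspace (wedge n X p)"
    using fst_le by force
  moreover have "?q (z, 0) = id (0, p 0)" "?q (z, 1) = (Suc n, a)" if "z \<in> topspace Z" for z
    using cone_attachedD(5,6)[OF S that] proj_base proj topS(2) by auto
  moreover have "continuous_map Z (wedge n X p) (\<lambda>_. (0, p 0))" using base by simp
  ultimately show ?thesis
    using top unfolding cone_attached_def by (simp add: inj_on_id)
qed

lemma homotopy_equivalence_wedge_0: "homotopy_equivalence (X 0) (wedge 0 X p) (Pair 0)"
proof -
  have proj: "wedge_proj p (0, x) = (0, x)" for x by (simp add: wedge_proj_def)
  have 1: "continuous_map (X 0) (wedge 0 X p) (Pair 0)"
    unfolding continuous_map_def by (auto simp: topspace_wedge openin_wedge proj)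
  have 2: "continuous_map (wedge 0 X p) (X 0) snd"
    unfolding continuous_map_def
  proof (intro conjI allI impI)
    fix U assume "openin (X 0) U"
    moreover from this have "{x \<in> topspace (X 0). x \<in> U} = U" using openin_subset by blast
    ultimately show "openin (wedge 0 X p) {x \<in> topspace (wedge 0 X p). snd x \<in> U}"
      unfolding openin_wedge by (auto simp: topspace_wedge proj)
  qed (auto simp: topspace_wedge proj)
  show ?thesis
    by (rule homotopy_equivalenceI[OF 1 2]; rule homotopic_eqI)
      (auto intro: continuous_map_compose[OF 1 2] continuous_map_compose[OF 2 1] simp: topspace_wedge proj)
qed

lemma homotopy_equivalence_base_space: "homotopy_equivalence X (base_space X) Base"
proof -
  have top: "topspace (base_space X) = Base ` topspace X"
    by (auto simp: base_space_def topspace_pullback_topology)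
  have 1: "continuous_map X (base_space X) Base"
    unfolding base_space_def by (rule continuous_map_pullback') (auto simp: o_def)
  have "continuous_map (base_space X) X (id \<circ> unBase)"
    unfolding base_space_def by (rule continuous_map_pullback) simp
  then have 2: "continuous_map (base_space X) X unBase" by simp
  show ?thesis
    by (rule homotopy_equivalenceI[OF 1 2]; rule homotopic_eqI)
      (auto intro: continuous_map_compose[OF 1 2] continuous_map_compose[OF 2 1] simp: top)
qed

section \<open>Finiteness in affine monoids\<close>

lemma nondecreasing_subsequence:
  fixes f :: "nat \<Rightarrow> nat"
  obtains r :: "nat \<Rightarrow> nat" where "strict_mono r" "mono (f \<circ> r)"
proof -
  obtain r :: "nat \<Rightarrow> nat" where r: "strict_mono r" "monoseq (\<lambda>n. f (r n))"
    using seq_monosub[of f] by blast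
  show thesis
  proof (cases "\<forall>m n. m \<le> n \<longrightarrow> f (r m) \<le> f (r n)")
    case True
    then show thesis using that r by (auto simp: mono_def)
  next
    case False
    then have dec: "f (r n) \<le> f (r m)" if "m \<le> n" for m n
      using r(2) that unfolding monoseq_def by blast
    obtain N where N: "\<And>n. f (r N) \<le> f (r n)"
      using ex_has_least_nat[of "\<lambda>_. True" 0 "\<lambda>n. f (r n)"] by auto
    have "f (r (N + n)) = f (r N)" for n using dec[of N "N + n"] N[of "N + n"] by simp
    then have "mono (f \<circ> (\<lambda>n. r (N + n)))" by (simp add: mono_def)
    moreover have "strict_mono (\<lambda>n. r (N + n))" using r(1) by (simp add: strict_mono_def)
    ultimately show thesis using that by blast
  qed
qed

lemma dickson:
  fixes a :: "nat \<Rightarrow> 's \<Rightarrow> nat"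
  assumes "finite S"
  obtains r :: "nat \<Rightarrow> nat" where "strict_mono r" "\<And>s m n. s \<in> S \<Longrightarrow> m \<le> n \<Longrightarrow> a (r m) s \<le> a (r n) s"
proof -
  have "\<exists>r :: nat \<Rightarrow> nat. strict_mono r \<and> (\<forall>s\<in>S. \<forall>m n. m \<le> n \<longrightarrow> a (r m) s \<le> a (r n) s)"
    using assms
  proof (induction S)
    case empty
    then show ?case using strict_mono_id by auto
  next
    case (insert s S)
    then obtain r :: "nat \<Rightarrow> nat" where r: "strict_mono r" "\<forall>s\<in>S. \<forall>m n. m \<le> n \<longrightarrow> a (r m) s \<le> a (r n) s"
      by blast
    obtain r' :: "nat \<Rightarrow> nat" where r': "strict_mono r'" "mono ((\<lambda>n. a (r n) s) \<circ> r')"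
      by (rule nondecreasing_subsequence)
    have "strict_mono (r \<circ> r')" using r(1) r'(1) by (rule strict_mono_o)
    moreover have "a ((r \<circ> r') m) t \<le> a ((r \<circ> r') n) t" if "t \<in> insert s S" "m \<le> n" for t m n
      using that r(2) r'(2) strict_mono_less_eq[OF r'(1)] by (auto simp: mono_def)
    ultimately show ?case by blast
  qed
  then show thesis using that by blast
qed

context affine_monoid
begin

lemma dvd_refl: "x \<in> carrier G \<Longrightarrow> x divides x"
  by (rule divides_refl)

lemma dvd_trans: "x divides y \<Longrightarrow> y divides z \<Longrightarrow> x \<in> carrier G \<Longrightarrow> x divides z"
  by (rule divides_trans)

lemma mult_eq_self: "x \<in> carrier G \<Longrightarrow> c \<in> carrier G \<Longrightarrow> x = x \<otimes> c \<Longrightarrow> c = \<one>"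
  using l_cancel[of x c \<one>] by simp

lemma dvd_antisym:
  assumes "x divides y" "y divides x" "x \<in> carrier G" "y \<in> carrier G"
  shows "x = y"
proof -
  obtain c d where cd: "c \<in> carrier G" "y = x \<otimes> c" "d \<in> carrier G" "x = y \<otimes> d"
    using assms by (auto simp: factor_def)
  have "x \<otimes> (c \<otimes> d) = (x \<otimes> c) \<otimes> d" using cd(1,3) assms by (simp add: m_assoc)
  also have "\<dots> = y \<otimes> d" by (simp only: cd(2))
  also have "\<dots> = x" by (rule cd(4)[symmetric])
  finally have "x = x \<otimes> (c \<otimes> d)" ..
  then have "c \<otimes> d = \<one>" using cd(1,3) assms(3) by (intro mult_eq_self[of x]) auto
  then have "c = \<one>" using reduced[of c d] cd(1,3) by blast
  then show ?thesis using cd(2) assms(3) by simp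
qed

lemma dvd_mult: "x \<in> carrier G \<Longrightarrow> y \<in> carrier G \<Longrightarrow> x divides x \<otimes> y"
  by (auto simp: factor_def)

lemma dvd_mult': "x \<in> carrier G \<Longrightarrow> y \<in> carrier G \<Longrightarrow> y divides x \<otimes> y"
  using dvd_mult[of y x] by (simp add: m_comm)

lemma one_dvd: "x \<in> carrier G \<Longrightarrow> \<one> divides x"
  by (auto simp: factor_def)

lemma mult_dvd_mult:
  assumes "x divides y" "x \<in> carrier G" "y \<in> carrier G" "z \<in> carrier G"
  shows "x \<otimes> z divides y \<otimes> z"
  using assms by (auto simp: factor_def m_ac)

lemma mult_dvd_cancel:
  assumes "x \<otimes> z divides y \<otimes> z" "x \<in> carrier G" "y \<in> carrier G" "z \<in> carrier G"
  shows "x divides y"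
proof -
  obtain c where c: "c \<in> carrier G" "y \<otimes> z = (x \<otimes> z) \<otimes> c" using assms by (auto simp: factor_def)
  then have "y \<otimes> z = (x \<otimes> c) \<otimes> z" using assms by (simp add: m_ac)
  then have "y = x \<otimes> c" by (rule r_cancel) (use c assms in auto)
  then show ?thesis using c by (auto simp: factor_def)
qed

text \<open>Exponent vectors over finitely many generators describe all elements, and coordinatewise
  growth of the vectors yields divisibility. So Dickson's lemma transfers to
  \<open>G\<close>.\<close>

lemma dvd_sequence:
  assumes x: "\<And>n::nat. x n \<in> carrier G"
  obtains r :: "nat \<Rightarrow> nat" where "strict_mono r" "\<And>m n. m \<le> n \<Longrightarrow> x (r m) divides x (r n)"
proof -
  obtain S where S: "finite S" "S \<subseteq> carrier G" "\<And>H. submonoid H G \<Longrightarrow> S \<subseteq> H \<Longrightarrow> H = carrier G"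
    using finitely_generated by blast
  define e :: "('a \<Rightarrow> nat) \<Rightarrow> 'a" where "e = (\<lambda>a. finprod G (\<lambda>s. s [^] a s) S)"
  have closed: "(\<lambda>s. s [^] a s) \<in> S \<rightarrow> carrier G" for a :: "'a \<Rightarrow> nat" using S by auto
  have e_closed: "e a \<in> carrier G" for a unfolding e_def by (rule finprod_closed[OF closed])
  have e_mult: "e (\<lambda>s. a s + b s) = e a \<otimes> e b" for a b
  proof -
    have "e a \<otimes> e b = finprod G (\<lambda>s. s [^] a s \<otimes> s [^] b s) S"
      unfolding e_def by (rule finprod_multf[OF closed closed, symmetric])
    also have "\<dots> = e (\<lambda>s. a s + b s)"
      unfolding e_def using S by (intro finprod_cong') (auto simp: nat_pow_mult)
    finally show ?thesis by simp
  qed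
  \<comment> \<open>The image of the exponent vectors is a submonoid containing the generators,
    hence everything.\<close>
  have "submonoid (range e) G"
  proof
    show "range e \<subseteq> carrier G" using e_closed by auto
    show "x \<otimes> y \<in> range e" if "x \<in> range e" "y \<in> range e" for x y
      using that e_mult by (auto simp: image_iff) metis
    have "e (\<lambda>_. 0) = \<one>" unfolding e_def by (simp add: finprod_one_eqI)
    then show "\<one> \<in> range e" by (metis rangeI)
  qed
  moreover have "S \<subseteq> range e"
  proof
    fix s assume s: "s \<in> S"
    have "e (\<lambda>t. if t = s then 1 else 0) = finprod G (\<lambda>t. if s = t then t else \<one>) S"
      unfolding e_def using S by (intro finprod_cong') auto
    also have "\<dots> = s" using S s by (intro finprod_singleton) auto
    finally show "s \<in> range e" by (metis rangeI)
  qed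
  ultimately have "range e = carrier G" by (rule S(3))
  then have "\<forall>n. \<exists>a. x n = e a" using x by (metis imageE)
  then obtain a where a: "\<And>n. x n = e (a n)" by metis
  obtain r :: "nat \<Rightarrow> nat" where r: "strict_mono r" "\<And>s m n. s \<in> S \<Longrightarrow> m \<le> n \<Longrightarrow> a (r m) s \<le> a (r n) s"
    using dickson[OF S(1), of a] by blast
  have "x (r m) divides x (r n)" if "m \<le> n" for m n
  proof -
    have "x (r n) = e (\<lambda>s. a (r m) s + (a (r n) s - a (r m) s))"
      unfolding a e_def using S r(2)[OF _ that] by (intro finprod_cong') auto
    then have "x (r n) = x (r m) \<otimes> e (\<lambda>s. a (r n) s - a (r m) s)" by (simp only: e_mult a)
    then show ?thesis using e_closed by (auto simp: factor_def)
  qed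
  with r(1) show thesis by (rule that)
qed

text \<open>Infinitely many divisors and their cofactors would both ascend along a common
  subsequence. Their product is always \<open>x\<close>, so by cancellation and the absence of
  invertible elements neither factor can grow. All intervals are therefore finite, as the results on
  clique complexes require.\<close>

theorem finite_divisors:
  assumes x: "x \<in> carrier G"
  shows "finite {y \<in> carrier G. y divides x}"
proof (rule ccontr)
  assume "infinite {y \<in> carrier G. y divides x}"
  then obtain y :: "nat \<Rightarrow> 'a" where y: "inj y" "range y \<subseteq> {y \<in> carrier G. y divides x}"
    using infinite_countable_subset by blast
  then have yG: "y n \<in> carrier G" and "\<exists>z\<in>carrier G. x = y n \<otimes> z" for n
    by (auto simp: factor_def)
  then obtain z where z: "\<And>n. z n \<in> carrier G" "\<And>n. x = y n \<otimes> z n" by metis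
  obtain r :: "nat \<Rightarrow> nat" where r: "strict_mono r" "\<And>m n. m \<le> n \<Longrightarrow> y (r m) divides y (r n)"
    using dvd_sequence[of y] yG by blast
  obtain r' :: "nat \<Rightarrow> nat" where r': "strict_mono r'" "\<And>m n. m \<le> n \<Longrightarrow> z (r (r' m)) divides z (r (r' n))"
    using dvd_sequence[of "\<lambda>n. z (r n)"] z by blast
  let ?i = "r (r' 0)" and ?j = "r (r' 1)"
  have "r' 0 < r' 1" using r'(1) by (simp add: strict_mono_def)
  then have ij: "y ?i divides y ?j" "z ?i divides z ?j" "?i < ?j"
    using r(2)[of "r' 0" "r' 1"] r'(2)[of 0 1] strict_monoD[OF r(1)] by simp_all
  then obtain c d where cd: "c \<in> carrier G" "y ?j = y ?i \<otimes> c" "d \<in> carrier G" "z ?j = z ?i \<otimes> d"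
    by (auto simp: factor_def)
  have "y ?j \<otimes> z ?j = (y ?i \<otimes> z ?i) \<otimes> (c \<otimes> d)"
    unfolding cd using cd(1,3) yG z(1) by (simp add: m_ac)
  then have "x = x \<otimes> (c \<otimes> d)" using z(2)[of ?i] z(2)[of ?j] by simp
  then have "c \<otimes> d = \<one>" using cd(1,3) x by (intro mult_eq_self[of x]) auto
  then have "c = \<one>" using reduced[of c d] cd(1,3) by blast
  then have "y ?j = y ?i" using cd(2) yG by simp
  then show False using y(1) ij(3) by (auto dest: injD)
qed

end


section \<open>The order of the monoid with a fraction adjoined\<close>

text \<open>The order of \<open>\<Lambda>[\<rho>/r]\<close> in the normal form \<open>x + i\<rho>/r\<close>, \<open>i < r\<close>; it does not depend on \<open>r\<close>.\<close>

definition frac_le :: "('a, 'b) monoid_scheme \<Rightarrow> 'a \<Rightarrow> 'a \<times> nat \<Rightarrow> 'a \<times> nat \<Rightarrow> bool" where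
  "frac_le G \<rho> v w \<longleftrightarrow>
     (if snd v \<le> snd w then fst v divides\<^bsub>G\<^esub> fst w else (fst v \<otimes>\<^bsub>G\<^esub> \<rho>) divides\<^bsub>G\<^esub> fst w)"

definition frac_interval :: "('a, 'b) monoid_scheme \<Rightarrow> 'a \<Rightarrow> nat \<Rightarrow> 'a \<Rightarrow> nat \<Rightarrow> ('a \<times> nat) set" where
  "frac_interval G \<rho> r x k = {v. fst v \<in> carrier G \<and> snd v < r \<and> v \<noteq> (\<one>\<^bsub>G\<^esub>, 0) \<and> v \<noteq> (x, k) \<and> frac_le G \<rho> v (x, k)}"

definition open_interval :: "('a, 'b) monoid_scheme \<Rightarrow> 'a \<Rightarrow> 'a set" where
  "open_interval G x = {y \<in> carrier G. y \<noteq> \<one>\<^bsub>G\<^esub> \<and> y \<noteq> x \<and> y divides\<^bsub>G\<^esub> x}"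

locale affine_monoid_elem = affine_monoid +
  fixes \<rho>
  assumes rho: "\<rho> \<in> carrier G" "\<rho> \<noteq> \<one>"
begin

abbreviation le (infix \<open>\<preceq>\<close> 50) where "v \<preceq> w \<equiv> frac_le G \<rho> v w"

lemma rho_dvd: "x \<otimes> \<rho> divides y \<Longrightarrow> x \<in> carrier G \<Longrightarrow> x divides y"
  using dvd_trans[OF dvd_mult[of x \<rho>]] rho by blast

lemma not_rho_dvd_self: "x \<in> carrier G \<Longrightarrow> \<not> x \<otimes> \<rho> divides x"
  using dvd_antisym[of "x \<otimes> \<rho>" x] dvd_mult[of x \<rho>] mult_eq_self[of x \<rho>] rho by auto

lemma le_fst_dvd: "v \<preceq> w \<Longrightarrow> fst v \<in> carrier G \<Longrightarrow> fst v divides fst w"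
  by (auto simp: frac_le_def rho_dvd split: if_splits)

lemma le_refl: "fst v \<in> carrier G \<Longrightarrow> v \<preceq> v"
  by (simp add: frac_le_def dvd_refl)

lemma le_trans:
  assumes "u \<preceq> v" "v \<preceq> w" and G: "fst u \<in> carrier G" "fst v \<in> carrier G" "fst w \<in> carrier G"
  shows "u \<preceq> w"
proof (cases "snd u \<le> snd w")
  case True
  have "fst u divides fst w"
    using dvd_trans[OF le_fst_dvd[OF assms(1)] le_fst_dvd[OF assms(2)]] G by simp
  then show ?thesis using True by (simp add: frac_le_def)
next
  case False
  have "(fst u \<otimes> \<rho>) divides fst w"
  proof (cases "snd u \<le> snd v")
    case True
    then have "fst u divides fst v" "(fst v \<otimes> \<rho>) divides fst w"
      using assms(1,2) False by (auto simp: frac_le_def split: if_splits)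
    then show ?thesis using dvd_trans[OF mult_dvd_mult[of "fst u" "fst v" \<rho>]] G rho by simp
  next
    case 2: False
    then have "(fst u \<otimes> \<rho>) divides fst v" using assms(1) by (simp add: frac_le_def)
    then show ?thesis using dvd_trans[OF _ le_fst_dvd[OF assms(2)]] G rho by simp
  qed
  then show ?thesis using False by (simp add: frac_le_def)
qed

lemma le_antisym:
  assumes vw: "v \<preceq> w" "w \<preceq> v" and G: "fst v \<in> carrier G" "fst w \<in> carrier G"
  shows "v = w"
proof -
  have 1: "fst v = fst w"
    using dvd_antisym[OF le_fst_dvd[OF vw(1)] le_fst_dvd[OF vw(2)]] G by simp
  then have "snd v \<le> snd w" "snd w \<le> snd v"
    using vw not_rho_dvd_self[of "fst v"] G by (auto simp: frac_le_def split: if_splits)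
  then show ?thesis using 1 by (simp add: prod_eq_iff)
qed

lemma le_order_on:
  assumes "\<And>v. v \<in> P \<Longrightarrow> fst v \<in> carrier G"
  shows "antisymp_on P (\<preceq>)" "transp_on P (\<preceq>)" "reflp_on P (\<preceq>)"
proof -
  show "antisymp_on P (\<preceq>)" by (rule antisymp_onI) (use le_antisym assms in blast)
  show "transp_on P (\<preceq>)" by (rule transp_onI) (use le_trans assms in blast)
  show "reflp_on P (\<preceq>)" by (rule reflp_onI) (use le_refl assms in blast)
qed

lemma dvd_order_on:
  assumes "P \<subseteq> carrier G"
  shows "transp_on P (\<lambda>x y. x divides y)" "reflp_on P (\<lambda>x y. x divides y)"
proof -
  show "transp_on P (\<lambda>x y. x divides y)" by (rule transp_onI) (use dvd_trans assms in blast)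
  show "reflp_on P (\<lambda>x y. x divides y)" by (rule reflp_onI) (use dvd_refl assms in blast)
qed

lemma finite_open_interval: "x \<in> carrier G \<Longrightarrow> finite (open_interval G x)"
  by (rule finite_subset[OF _ finite_divisors[of x]]) (auto simp: open_interval_def)

lemma frac_intervalD:
  assumes "v \<in> frac_interval G \<rho> r x k"
  shows "fst v \<in> carrier G" "snd v < r" "v \<noteq> (\<one>, 0)" "v \<noteq> (x, k)" "v \<preceq> (x, k)" "fst v divides x"
  using assms le_fst_dvd[of v "(x, k)"] by (auto simp: frac_interval_def)

lemma finite_frac_interval:
  assumes "x \<in> carrier G" shows "finite (frac_interval G \<rho> r x k)"
proof (rule finite_subset)
  show "frac_interval G \<rho> r x k \<subseteq> {y \<in> carrier G. y divides x} \<times> {..<r}"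
    using frac_intervalD by (auto simp: mem_Times_iff)
qed (simp add: finite_divisors assms)

section \<open>Homotopies that change the fractional part\<close>

lemma monotone_raise: "monotone_on P (\<preceq>) (\<preceq>) (\<lambda>v. (fst v, max (snd v) 1))"
  if "\<And>v. v \<in> P \<Longrightarrow> fst v \<in> carrier G"
  by (rule monotone_onI) (use that in \<open>auto simp: frac_le_def rho_dvd max_def split: if_splits\<close>)

lemma monotone_lower: "monotone_on P (\<preceq>) (\<preceq>) (\<lambda>v. (fst v, min (snd v) 1))"
  if "\<And>v. v \<in> P \<Longrightarrow> fst v \<in> carrier G"
  by (rule monotone_onI) (use that in \<open>auto simp: frac_le_def rho_dvd min_def split: if_splits\<close>)

text \<open>The identity and the constant map at \<open>(\<one>, 1)\<close> both lie below the map
  that raises fractional parts. So it suffices that no element of \<open>P\<close> is raised out of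
  \<open>P\<close>.\<close>

lemma contractible_raise:
  assumes fin: "finite P" and G: "\<And>v. v \<in> P \<Longrightarrow> fst v \<in> carrier G"
    and raise: "\<And>v. v \<in> P \<Longrightarrow> (fst v, max (snd v) 1) \<in> P" and one: "(\<one>, 1) \<in> P"
  shows "contractible_space (clique_space (\<preceq>) P)"
proof -
  let ?g = "\<lambda>v. (fst v, max (snd v) 1)"
  note ord = le_order_on[of P, OF G]
  have "homotopic (clique_space (\<preceq>) P) (clique_space (\<preceq>) P) (push_forward P id) (push_forward P ?g)"
    using raise G
    by (intro homotopic_push_forward_le[OF fin fin ord ord(3,2)] monotone_raise)
      (auto simp: monotone_on_def frac_le_def dvd_refl)
  moreover have "homotopic (clique_space (\<preceq>) P) (clique_space (\<preceq>) P) (push_forward P (\<lambda>_. (\<one>, 1))) (push_forward P ?g)"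
    using raise G one
    by (intro homotopic_push_forward_le[OF fin fin ord ord(3,2)] monotone_raise)
      (auto simp: monotone_on_def frac_le_def dvd_refl one_dvd)
  ultimately have "homotopic (clique_space (\<preceq>) P) (clique_space (\<preceq>) P) (push_forward P id) (push_forward P (\<lambda>_. (\<one>, 1)))"
    using homotopic_with_trans homotopic_with_symD by blast
  then have "homotopic (clique_space (\<preceq>) P) (clique_space (\<preceq>) P) id (\<lambda>_. indicator {(\<one>, 1)})"
    by (rule homotopic_with_eq) (auto simp: push_forward_id[OF fin] push_forward_const[OF fin])
  then show ?thesis unfolding contractible_space_def by blast
qed

lemma contractible_frac_interval:
  assumes x: "x \<in> carrier G" and k: "2 \<le> k" "k < r"
  shows "contractible_space (clique_space (\<preceq>) (frac_interval G \<rho> r x k))"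
    "indicator {(\<one>, 1)} \<in> clique_points (\<preceq>) (frac_interval G \<rho> r x k)"
proof -
  have one: "(\<one>, 1) \<in> frac_interval G \<rho> r x k"
    using x k by (auto simp: frac_interval_def frac_le_def one_dvd)
  show "contractible_space (clique_space (\<preceq>) (frac_interval G \<rho> r x k))"
  proof (rule contractible_raise[OF finite_frac_interval[OF x] _ _ one])
    fix v assume v: "v \<in> frac_interval G \<rho> r x k"
    \<comment> \<open>An element that changes gets fractional part 1. As \<open>k\<close> is at
      least 2, it stays below the top \<open>(x, k)\<close> without reaching it.\<close>
    then show "(fst v, max (snd v) 1) \<in> frac_interval G \<rho> r x k"
      using k frac_intervalD[OF v] by (cases "snd v = 0") (auto simp: frac_interval_def frac_le_def max_def prod_eq_iff)
  qed (rule frac_intervalD(1))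
  show "indicator {(\<one>, 1)} \<in> clique_points (\<preceq>) (frac_interval G \<rho> r x k)"
    by (rule indicator_in_clique_points[OF finite_frac_interval[OF x] one]) (simp add: le_refl)
qed

text \<open>\<open>(x, 0)\<close> is the one element that raising would send to the excluded top
  \<open>(x, 1)\<close>. No other element of the interval lies above it, so its link is the interval
  below it. For \<open>x = \<one>\<close> it would be the excluded bottom.\<close>

lemma frac_interval_1_suspension:
  fixes Z :: "'p susp_point topology"
  assumes x: "x \<in> carrier G" "x \<noteq> \<one>" and r: "2 \<le> r"
    and Z: "clique_space (\<preceq>) (frac_interval G \<rho> r x 0) homotopy_equivalent_space Z"
  shows "clique_space (\<preceq>) (frac_interval G \<rho> r x 1) homotopy_equivalent_space suspension Z"
proof -
  let ?m = "(x, 0)"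
  define P where "P = frac_interval G \<rho> r x 1 - {?m}"
  have mem: "v \<in> P \<longleftrightarrow> fst v \<in> carrier G \<and> snd v < r \<and> v \<noteq> (\<one>, 0) \<and> v \<noteq> (x, 1) \<and> v \<preceq> (x, 1) \<and> v \<noteq> (x, 0)" for v
    by (auto simp: P_def frac_interval_def)
  have fin: "finite P" unfolding P_def using finite_frac_interval[OF x(1)] by simp
  have one: "(\<one>, 1) \<in> P" using x r by (auto simp: mem frac_le_def one_dvd)
  have eq: "frac_interval G \<rho> r x 1 = insert ?m P"
    using x r by (auto simp: P_def frac_interval_def frac_le_def dvd_refl)
  have raise: "(fst v, max (snd v) 1) \<in> P" if v: "v \<in> P" for v
    using r v by (cases "snd v = 0") (auto simp: mem frac_le_def max_def prod_eq_iff)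
  have link: "{v \<in> P. comparable (\<preceq>) v ?m} = frac_interval G \<rho> r x 0"
  proof (intro equalityI subsetI)
    fix v assume v: "v \<in> {v \<in> P. comparable (\<preceq>) v ?m}"
    have "\<not> ?m \<preceq> v"
    proof
      assume mv: "?m \<preceq> v"
      have "fst v divides x" using v le_fst_dvd[of v "(x, 1)"] by (simp add: mem)
      moreover have "x divides fst v" using le_fst_dvd[OF mv] x by simp
      ultimately have "fst v = x" using dvd_antisym v x by (simp add: mem)
      then show False
        using v not_rho_dvd_self[OF x(1)] by (auto simp: mem frac_le_def prod_eq_iff split: if_splits)
    qed
    then show "v \<in> frac_interval G \<rho> r x 0" using v by (auto simp: mem frac_interval_def)
  next
    fix v assume v: "v \<in> frac_interval G \<rho> r x 0"
    have "v \<preceq> (x, 1)" "v \<noteq> (x, 1)"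
      using frac_intervalD[OF v] not_rho_dvd_self[OF x(1)] by (auto simp: frac_le_def split: if_splits)
    then show "v \<in> {v \<in> P. comparable (\<preceq>) v ?m}" using frac_intervalD[OF v] by (simp add: mem)
  qed
  have c: "contractible_space (clique_space (\<preceq>) P)"
    by (rule contractible_raise[OF fin _ raise one]) (simp add: mem)
  have i: "indicator {(\<one>, 1)} \<in> clique_points (\<preceq>) P"
    by (rule indicator_in_clique_points[OF fin one]) (simp add: le_refl)
  show ?thesis
    unfolding eq
  proof (rule clique_space_suspension_link[OF fin _ _ i c])
    show "clique_space (\<preceq>) {v \<in> P. comparable (\<preceq>) v ?m} homotopy_equivalent_space Z"
      unfolding link by (rule Z)
  qed (use x in \<open>simp_all add: mem le_refl\<close>)
qed

text \<open>Below an element with fractional part 0 every positive fractional part costs a full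
  \<rho>, whatever its value. So lowering it to 1 stays inside the interval.\<close>

lemma frac_interval_0_equiv:
  assumes x: "x \<in> carrier G" and r: "2 \<le> r"
  shows "clique_space (\<preceq>) (frac_interval G \<rho> r x 0) homotopy_equivalent_space clique_space (\<preceq>) (frac_interval G \<rho> 2 x 0)"
proof -
  let ?P = "frac_interval G \<rho> r x 0" and ?P' = "frac_interval G \<rho> 2 x 0"
  let ?f = "\<lambda>v::'a \<times> nat. (fst v, min (snd v) 1)"
  note fin = finite_frac_interval[OF x]
  have ord: "antisymp_on ?P (\<preceq>)" "transp_on ?P (\<preceq>)" "reflp_on ?P (\<preceq>)"
    using le_order_on[of ?P] frac_intervalD(1) by blast+
  have f: "?f ` ?P \<subseteq> ?P'"
  proof clarify
    fix y i assume "(y, i) \<in> ?P"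
    from frac_intervalD[OF this] show "(fst (y, i), min (snd (y, i)) 1) \<in> ?P'"
      by (cases "i = 0") (auto simp: frac_interval_def frac_le_def min_def)
  qed
  have sub: "?P' \<subseteq> ?P" using r by (auto simp: frac_interval_def)
  have mono: "monotone_on ?P (\<preceq>) (\<preceq>) ?f"
    by (rule monotone_lower) (rule frac_intervalD(1))
  have "homotopy_equivalence (clique_space (\<preceq>) ?P) (clique_space (\<preceq>) ?P') (push_forward ?P ?f)"
  proof (rule push_forward_equivalence[OF fin fin f, of id])
    show "id ` ?P' \<subseteq> ?P" using sub by auto
    show "comparable (\<preceq>) (?f v) (?f w)" if "v \<in> ?P" "w \<in> ?P" "v \<preceq> w" for v w
      using monotone_onD[OF mono that] by blast
    show "homotopic (clique_space (\<preceq>) ?P) (clique_space (\<preceq>) ?P) (push_forward ?P (id \<circ> ?f)) (push_forward ?P id)"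
      unfolding id_comp
    proof (rule homotopic_push_forward_le[OF fin fin ord ord(3,2) _ mono])
      show "?f ` ?P \<subseteq> ?P" using f sub by blast
      show "?f v \<preceq> id v" if "v \<in> ?P" for v
        using frac_intervalD(1)[OF that] by (simp add: frac_le_def dvd_refl)
    qed (auto simp: monotone_on_def)
    show "?f (id v) = v" if "v \<in> ?P'" for v
      using frac_intervalD(2)[OF that] by (simp add: prod_eq_iff)
  qed auto
  then show ?thesis unfolding homotopy_equivalent_space_iff_equivalence by blast
qed

text \<open>The element \<open>(x, 1)\<close> is maximal in the interval below \<open>x + \<rho>\<close>. Deleting it leaves the interval of the
  original monoid, and the factorization \<open>\<rho> = \<sigma> + \<tau>\<close> makes the inclusion of its link null-homotopic.\<close>

lemma frac_interval_0_cone: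
  assumes x: "x \<in> carrier G" and \<sigma>: "\<sigma> \<in> carrier G" "\<sigma> \<noteq> \<one>" and \<tau>: "\<tau> \<in> carrier G" "\<tau> \<noteq> \<one>" and \<rho>: "\<rho> = \<sigma> \<otimes> \<tau>"
  defines "P \<equiv> frac_interval G \<rho> 2 (x \<otimes> \<rho>) 0 - {(x, 1)}"
    and "Q \<equiv> open_interval G (x \<otimes> \<rho>)" and "g \<equiv> (\<lambda>v::'a \<times> nat. if snd v = 0 then fst v else fst v \<otimes> \<rho>)"
  shows "cone_attached (clique_space (\<preceq>) (frac_interval G \<rho> 2 x 1)) (clique_space (\<preceq>) P) id
           (clique_space (\<preceq>) (frac_interval G \<rho> 2 (x \<otimes> \<rho>) 0)) id (cone_point (x, 1)) (indicator {(x, 1)})" (is ?thesis1)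
    and "homotopy_equivalence (clique_space (\<preceq>) P) (clique_space (\<lambda>a b. a divides b) Q) (push_forward P g)" (is ?thesis2)
    and "homotopic (clique_space (\<preceq>) (frac_interval G \<rho> 2 x 1)) (clique_space (\<lambda>a b. a divides b) Q)
           (push_forward P g \<circ> id) (\<lambda>_. indicator {\<sigma>})" (is ?thesis3)
proof -
  let ?x = "x \<otimes> \<rho>" and ?L = "frac_interval G \<rho> 2 x 1"
  let ?D = "\<lambda>a b. a divides b"
  have x': "?x \<in> carrier G" using x rho by simp
  have memP: "v \<in> P \<longleftrightarrow> fst v \<in> carrier G \<and> snd v < 2 \<and> v \<noteq> (\<one>, 0) \<and> v \<noteq> (?x, 0) \<and> v \<preceq> (?x, 0) \<and> v \<noteq> (x, 1)" for v
    by (auto simp: P_def frac_interval_def)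
  have memL: "v \<in> ?L \<longleftrightarrow> fst v \<in> carrier G \<and> snd v < 2 \<and> v \<noteq> (\<one>, 0) \<and> v \<noteq> (x, 1) \<and> fst v divides x" for v
    by (auto simp: frac_interval_def frac_le_def)
  have memQ: "y \<in> Q \<longleftrightarrow> y \<in> carrier G \<and> y \<noteq> \<one> \<and> y \<noteq> ?x \<and> y divides ?x" for y
    by (auto simp: Q_def open_interval_def)
  have finP: "finite P" unfolding P_def using finite_frac_interval[OF x'] by simp
  have finL: "finite ?L" by (rule finite_frac_interval[OF x])
  have finQ: "finite Q" unfolding Q_def by (rule finite_open_interval[OF x'])
  have QG: "Q \<subseteq> carrier G" by (auto simp: memQ)
  have xx: "x divides ?x" using dvd_mult x rho by blast
  have dvd_x: "y divides ?x" "y \<noteq> ?x" if "y \<in> carrier G" "y divides x" for y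
  proof -
    show "y divides ?x" by (rule dvd_trans[OF that(2) xx that(1)])
    show "y \<noteq> ?x" using that(2) not_rho_dvd_self[OF x] by blast
  qed
  have mul_rho: "y \<otimes> \<rho> \<noteq> \<one>" if "y \<in> carrier G" for y using reduced[of y \<rho>] rho that by auto
  have eq: "frac_interval G \<rho> 2 ?x 0 = insert (x, 1) P"
    using x rho x' by (auto simp: P_def frac_interval_def frac_le_def dvd_refl)
  have link: "{v \<in> P. comparable (\<preceq>) v (x, 1)} = ?L"
  proof (intro equalityI subsetI)
    fix v assume v: "v \<in> {v \<in> P. comparable (\<preceq>) v (x, 1)}"
    have "\<not> (x, 1) \<preceq> v"
    proof
      assume xv: "(x, 1) \<preceq> v"
      show False
      proof (cases "snd v = 0")
        case True
        then have "?x divides fst v" "fst v divides ?x" using xv v by (auto simp: memP frac_le_def)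
        then have "fst v = ?x" using dvd_antisym x' v by (simp add: memP)
        then show False using v True by (auto simp: memP prod_eq_iff)
      next
        case False
        then have "x divides fst v" "fst v \<otimes> \<rho> divides ?x" using xv v by (auto simp: memP frac_le_def)
        then have "fst v = x" using dvd_antisym[of "fst v" x] mult_dvd_cancel[of "fst v" \<rho> x] x rho v by (simp add: memP)
        then show False using v False by (auto simp: memP prod_eq_iff)
      qed
    qed
    then have "v \<preceq> (x, 1)" using v by simp
    then have "fst v divides x" using v le_fst_dvd[of v "(x, 1)"] by (simp add: memP)
    then show "v \<in> ?L" unfolding memL using v by (simp add: memP)
  next
    fix v assume v: "v \<in> ?L"
    have v: "fst v \<in> carrier G" "snd v < 2" "v \<noteq> (\<one>, 0)" "v \<noteq> (x, 1)" "fst v divides x"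
      using v unfolding memL by auto
    have "v \<preceq> (?x, 0)"
      using v dvd_x[of "fst v"] mult_dvd_mult[of "fst v" x \<rho>] x rho by (simp add: frac_le_def)
    moreover have "v \<preceq> (x, 1)" "v \<noteq> (?x, 0)"
      using v dvd_x(2)[of "fst v"] by (auto simp: frac_le_def)
    ultimately show "v \<in> {v \<in> P. comparable (\<preceq>) v (x, 1)}"
      unfolding mem_Collect_eq memP using v by blast
  qed
  show ?thesis1
    using cone_attached_clique_space[where R = "(\<preceq>)" and m = "(x, 1)" and P = P] finP x
    unfolding eq link by (simp add: le_refl memP)
  \<comment> \<open>Of all elements of the interval, \<open>(x, 1)\<close> alone would be sent to
    the excluded top \<open>?x\<close>; this is the reason for deleting it.\<close>
  have gQ: "g v \<in> Q" if "v \<in> P" for v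
  proof (cases "snd v = 0")
    case True
    then show ?thesis using that by (auto simp: g_def memP memQ frac_le_def prod_eq_iff)
  next
    case False
    have "fst v \<noteq> x" using that False by (auto simp: memP prod_eq_iff)
    then have "fst v \<otimes> \<rho> \<noteq> ?x" using r_cancel that x rho memP by blast
    then show ?thesis using that False mul_rho rho by (auto simp: g_def memP memQ frac_le_def)
  qed
  have eP: "(y, 0) \<in> P" if "y \<in> Q" for y using that by (auto simp: memP memQ frac_le_def)
  have gmono: "g v divides g w" if "v \<preceq> w" "fst v \<in> carrier G" "fst w \<in> carrier G" for v w
  proof (cases "snd w = 0")
    case True
    then show ?thesis using that by (auto simp: g_def frac_le_def)
  next
    case False
    have "fst v divides fst w" by (rule le_fst_dvd[OF that(1,2)])
    moreover from this have "fst v divides fst w \<otimes> \<rho>"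
      using dvd_trans dvd_mult[OF that(3) rho(1)] that by blast
    ultimately show ?thesis using that False mult_dvd_mult rho by (simp add: g_def)
  qed
  have PG: "fst v \<in> carrier G" if "v \<in> P" for v using that by (simp add: memP)
  have LG: "fst v \<in> carrier G" if "v \<in> ?L" for v using that unfolding memL by simp
  note ordP = le_order_on[of P, OF PG] and ordL = le_order_on[of ?L, OF LG] and ordQ = dvd_order_on[OF QG]
  show ?thesis2
  proof (rule push_forward_equivalence[OF finP finQ, where g = "\<lambda>y. (y, 0)"])
    show "g ` P \<subseteq> Q" using gQ by auto
    show "(\<lambda>y. (y, 0)) ` Q \<subseteq> P" using eP by auto
    show "comparable ?D (g v) (g w)" if "v \<in> P" "w \<in> P" "v \<preceq> w" for v w
      using gmono[OF that(3)] PG that by blast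
    show "comparable (\<preceq>) (y, 0) (z, 0)" if "y \<in> Q" "z \<in> Q" "y divides z" for y z
      using that by (simp add: frac_le_def)
    have "homotopic (clique_space (\<preceq>) P) (clique_space (\<preceq>) P) (push_forward P id) (push_forward P ((\<lambda>y. (y, 0)) \<circ> g))"
    proof (rule homotopic_push_forward_le[OF finP finP ordP ordP(3,2)])
      show "((\<lambda>y. (y, 0)) \<circ> g) ` P \<subseteq> P" using gQ eP by auto
      show "monotone_on P (\<preceq>) (\<preceq>) ((\<lambda>y. (y, 0)) \<circ> g)"
        by (rule monotone_onI) (use gmono PG in \<open>auto simp: frac_le_def\<close>)
      show "id v \<preceq> ((\<lambda>y. (y, 0)) \<circ> g) v" if "v \<in> P" for v
        using PG[OF that] rho by (auto simp: frac_le_def g_def dvd_refl)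
    qed (auto simp: monotone_on_def)
    then show "homotopic (clique_space (\<preceq>) P) (clique_space (\<preceq>) P) (push_forward P ((\<lambda>y. (y, 0)) \<circ> g)) (push_forward P id)"
      by (rule homotopic_with_symD)
    show "g (y, 0) = y" for y by (simp add: g_def)
  qed
  have LP: "?L \<subseteq> P" using link by blast
  \<comment> \<open>The cofactor \<open>c \<otimes> \<tau>\<close> is not \<open>\<one>\<close>
    because \<tau> is not, so \<open>y \<otimes> \<sigma>\<close> stays strictly below the top. Here
    reducibility of \<rho> enters: a shift of \<open>x\<close> by all of \<rho> would reach the
    top.\<close>
  have sQ: "y \<otimes> \<sigma> \<in> Q" if y: "y \<in> carrier G" "y divides x" for y
  proof -
    obtain c where c: "c \<in> carrier G" "x = y \<otimes> c" using y by (auto simp: factor_def)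
    have eq': "?x = (y \<otimes> \<sigma>) \<otimes> (c \<otimes> \<tau>)" unfolding c \<rho> using c y \<sigma> \<tau> by (simp add: m_ac)
    have "y \<otimes> \<sigma> \<noteq> ?x"
    proof
      assume "y \<otimes> \<sigma> = ?x"
      from this eq' have "y \<otimes> \<sigma> = (y \<otimes> \<sigma>) \<otimes> (c \<otimes> \<tau>)" by (rule trans)
      with y c \<sigma> \<tau> have "c \<otimes> \<tau> = \<one>" by (intro mult_eq_self[of "y \<otimes> \<sigma>"]) auto
      then show False using reduced[of c \<tau>] c \<tau> by simp
    qed
    moreover have "y \<otimes> \<sigma> divides ?x" using eq' c \<tau> by (auto simp: factor_def)
    moreover have "y \<otimes> \<sigma> \<noteq> \<one>" using reduced[of y \<sigma>] y \<sigma> by auto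
    ultimately show ?thesis using y \<sigma> by (simp add: memQ)
  qed
  \<comment> \<open>\<open>h\<close> shifts by \<sigma> only the elements with a positive fractional
    part, \<open>h'\<close> shifts all of them. \<open>h\<close> lies below both \<open>g\<close>
    and \<open>h'\<close>, and \<open>h'\<close> lies above the constant \<sigma>.\<close>
  define h where "h = (\<lambda>v::'a \<times> nat. if snd v = 0 then fst v else fst v \<otimes> \<sigma>)"
  define h' where "h' = (\<lambda>v::'a \<times> nat. fst v \<otimes> \<sigma>)"
  have s_rho: "y \<otimes> \<sigma> divides y \<otimes> \<rho>" if "y \<in> carrier G" for y
    using mult_dvd_mult[of \<sigma> \<rho> y] dvd_mult[of \<sigma> \<tau>] that \<sigma> \<tau> rho by (simp add: \<rho> m_comm)
  have hmono: "h v divides h w" if "v \<preceq> w" "fst v \<in> carrier G" "fst w \<in> carrier G" for v w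
  proof (cases "snd w = 0")
    case True
    then show ?thesis using that dvd_trans[OF s_rho[of "fst v"]] \<sigma> by (auto simp: h_def frac_le_def)
  next
    case False
    have "fst v divides fst w" by (rule le_fst_dvd[OF that(1,2)])
    moreover from this have "fst v divides fst w \<otimes> \<sigma>"
      using dvd_trans dvd_mult[OF that(3) \<sigma>(1)] that by blast
    ultimately show ?thesis using that False mult_dvd_mult \<sigma> by (simp add: h_def)
  qed
  have h'mono: "h' v divides h' w" if "v \<preceq> w" "fst v \<in> carrier G" "fst w \<in> carrier G" for v w
    using le_fst_dvd[OF that(1,2)] mult_dvd_mult that \<sigma> by (simp add: h'_def)
  have hQ: "h v \<in> Q" "h' v \<in> Q" if "v \<in> ?L" for v
    using that sQ[of "fst v"] dvd_x[of "fst v"] unfolding memL by (auto simp: h_def h'_def memQ prod_eq_iff)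
  have \<sigma>Q: "\<sigma> \<in> Q" using sQ[of \<one>] x \<sigma> one_dvd by simp
  have cmp: "homotopic (clique_space (\<preceq>) ?L) (clique_space ?D Q) (push_forward ?L a) (push_forward ?L b)"
    if "\<And>v. v \<in> ?L \<Longrightarrow> a v \<in> Q" "\<And>v. v \<in> ?L \<Longrightarrow> b v \<in> Q"
      "\<And>v w. v \<preceq> w \<Longrightarrow> fst v \<in> carrier G \<Longrightarrow> fst w \<in> carrier G \<Longrightarrow> a v divides a w"
      "\<And>v w. v \<preceq> w \<Longrightarrow> fst v \<in> carrier G \<Longrightarrow> fst w \<in> carrier G \<Longrightarrow> b v divides b w"
      "\<And>v. v \<in> ?L \<Longrightarrow> a v divides b v" for a b
    using that LG by (intro homotopic_push_forward_le[OF finL finQ ordL ordQ(2,1)] monotone_onI) auto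
  have hg: "h v divides g v" and hh': "h v divides h' v" and sh': "\<sigma> divides h' v" if "v \<in> ?L" for v
    using LG[OF that] s_rho[of "fst v"] dvd_mult[of "fst v" \<sigma>] dvd_mult'[of "fst v" \<sigma>] \<sigma>(1)
    by (auto simp: h_def g_def h'_def dvd_refl)
  have 1: "homotopic (clique_space (\<preceq>) ?L) (clique_space ?D Q) (push_forward ?L h) (push_forward ?L g)"
    by (rule cmp; use hQ(1) gQ LP hmono gmono hg in blast)
  have 2: "homotopic (clique_space (\<preceq>) ?L) (clique_space ?D Q) (push_forward ?L h) (push_forward ?L h')"
    by (rule cmp; use hQ hmono h'mono hh' in blast)
  have 3: "homotopic (clique_space (\<preceq>) ?L) (clique_space ?D Q) (push_forward ?L (\<lambda>_. \<sigma>)) (push_forward ?L h')"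
    by (rule cmp; use hQ(2) \<sigma>Q h'mono sh' dvd_refl \<sigma>(1) in blast)
  have "homotopic (clique_space (\<preceq>) ?L) (clique_space ?D Q) (push_forward ?L g) (push_forward ?L (\<lambda>_. \<sigma>))"
    using homotopic_with_trans[OF homotopic_with_trans[OF homotopic_with_symD[OF 1] 2] homotopic_with_symD[OF 3]] .
  then show ?thesis3
    by (rule homotopic_with_eq)
      (auto simp: push_forward_restrict[OF finP LP] push_forward_const[OF finL] simp del: One_nat_def)
qed

end

section \<open>A tower of wedges of joins\<close>

lemma homotopy_equivalent_space_trivial:
  "(trivial_topology :: 'a topology) homotopy_equivalent_space (trivial_topology :: 'b topology)"
  unfolding homotopy_equivalent_space_def by (simp add: homotopic_on_empty)

section \<open>Paths that move base points\<close>

lemma path_component_of_clique_points: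
  assumes fin: "finite P" and xy: "x \<in> P" "y \<in> P" "R x x" "R y y" "comparable R x y"
  shows "path_component_of (clique_space R P) (indicator {x}) (indicator {y})"
proof -
  let ?E = "clique_space R {x}"
  have ne: "indicator {x} \<in> clique_points R {x}" using xy by (intro indicator_in_clique_points) auto
  then have "?E \<noteq> trivial_topology" by (metis empty_iff topspace_discrete_topology topspace_euclidean_subtopology)
  moreover have "homotopic ?E (clique_space R P) (push_forward {x} (\<lambda>_. x)) (push_forward {x} (\<lambda>_. y))"
    using xy by (intro homotopic_push_forward_contiguous[OF _ fin]) auto
  then have "homotopic ?E (clique_space R P) (\<lambda>_. indicator {x}) (\<lambda>_. indicator {y})"
    by (rule homotopic_with_eq) (auto simp: push_forward_const[of "{x}"])
  ultimately show ?thesis unfolding homotopic_constant_maps by blast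
qed

text \<open>The two end points are joined only by a line over a point of the original space, hence
  the need for \<open>z\<close>. This connectedness is what permits either end as base
  point.\<close>

lemma path_component_of_suspension:
  assumes ne: "z \<in> topspace Z" and w: "w \<in> topspace (suspension Z)" and p: "p = South \<or> p = North"
  shows "path_component_of (suspension Z) w p"
proof -
  obtain q a where S: "cone_attached Z (discrete_topology {p}) (\<lambda>_. p) (suspension Z) id q a"
    by (rule cone_attached_suspension[OF p])
  note D = cone_attachedD[OF S]
  have line: "path_component_of (suspension Z) (q (z, t)) p" if "z \<in> topspace Z" "t \<in> {0..1}" for z t
  proof -
    have c: "continuous_map unit_interval (suspension Z) (\<lambda>s. q (z, clamp01 (t * s)))"
      using that(1) by (intro continuous_map_comp2[OF D(3)] continuous_map_clamp01 continuous_map_real_mult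
          continuous_map_canonical_const continuous_map_into_fulltopology[OF continuous_map_id[unfolded id_def]]) auto
    have "path_component_of (suspension Z) (q (z, clamp01 (t * 0))) (q (z, clamp01 (t * 1)))"
      unfolding path_component_of_def pathin_def using c by auto
    then have "path_component_of (suspension Z) p (q (z, t))" using that D by simp
    then show ?thesis by (rule path_component_of_sym)
  qed
  show ?thesis
    using S w
  proof (cases rule: cone_attached_cases)
    case (base y)
    then show ?thesis using D(2) by (auto simp: path_component_of_refl w)
  next
    case apex
    then show ?thesis using line[OF ne, of 1] D(6)[OF ne] by simp
  next
    case (cyl z t)
    then show ?thesis using line by simp
  qed
qed

lemma path_component_of_continuous_image:
  assumes "continuous_map X Y f" "path_component_of X a b"
  shows "path_component_of Y (f a) (f b)"
proof -
  obtain g where "pathin X g" "g 0 = a" "g 1 = b"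
    using assms(2) by (auto simp: path_component_of_def)
  then have "pathin Y (f \<circ> g)" "(f \<circ> g) 0 = f a" "(f \<circ> g) 1 = f b"
    using assms(1) by (auto simp: pathin_def intro: continuous_map_compose)
  then show ?thesis unfolding path_component_of_def by blast
qed

datatype 'q tower_vertex = Elem 'q | Apex | Pole1 | Pole2

text \<open>Level \<open>i\<close> of the tower is the graph \<open>Q i\<close> with a cone attached: a new vertex \<open>Apex\<close> and the vertex \<open>\<sigma>\<close>
  are both joined to two poles and to all higher levels. So \<open>Apex\<close>, \<open>\<sigma>\<close> and the two poles build a double
  suspension of the higher levels.\<close>

definition upper :: "'q \<Rightarrow> 'q tower_vertex \<Rightarrow> bool" where
  "upper \<sigma> u \<longleftrightarrow> u = Elem \<sigma> \<or> u = Apex \<or> u = Pole1 \<or> u = Pole2"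

text \<open>Between different levels the lower vertex alone decides. Within a level
  \<open>Apex\<close> and \<sigma> are not adjacent, and neither are the two poles, so these four
  vertices form a 4-cycle, the join of two 0-spheres.\<close>

definition tower_adj :: "('q \<Rightarrow> 'q \<Rightarrow> bool) \<Rightarrow> 'q \<Rightarrow> nat \<times> 'q tower_vertex \<Rightarrow> nat \<times> 'q tower_vertex \<Rightarrow> bool" where
  "tower_adj R \<sigma> v w \<longleftrightarrow>
     (if fst v < fst w then upper \<sigma> (snd v)
      else if fst w < fst v then upper \<sigma> (snd w)
      else snd v = snd w
        \<or> (\<exists>x y. snd v = Elem x \<and> snd w = Elem y \<and> comparable R x y)
        \<or> (snd v \<in> {Elem \<sigma>, Apex} \<and> snd w \<in> {Pole1, Pole2})
        \<or> (snd w \<in> {Elem \<sigma>, Apex} \<and> snd v \<in> {Pole1, Pole2}))"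

lemma tower_adj_refl [simp]: "tower_adj R \<sigma> v v"
  by (simp add: tower_adj_def)

lemma tower_adj_sym: "tower_adj R \<sigma> v w \<longleftrightarrow> tower_adj R \<sigma> w v"
  by (auto simp: tower_adj_def)

lemma comparable_tower_adj: "comparable (tower_adj R \<sigma>) v w \<longleftrightarrow> tower_adj R \<sigma> v w"
  by (simp add: tower_adj_sym[of R \<sigma> w v])

text \<open>\<open>pres i\<close> tells whether the summand of level \<open>Suc i\<close> is a space
  rather than S^{-2}. If it is not, the poles of level \<open>i\<close> are omitted and the level
  above is empty, so that the last apex has an empty link, as the suspension of S^{-2} has to be.
  The assumptions confine this to the last level.\<close>

locale tower =
  fixes R :: "'q \<Rightarrow> 'q \<Rightarrow> bool" and Q :: "nat \<Rightarrow> 'q set" and \<sigma> :: 'q and pres :: "nat \<Rightarrow> bool" and L :: nat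
  assumes fin: "finite (Q i)"
    and refl: "x \<in> Q i \<Longrightarrow> R x x"
    and sigma: "0 < i \<Longrightarrow> i < L \<Longrightarrow> \<sigma> \<in> Q i"
    and pres: "Suc i < L \<Longrightarrow> pres i"
    and empty: "\<not> pres i \<Longrightarrow> Q (Suc i) = {}"
begin

abbreviation adj (infix \<open>\<bowtie>\<close> 50) where "v \<bowtie> w \<equiv> tower_adj R \<sigma> v w"

abbreviation "level_space i \<equiv> clique_space R (Q i)"

text \<open>The top level \<open>b\<close> keeps only its elements: apexes and poles serve to attach
  the levels above them.\<close>

definition levels :: "nat \<Rightarrow> nat \<Rightarrow> (nat \<times> 'q tower_vertex) set" where
  "levels a b = {(i, u). a \<le> i \<and> i \<le> b \<and>
     ((\<exists>x\<in>Q i. u = Elem x) \<or> (u = Apex \<and> i < b) \<or> ((u = Pole1 \<or> u = Pole2) \<and> i < b \<and> pres i))}"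

definition poles :: "nat \<Rightarrow> (nat \<times> 'q tower_vertex) set" where
  "poles i = (if pres i then {(i, Pole1), (i, Pole2)} else {})"

lemma finite_levels [simp]: "finite (levels a b)"
proof (rule finite_subset)
  show "levels a b \<subseteq> Sigma {a..b} (\<lambda>i. Elem ` Q i \<union> {Apex, Pole1, Pole2})"
    by (auto simp: levels_def)
qed (simp add: fin)

lemma finite_poles [simp]: "finite (poles i)"
  by (simp add: poles_def)

lemma levels_same: "levels i i = (\<lambda>x. (i, Elem x)) ` Q i"
  by (auto simp: levels_def)

lemma join_pair:
  fixes Z :: "'p susp_point topology"
  assumes fin: "finite P" and xy: "x \<notin> P" "y \<notin> P" "\<not> x \<bowtie> y"
    and R: "\<And>v. v \<in> P \<Longrightarrow> v \<bowtie> x" "\<And>v. v \<in> P \<Longrightarrow> v \<bowtie> y"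
    and Z: "clique_space (\<bowtie>) P homotopy_equivalent_space Z"
  shows "clique_space (\<bowtie>) (insert x (insert y P)) homotopy_equivalent_space suspension Z"
  using assms tower_adj_sym[of R \<sigma> x y] by (intro clique_space_join_two_points) auto

lemma poles_join:
  fixes Z :: "'p susp_point topology"
  assumes Z: "clique_space (\<bowtie>) (levels (Suc i) b) homotopy_equivalent_space Z" and pr: "pres i"
  shows "clique_space (\<bowtie>) (poles i \<union> levels (Suc i) b) homotopy_equivalent_space suspension Z"
proof -
  have "poles i \<union> levels (Suc i) b = insert (i, Pole1) (insert (i, Pole2) (levels (Suc i) b))"
    using pr by (auto simp: poles_def)
  moreover have "v \<bowtie> (i, Pole1)" "v \<bowtie> (i, Pole2)" if "v \<in> levels (Suc i) b" for v
    using that by (auto simp: levels_def tower_adj_def upper_def)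
  moreover have "(i, u) \<notin> levels (Suc i) b" for u by (simp add: levels_def)
  moreover have "\<not> (i, Pole1) \<bowtie> (i, Pole2)" by (simp add: tower_adj_def)
  ultimately show ?thesis
    using join_pair[OF finite_levels _ _ _ _ _ Z, of "(i, Pole1)" "(i, Pole2)"] by simp
qed

text \<open>Deleting the lowest apex leaves a complex that retracts onto the lowest level, since all other new
  vertices are adjacent to \<open>\<sigma>\<close>.\<close>

lemma tower_bottom_cone:
  assumes i: "0 < i" "i < b" "b \<le> L"
  defines "P \<equiv> levels i b - {(i, Apex)}"
    and "g \<equiv> (\<lambda>v. case v of (j, Elem x) \<Rightarrow> if j = i then x else \<sigma> | _ \<Rightarrow> \<sigma>)"
  shows "cone_attached (clique_space (\<bowtie>) (poles i \<union> levels (Suc i) b)) (clique_space (\<bowtie>) P) id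
           (clique_space (\<bowtie>) (levels i b)) id (cone_point (i, Apex)) (indicator {(i, Apex)})" (is ?thesis1)
    and "homotopy_equivalence (clique_space (\<bowtie>) P) (level_space i) (push_forward P g)" (is ?thesis2)
    and "homotopic (clique_space (\<bowtie>) (poles i \<union> levels (Suc i) b)) (level_space i)
           (push_forward P g \<circ> id) (\<lambda>_. indicator {\<sigma>})" (is ?thesis3)
proof -
  let ?L = "poles i \<union> levels (Suc i) b"
  have s: "\<sigma> \<in> Q i" "R \<sigma> \<sigma>" using sigma[of i] refl[of \<sigma> i] i by auto
  have finP: "finite P" by (simp add: P_def)
  have finL: "finite ?L" by simp
  have eq: "levels i b = insert (i, Apex) P" using i by (auto simp: P_def levels_def)
  \<comment> \<open>\<open>Apex\<close> is adjacent to no element of its own level, but to its poles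
    and to all higher levels. So its link is the next part of the tower, suspended if the poles are
    present.\<close>
  have link: "{v \<in> P. comparable (\<bowtie>) v (i, Apex)} = ?L"
  proof (rule Set.set_eqI)
    fix v :: "nat \<times> 'q tower_vertex"
    obtain j u where v: "v = (j, u)" by (cases v)
    have "v \<in> {v \<in> P. comparable (\<bowtie>) v (i, Apex)} \<longleftrightarrow> v \<in> P \<and> v \<bowtie> (i, Apex)"
      by (simp only: comparable_tower_adj mem_Collect_eq)
    also have "\<dots> \<longleftrightarrow> v \<in> ?L"
      unfolding v using i
      by (cases u; cases "j = i") (auto simp: P_def levels_def poles_def tower_adj_def upper_def)
    finally show "v \<in> {v \<in> P. comparable (\<bowtie>) v (i, Apex)} \<longleftrightarrow> v \<in> ?L" .
  qed
  have memP: "v \<in> ?L \<or> (\<exists>x\<in>Q i. v = (i, Elem x))" if "v \<in> P" for v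
    using that by (cases v; cases "fst v = i") (auto simp: P_def levels_def poles_def split: if_splits)
  have LP: "?L \<subseteq> P" using link by blast
  have gL: "g v = \<sigma>" if "v \<in> ?L" for v
    using that by (auto simp: g_def levels_def poles_def split: if_splits)
  have g_elem: "g (i, Elem x) = x" for x by (simp add: g_def)
  have gQ: "g v \<in> Q i" if "v \<in> P" for v using memP[OF that] gL[of v] s g_elem by metis
  have eP: "(i, Elem x) \<in> P" if "x \<in> Q i" for x using that i by (auto simp: P_def levels_def)
  have Ls: "v \<bowtie> (i, Elem \<sigma>)" if "v \<in> ?L" for v
    using that by (cases v) (auto simp: levels_def poles_def tower_adj_def upper_def split: if_splits)
  have Lx: "x = \<sigma>" if "v \<in> ?L" "v \<bowtie> (i, Elem x)" for v x
    using that by (cases v) (auto simp: levels_def poles_def tower_adj_def upper_def split: if_splits)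
  have elem_adj: "(i, Elem x) \<bowtie> (i, Elem y) \<longleftrightarrow> x = y \<or> comparable R x y" for x y
    by (auto simp: tower_adj_def)
  have gg: "comparable R (g v) (g w)" and eg: "v \<bowtie> (i, Elem (g w))"
    if v: "v \<in> P" and w: "w \<in> P" and vw: "v \<bowtie> w" for v w
  proof -
    consider "v \<in> ?L" "w \<in> ?L" | x where "v \<in> ?L" "x \<in> Q i" "w = (i, Elem x)"
      | x where "w \<in> ?L" "x \<in> Q i" "v = (i, Elem x)"
      | x y where "x \<in> Q i" "y \<in> Q i" "v = (i, Elem x)" "w = (i, Elem y)"
      using memP[OF v] memP[OF w] by blast
    then have "comparable R (g v) (g w) \<and> v \<bowtie> (i, Elem (g w))"
    proof cases
      case 1
      then show ?thesis using gL Ls s by simp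
    next
      case 2
      then show ?thesis using gL Lx[of v x] Ls s vw by (simp add: g_elem)
    next
      case 3
      then have "x = \<sigma>" using Lx[of w x] vw tower_adj_sym[of R \<sigma> v w] by simp
      then show ?thesis using 3 gL s by (simp add: g_elem)
    next
      case 4
      then show ?thesis using vw refl[of x i] by (auto simp: g_elem elem_adj)
    qed
    then show "comparable R (g v) (g w)" "v \<bowtie> (i, Elem (g w))" by auto
  qed
  show ?thesis1
    using cone_attached_clique_space[where R = "(\<bowtie>)" and m = "(i, Apex)" and P = P] finP
    unfolding eq link by (simp add: P_def)
  show ?thesis2
  proof (rule push_forward_equivalence[OF finP fin, where g = "\<lambda>x. (i, Elem x)"])
    show "g ` P \<subseteq> Q i" using gQ by auto
    show "(\<lambda>x. (i, Elem x)) ` Q i \<subseteq> P" using eP by auto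
    show "comparable R (g v) (g w)" if "v \<in> P" "w \<in> P" "v \<bowtie> w" for v w
      by (rule gg[OF that])
    show "comparable (\<bowtie>) (i, Elem x) (i, Elem y)" if "x \<in> Q i" "y \<in> Q i" "R x y" for x y
      using that by (simp add: elem_adj)
    have "homotopic (clique_space (\<bowtie>) P) (clique_space (\<bowtie>) P) (push_forward P id) (push_forward P ((\<lambda>x. (i, Elem x)) \<circ> g))"
    proof (rule homotopic_push_forward_contiguous[OF finP finP])
      show "((\<lambda>x. (i, Elem x)) \<circ> g) ` P \<subseteq> P" using gQ eP by auto
      show "comparable (\<bowtie>) (((\<lambda>x. (i, Elem x)) \<circ> g) v) (((\<lambda>x. (i, Elem x)) \<circ> g) w)"
        if "v \<in> P" "w \<in> P" "v \<bowtie> w" for v w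
        using gg[OF that] by (auto simp: elem_adj)
      show "comparable (\<bowtie>) (id v) (((\<lambda>x. (i, Elem x)) \<circ> g) w)"
        if "v \<in> P" "w \<in> P" "comparable (\<bowtie>) v w" for v w
        using eg[OF that(1,2)] that(3) tower_adj_sym[of R \<sigma> v w] by auto
    qed auto
    then show "homotopic (clique_space (\<bowtie>) P) (clique_space (\<bowtie>) P) (push_forward P ((\<lambda>x. (i, Elem x)) \<circ> g)) (push_forward P id)"
      by (rule homotopic_with_symD)
    show "g (i, Elem x) = x" for x by (rule g_elem)
  qed
  have c: "push_forward P g u = indicator {\<sigma>}" if "u \<in> clique_points (\<bowtie>) ?L" for u
    using push_forward_restrict[OF finP LP that, of g] push_forward_const[OF finL that, of g \<sigma>] gL by simp
  have "indicator {\<sigma>} \<in> clique_points R (Q i)" by (rule indicator_in_clique_points[where R = R, OF fin s])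
  then have "homotopic (clique_space (\<bowtie>) ?L) (level_space i) (\<lambda>_. indicator {\<sigma>}) (\<lambda>_. indicator {\<sigma>})"
    by simp
  then show ?thesis3
    by (rule homotopic_with_eq) (auto simp: c)
qed

text \<open>The poles at level 0 realize the additional suspension in the case \<open>k = 1\<close>.\<close>

definition bottom :: "nat \<Rightarrow> (nat \<times> 'q tower_vertex) set" where
  "bottom k = (if k = 0 then {} else {(0, Pole1), (0, Pole2)})"

lemma finite_bottom [simp]: "finite (bottom k)"
  by (simp add: bottom_def)

text \<open>The index is shifted because the poles of level \<open>i - 1\<close> are those that
  suspend level \<open>i\<close>.\<close>

definition summand :: "nat \<Rightarrow> ('q \<Rightarrow> real) ext_space" where
  "summand i = (if 0 < i \<and> \<not> pres (i - 1) then SphereMinus2 else Space (level_space i))"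

section \<open>Homotopy types of the links of the apexes\<close>

lemma join_pair_ext:
  fixes F :: "'p ext_space"
  assumes "finite P" "x \<notin> P" "y \<notin> P" "\<not> x \<bowtie> y" "\<And>v. v \<in> P \<Longrightarrow> v \<bowtie> x" "\<And>v. v \<in> P \<Longrightarrow> v \<bowtie> y"
    and F: "Space (clique_space (\<bowtie>) P) \<simeq>\<^sub>e iter_suspension n F"
  shows "Space (clique_space (\<bowtie>) (insert x (insert y P))) \<simeq>\<^sub>e iter_suspension (Suc n) F"
proof -
  obtain Z where Z: "iter_suspension n F = Space Z" using F by (cases "iter_suspension n F") auto
  then have "clique_space (\<bowtie>) P homotopy_equivalent_space Z" using F by simp
  from join_pair[OF assms(1-6) this]
  have "Space (clique_space (\<bowtie>) (insert x (insert y P))) \<simeq>\<^sub>e ext_suspension (iter_suspension n F)"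
    unfolding Z by simp
  then show ?thesis by (simp add: iter_suspension_def)
qed

lemma level_isomorphism:
  "homotopy_equivalence (clique_space (\<bowtie>) (levels i i)) (level_space i)
     (push_forward (levels i i) (\<lambda>v. case snd v of Elem x \<Rightarrow> x | _ \<Rightarrow> \<sigma>))"
proof (rule push_forward_isomorphism[OF finite_levels fin, where g = "\<lambda>x. (i, Elem x)"])
  show "comparable R (case snd v of Elem x \<Rightarrow> x | _ \<Rightarrow> \<sigma>) (case snd w of Elem x \<Rightarrow> x | _ \<Rightarrow> \<sigma>)"
    if "v \<in> levels i i" "w \<in> levels i i" "v \<bowtie> w" for v w
    using that refl by (auto simp: levels_same tower_adj_def)
qed (auto simp: levels_same tower_adj_def)

lemma level_base: "clique_space (\<bowtie>) (levels i i) homotopy_equivalent_space base_space (level_space i)"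
  using homotopy_equivalence_compose[OF level_isomorphism homotopy_equivalence_base_space]
  unfolding homotopy_equivalent_space_iff_equivalence by blast

text \<open>If the poles are missing, both sides are empty: the link has no vertices, and the
  suspension of S^{-2} is the empty space.\<close>

lemma top_link:
  assumes j: "0 < j"
  shows "Space (clique_space (\<bowtie>) (poles j \<union> levels (Suc j) (Suc j))) \<simeq>\<^sub>e iter_suspension 1 (summand (Suc j))"
proof (cases "pres j")
  case True
  then have "clique_space (\<bowtie>) (poles j \<union> levels (Suc j) (Suc j)) homotopy_equivalent_space
      suspension (base_space (level_space (Suc j)))"
    by (intro poles_join level_base) auto
  then show ?thesis using True by (simp add: summand_def iter_suspension_def)
next
  case False
  then have "poles j \<union> levels (Suc j) (Suc j) = {}"
    using empty[of j] by (simp add: poles_def levels_same)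
  then show ?thesis using False
    by (simp add: summand_def iter_suspension_def homotopy_equivalent_space_trivial)
qed

text \<open>The vertices on the levels from \<open>a\<close> to \<open>j - 1\<close> that are
  adjacent to \<open>(j, Apex)\<close>. For \<open>0 < a\<close> and \<open>j < L\<close> all of
  them occur in the tower, since \<sigma> and the poles belong to each of these levels.\<close>

definition middle :: "nat \<Rightarrow> nat \<Rightarrow> (nat \<times> 'q tower_vertex) set" where
  "middle a j = {(i, u). a \<le> i \<and> i < j \<and> upper \<sigma> u}"

text \<open>Each level in between adds two pairs of non-adjacent vertices, \<sigma> with the apex
  and the two poles, joined to each other and to everything above. That makes two suspensions per
  level; the remaining one comes from level \<open>j\<close> itself.\<close>

lemma middle_link:
  assumes j: "0 < j" "j < L" and a: "0 < a" "a \<le> j"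
  shows "finite (middle a j) \<and> Space (clique_space (\<bowtie>) (middle a j \<union> (poles j \<union> levels (Suc j) (Suc j))))
     \<simeq>\<^sub>e iter_suspension (2 * (j - a) + 1) (summand (Suc j))"
  using a(2,1)
proof (induction a rule: inc_induct)
  case base
  have "middle j j = {}" by (auto simp: middle_def)
  then show ?case using top_link[OF j(1)] by simp
next
  case (step a)
  let ?T = "poles j \<union> levels (Suc j) (Suc j)"
  let ?P = "middle (Suc a) j \<union> ?T"
  have fin: "finite (middle (Suc a) j)"
    and IH: "Space (clique_space (\<bowtie>) ?P) \<simeq>\<^sub>e iter_suspension (2 * (j - Suc a) + 1) (summand (Suc j))"
    using step by auto
  have above: "a < fst v" if "v \<in> ?P" for v
    using that step.hyps by (auto simp: middle_def poles_def levels_def split: if_splits)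
  have out: "(a, u) \<notin> ?P" for u using above[of "(a, u)"] by auto
  have up: "v \<bowtie> (a, u)" if "v \<in> ?P" "upper \<sigma> u" for v u
    using above[OF that(1)] that(2) by (simp add: tower_adj_def)
  have 1: "Space (clique_space (\<bowtie>) (insert (a, Elem \<sigma>) (insert (a, Apex) ?P)))
      \<simeq>\<^sub>e iter_suspension (Suc (2 * (j - Suc a) + 1)) (summand (Suc j))"
  proof (rule join_pair_ext[OF _ _ _ _ _ _ IH])
    show "v \<bowtie> (a, Elem \<sigma>)" "v \<bowtie> (a, Apex)" if "v \<in> ?P" for v
      using up[OF that, of "Elem \<sigma>"] up[OF that, of Apex] by (simp_all add: upper_def)
    show "(a, Elem \<sigma>) \<notin> ?P" "(a, Apex) \<notin> ?P" using out by blast+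
  qed (use fin in \<open>simp_all add: tower_adj_def\<close>)
  have 2: "Space (clique_space (\<bowtie>) (insert (a, Pole1) (insert (a, Pole2) (insert (a, Elem \<sigma>) (insert (a, Apex) ?P)))))
      \<simeq>\<^sub>e iter_suspension (Suc (Suc (2 * (j - Suc a) + 1))) (summand (Suc j))"
  proof (rule join_pair_ext[OF _ _ _ _ _ _ 1])
    show "v \<bowtie> (a, Pole1)" "v \<bowtie> (a, Pole2)" if "v \<in> insert (a, Elem \<sigma>) (insert (a, Apex) ?P)" for v
      using that up[of v Pole1] up[of v Pole2] by (auto simp: upper_def tower_adj_def)
    show "(a, Pole1) \<notin> insert (a, Elem \<sigma>) (insert (a, Apex) ?P)" "(a, Pole2) \<notin> insert (a, Elem \<sigma>) (insert (a, Apex) ?P)"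
      using out by blast+
  qed (use fin in \<open>simp_all add: tower_adj_def\<close>)
  have eq: "insert (a, Pole1) (insert (a, Pole2) (insert (a, Elem \<sigma>) (insert (a, Apex) (middle (Suc a) j)))) = middle a j"
    using step.hyps by (auto simp: middle_def upper_def Suc_le_eq)
  have "finite (middle a j)" unfolding eq[symmetric] using fin by simp
  moreover have "insert (a, Pole1) (insert (a, Pole2) (insert (a, Elem \<sigma>) (insert (a, Apex) ?P))) = middle a j \<union> ?T"
    unfolding eq[symmetric] by simp
  moreover have "Suc (Suc (2 * (j - Suc a) + 1)) = 2 * (j - a) + 1" using step.hyps by simp
  ultimately show ?case using 2 by simp
qed

text \<open>The poles at level 0 contribute \<open>k\<close> suspensions, the levels from 1 to
  \<open>j - 1\<close> two each, and level \<open>j\<close> one. This is one fewer than in the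
  summand with index \<open>j\<close>; the missing one arises when the cone over this link is
  attached.\<close>

lemma full_link:
  assumes j: "0 < j" "j < L" and k: "k \<le> 1"
  shows "Space (clique_space (\<bowtie>) (bottom k \<union> (middle 1 j \<union> (poles j \<union> levels (Suc j) (Suc j)))))
     \<simeq>\<^sub>e iter_suspension (2 * j + k - 1) (summand (Suc j))"
proof -
  let ?P = "middle 1 j \<union> (poles j \<union> levels (Suc j) (Suc j))"
  have m: "finite (middle 1 j)" "Space (clique_space (\<bowtie>) ?P) \<simeq>\<^sub>e iter_suspension (2 * (j - 1) + 1) (summand (Suc j))"
    using middle_link[OF j, of 1] j by auto
  show ?thesis
  proof (cases "k = 0")
    case True
    have "2 * (j - 1) + 1 = 2 * j + k - 1" using j True by simp
    then show ?thesis using m(2) True by (simp add: bottom_def)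
  next
    case False
    have pos: "0 < fst v" if "v \<in> ?P" for v
      using that j by (auto simp: middle_def poles_def levels_def split: if_splits)
    have "Space (clique_space (\<bowtie>) (insert (0, Pole1) (insert (0, Pole2) ?P)))
        \<simeq>\<^sub>e iter_suspension (Suc (2 * (j - 1) + 1)) (summand (Suc j))"
    proof (rule join_pair_ext[OF _ _ _ _ _ _ m(2)])
      show "(0, Pole1) \<notin> ?P" "(0, Pole2) \<notin> ?P" using pos by fastforce+
      show "v \<bowtie> (0, Pole1)" "v \<bowtie> (0, Pole2)" if "v \<in> ?P" for v
        using pos[OF that] by (simp_all add: tower_adj_def upper_def)
    qed (use m(1) in \<open>auto simp: tower_adj_def\<close>)
    moreover have "Suc (2 * (j - 1) + 1) = 2 * j + k - 1" using j k False by simp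
    ultimately show ?thesis using False by (simp add: bottom_def)
  qed
qed

lemma equivalence_topspace: "homotopy_equivalence X Y f \<Longrightarrow> x \<in> topspace X \<Longrightarrow> f x \<in> topspace Y"
  using continuous_map_image_subset_topspace[OF homotopy_equivalence_continuous] by fastforce

text \<open>Each attaching map contracts to the vertex \<sigma> of the current level, and a path
  from there to the base point of the wedge is still needed. The second conjunct keeps such a path
  available. It is restricted to \<open>1 < L\<close>, since for a single summand \<open>p\<close>
  is arbitrary and \<sigma> need not occur.\<close>

theorem tower_wedge:
  fixes X :: "nat \<Rightarrow> ('q \<Rightarrow> real) susp_point topology"
  assumes k: "k \<le> 1" and L: "0 < L" and pres0: "pres 0"
    and X: "\<And>l. l < L \<Longrightarrow> Space (X l) = iter_suspension (2 * l + k) (summand (Suc l))"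
    and p: "\<And>l. 1 < L \<Longrightarrow> l < L \<Longrightarrow>
      (if 2 * l + k = 0 then p l = Base (indicator {\<sigma>}) else p l = South \<or> p l = North)"
    and n: "n < L"
  shows "\<exists>\<phi>. homotopy_equivalence (clique_space (\<bowtie>) (bottom k \<union> levels 1 (Suc n))) (wedge n X p) \<phi> \<and>
     (1 < L \<longrightarrow> path_component_of (wedge n X p) (\<phi> (indicator {(1, Elem \<sigma>)})) (0, p 0))"
  using n
proof (induction n)
  case 0
  let ?Q = "level_space 1"
  have s1: "summand 1 = Space ?Q" using pres0 by (simp add: summand_def)
  have e_in: "indicator {\<sigma>} \<in> clique_points R (Q 1)" if "1 < L"
    using sigma[of 1] refl[of \<sigma> 1] that fin by (intro indicator_in_clique_points) auto
  have v_in: "indicator {(1, Elem \<sigma>)} \<in> clique_points (\<bowtie>) (bottom k \<union> levels 1 1)" if "1 < L"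
  proof (rule indicator_in_clique_points)
    show "(1, Elem \<sigma>) \<in> bottom k \<union> levels 1 1" using sigma[of 1] that by (simp add: levels_def)
  qed simp_all
  show ?case
  proof (cases "k = 0")
    case True
    let ?e = "\<lambda>v :: nat \<times> 'q tower_vertex. case snd v of Elem x \<Rightarrow> x | _ \<Rightarrow> \<sigma>"
    let ?\<phi> = "Pair 0 \<circ> (Base \<circ> push_forward (levels 1 1) ?e)"
    have "X 0 = base_space ?Q" using X[OF L] True s1 by (simp add: iter_suspension_def)
    then have \<phi>: "homotopy_equivalence (clique_space (\<bowtie>) (bottom k \<union> levels 1 (Suc 0))) (wedge 0 X p) ?\<phi>"
      using homotopy_equivalence_compose[OF homotopy_equivalence_compose[OF level_isomorphism[of 1] homotopy_equivalence_base_space]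
          homotopy_equivalence_wedge_0[of X p, unfolded \<open>X 0 = base_space ?Q\<close>]] True
      by (simp add: bottom_def)
    have "path_component_of (wedge 0 X p) (?\<phi> (indicator {(1, Elem \<sigma>)})) (0, p 0)" if "1 < L"
    proof -
      have "?\<phi> (indicator {(1, Elem \<sigma>)}) = (0, p 0)"
        using push_forward_indicator[OF finite_levels, of "(1, Elem \<sigma>)" 1 1 ?e] sigma[of 1] p[of 0] that True
        by (simp add: levels_def)
      moreover have "?\<phi> (indicator {(1, Elem \<sigma>)}) \<in> topspace (wedge 0 X p)"
        using equivalence_topspace[OF \<phi>] v_in[OF that] by simp
      ultimately show ?thesis by (simp add: path_component_of_refl)
    qed
    with \<phi> show ?thesis by blast
  next
    case False
    then have k1: "k = 1" using k by simp
    have X0: "X 0 = suspension (base_space ?Q)" using X[OF L] k1 s1 by (simp add: iter_suspension_def)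
    have "bottom k \<union> levels 1 1 = insert (0, Pole1) (insert (0, Pole2) (levels 1 1))"
      using k1 by (simp add: bottom_def)
    moreover have "clique_space (\<bowtie>) (insert (0, Pole1) (insert (0, Pole2) (levels 1 1)))
        homotopy_equivalent_space suspension (base_space ?Q)"
      by (rule join_pair[OF finite_levels _ _ _ _ _ level_base]) (auto simp: levels_def tower_adj_def upper_def)
    ultimately obtain \<psi> where \<psi>: "homotopy_equivalence (clique_space (\<bowtie>) (bottom k \<union> levels 1 1)) (X 0) \<psi>"
      unfolding X0 homotopy_equivalent_space_iff_equivalence by auto
    \<comment> \<open>Nothing is known about the point to which \<open>\<psi>\<close> sends the
      vertex, and \<open>p 0\<close> may be either end. Connectedness of the suspension settles
      both.\<close>
    have "path_component_of (wedge 0 X p) ((Pair 0 \<circ> \<psi>) (indicator {(1, Elem \<sigma>)})) (0, p 0)" if "1 < L"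
    proof -
      have "Base (indicator {\<sigma>}) \<in> topspace (base_space ?Q)"
        using equivalence_topspace[OF homotopy_equivalence_base_space, of "indicator {\<sigma>}" ?Q] e_in[OF that] by simp
      moreover have "\<psi> (indicator {(1, Elem \<sigma>)}) \<in> topspace (X 0)"
        using equivalence_topspace[OF \<psi>] v_in[OF that] by simp
      moreover have "p 0 = South \<or> p 0 = North" using p[OF that L] k1 by simp
      ultimately have "path_component_of (X 0) (\<psi> (indicator {(1, Elem \<sigma>)})) (p 0)"
        unfolding X0 by (rule path_component_of_suspension)
      from path_component_of_continuous_image[OF homotopy_equivalence_continuous[OF homotopy_equivalence_wedge_0[of X p]] this]
      show ?thesis by simp
    qed
    then show ?thesis
      using homotopy_equivalence_compose[OF \<psi> homotopy_equivalence_wedge_0[of X p]] by auto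
  qed
next
  case (Suc n)
  define j where "j = Suc n"
  have j: "0 < j" "j < L" and L1: "1 < L" using Suc.prems by (auto simp: j_def)
  obtain \<phi> where \<phi>: "homotopy_equivalence (clique_space (\<bowtie>) (bottom k \<union> levels 1 j)) (wedge n X p) \<phi>"
    and base: "path_component_of (wedge n X p) (\<phi> (indicator {(1, Elem \<sigma>)})) (0, p 0)"
    using Suc L1 unfolding j_def by auto
  let ?T = "bottom k \<union> levels 1 j" and ?N = "poles j \<union> levels (Suc j) (Suc j)"
  let ?W = "bottom k \<union> levels 1 (Suc j)"
  let ?L = "bottom k \<union> (middle 1 j \<union> ?N)"
  let ?s = "(j, Elem \<sigma>)"
  define P where "P = ?W - {(j, Apex)}"
  \<comment> \<open>The poles of level \<open>j\<close> and the whole level \<open>Suc j\<close> are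
    folded onto \<open>(j, Elem \<sigma>)\<close>, to which all of them are adjacent.\<close>
  define r where "r = (\<lambda>v. if v \<in> ?T then v else ?s)"
  have sj: "\<sigma> \<in> Q j" using sigma j by simp
  have finP: "finite P" by (simp add: P_def)
  have finT: "finite ?T" by simp
  have eq: "?W = insert (j, Apex) P" using j by (auto simp: P_def levels_def)
  have TP: "?T \<subseteq> P" using j by (auto simp: P_def levels_def bottom_def split: if_splits)
  have sT: "?s \<in> ?T" using sj j by (auto simp: levels_def)
  have PTN: "v \<in> ?T \<or> v \<in> ?N" if "v \<in> P" for v
  proof -
    obtain i u where v: "v = (i, u)" by (cases v)
    show ?thesis
      using that unfolding v by (cases u; cases "i = j"; cases "i = Suc j") (simp_all add: P_def levels_def poles_def; linarith)+
  qed
  have Ts: "v \<bowtie> ?s" if "v \<in> ?T" "w \<in> ?N" "v \<bowtie> w" for v w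
  proof -
    have "fst v < j \<and> upper \<sigma> (snd v) \<or> v = ?s"
      using that j by (cases v; cases w) (auto simp: levels_def poles_def bottom_def tower_adj_def upper_def split: if_splits)
    then show ?thesis by (auto simp: tower_adj_def)
  qed
  have Ns: "w \<bowtie> ?s" if "w \<in> ?N" for w
    using that by (cases w) (auto simp: levels_def poles_def tower_adj_def upper_def split: if_splits)
  have r_T: "r v = v" if "v \<in> ?T" for v using that by (simp add: r_def)
  have r_cases: "v \<in> ?T \<and> r v = v \<or> v \<in> ?N \<and> r v = ?s" if "v \<in> P" for v
    using PTN[OF that] by (auto simp: r_def)
  have rr: "r v \<bowtie> r w" and vr: "v \<bowtie> r w" if v: "v \<in> P" and w: "w \<in> P" and vw: "v \<bowtie> w" for v w
  proof -
    have wv: "w \<bowtie> v" using vw tower_adj_sym by metis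
    show "r v \<bowtie> r w"
      using r_cases[OF v] r_cases[OF w] vw Ts[of v w] Ts[of w v] wv tower_adj_sym[of R \<sigma> ?s w] by auto
    show "v \<bowtie> r w"
      using r_cases[OF v] r_cases[OF w] vw Ts[of v w] Ns[of v] by auto
  qed
  have rT: "r ` P \<subseteq> ?T" using sT by (auto simp: r_def)
  have retract: "homotopy_equivalence (clique_space (\<bowtie>) P) (clique_space (\<bowtie>) ?T) (push_forward P r)"
  proof (rule push_forward_equivalence[OF finP finT rT, where g = id])
    show "id ` ?T \<subseteq> P" using TP by simp
    show "comparable (\<bowtie>) (r v) (r w)" if "v \<in> P" "w \<in> P" "v \<bowtie> w" for v w
      using rr[OF that] by blast
    have "homotopic (clique_space (\<bowtie>) P) (clique_space (\<bowtie>) P) (push_forward P r) (push_forward P id)"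
    proof (rule homotopic_push_forward_contiguous[OF finP finP])
      show "r ` P \<subseteq> P" using rT TP by blast
      show "comparable (\<bowtie>) (r v) (r w)" if "v \<in> P" "w \<in> P" "v \<bowtie> w" for v w
        using rr[OF that] by blast
      show "comparable (\<bowtie>) (r v) (id w)" if "v \<in> P" "w \<in> P" "comparable (\<bowtie>) v w" for v w
        using vr[OF that(2,1)] that(3) tower_adj_sym[of R \<sigma> v w] by auto
    qed auto
    then show "homotopic (clique_space (\<bowtie>) P) (clique_space (\<bowtie>) P) (push_forward P (id \<circ> r)) (push_forward P id)"
      by simp
    show "r (id v) = v" if "v \<in> ?T" for v using r_T[OF that] by simp
  qed auto
  have link: "{v \<in> P. comparable (\<bowtie>) v (j, Apex)} = ?L"
  proof (rule Set.set_eqI)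
    fix v :: "nat \<times> 'q tower_vertex"
    obtain i u where v: "v = (i, u)" by (cases v)
    have "v \<in> {v \<in> P. comparable (\<bowtie>) v (j, Apex)} \<longleftrightarrow> v \<in> P \<and> v \<bowtie> (j, Apex)"
      by (simp only: comparable_tower_adj mem_Collect_eq)
    also have "\<dots> \<longleftrightarrow> v \<in> ?L"
    proof (cases "i < j")
      case True
      then have "(i, u) \<in> P \<and> upper \<sigma> u \<longleftrightarrow> (i, u) \<in> bottom k \<or> (0 < i \<and> upper \<sigma> u)"
        using j sigma[of i] pres[of i] by (auto simp: P_def levels_def bottom_def upper_def split: if_splits)
      then show ?thesis using True unfolding v by (auto simp: tower_adj_def middle_def poles_def levels_def)
    next
      case False
      then show ?thesis
        unfolding v using j by (cases u; cases "i = j"; cases "i = Suc j")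
          (auto simp: P_def levels_def poles_def bottom_def middle_def tower_adj_def upper_def)
    qed
    finally show "v \<in> {v \<in> P. comparable (\<bowtie>) v (j, Apex)} \<longleftrightarrow> v \<in> ?L" .
  qed
  have LP: "?L \<subseteq> P" using link by blast
  have finL: "finite ?L" using finite_subset[OF LP finP] .
  have cone: "cone_attached (clique_space (\<bowtie>) ?L) (clique_space (\<bowtie>) P) id (clique_space (\<bowtie>) ?W) id
      (cone_point (j, Apex)) (indicator {(j, Apex)})"
    using cone_attached_clique_space[where R = "(\<bowtie>)" and m = "(j, Apex)" and P = P] finP
    unfolding eq link by (simp add: P_def)
  \<comment> \<open>The link contains no element of level \<open>j\<close>, and below that level
    only vertices of kind \<open>upper\<close>. After folding, each vertex is therefore equal or
    adjacent to \<open>?s\<close>, and the link contracts to it inside \<open>?T\<close>.\<close>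
  have rs: "r v \<bowtie> ?s" if "v \<in> ?L" for v
  proof -
    have "v \<in> ?T \<Longrightarrow> v \<bowtie> ?s"
      using that j by (cases v) (auto simp: levels_def poles_def bottom_def middle_def tower_adj_def upper_def split: if_splits)
    then show ?thesis using r_cases[OF subsetD[OF LP that]] tower_adj_refl by metis
  qed
  have "homotopic (clique_space (\<bowtie>) ?L) (clique_space (\<bowtie>) ?T) (push_forward ?L r) (push_forward ?L (\<lambda>_. ?s))"
  proof (rule homotopic_push_forward_contiguous[OF finL finT])
    show "r ` ?L \<subseteq> ?T" using rT LP by blast
    show "comparable (\<bowtie>) (r v) (r w)" if "v \<in> ?L" "w \<in> ?L" "v \<bowtie> w" for v w
      using rr[of v w] LP that by blast
    show "comparable (\<bowtie>) (r v) ?s" if "v \<in> ?L" for v using rs[OF that] by blast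
  qed (use sT in auto)
  then have "homotopic (clique_space (\<bowtie>) ?L) (clique_space (\<bowtie>) ?T) (push_forward P r) (\<lambda>_. indicator {?s})"
    by (rule homotopic_with_eq)
      (simp_all add: push_forward_restrict[OF finP LP] push_forward_const[OF finL] del: One_nat_def)
  then have "homotopic (clique_space (\<bowtie>) ?L) (wedge n X p) (\<phi> \<circ> push_forward P r) (\<phi> \<circ> (\<lambda>_. indicator {?s}))"
    by (rule homotopic_with_compose_continuous_map_left[OF _ homotopy_equivalence_continuous[OF \<phi>]]) simp
  \<comment> \<open>At most one edge leads from \<open>(j, Elem \<sigma>)\<close> to
    \<open>(1, Elem \<sigma>)\<close>; the induction hypothesis supplies the rest of the
    path.\<close>
  moreover have "path_component_of (wedge n X p) (\<phi> (indicator {?s})) (0, p 0)"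
  proof -
    have "(1, Elem \<sigma>) \<in> ?T" using sigma[of 1] L1 j by (auto simp: levels_def)
    moreover have "?s \<bowtie> (1, Elem \<sigma>)" using j by (auto simp: tower_adj_def upper_def)
    ultimately have "path_component_of (clique_space (\<bowtie>) ?T) (indicator {?s}) (indicator {(1, Elem \<sigma>)})"
      using sT by (intro path_component_of_clique_points[OF finT]) auto
    from path_component_of_trans[OF path_component_of_continuous_image[OF homotopy_equivalence_continuous[OF \<phi>] this] base]
    show ?thesis .
  qed
  then have "homotopic (clique_space (\<bowtie>) ?L) (wedge n X p) (\<phi> \<circ> (\<lambda>_. indicator {?s})) (\<lambda>_. (0, p 0))"
    unfolding o_def homotopic_constant_maps by blast
  ultimately have null: "homotopic (clique_space (\<bowtie>) ?L) (wedge n X p) ((\<phi> \<circ> push_forward P r) \<circ> id) (\<lambda>_. (0, p 0))"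
    unfolding comp_id by (rule homotopic_with_trans)
  have link_type: "Space (clique_space (\<bowtie>) ?L) \<simeq>\<^sub>e iter_suspension (2 * j + k - 1) (summand (Suc j))"
    by (rule full_link[OF j k])
  then obtain Z where Z: "iter_suspension (2 * j + k - 1) (summand (Suc j)) = Space Z"
    by (cases "iter_suspension (2 * j + k - 1) (summand (Suc j))") auto
  have "Space (X j) = ext_suspension (iter_suspension (2 * j + k - 1) (summand (Suc j)))"
  proof -
    have "2 * j + k = Suc (2 * j + k - 1)" using j by simp
    then show ?thesis using X[OF j(2)] by (metis comp_apply funpow.simps(2) iter_suspension_def)
  qed
  then have "X j = suspension Z" unfolding Z by simp
  then have Xj: "X (Suc n) = suspension Z" unfolding j_def .
  have pj: "p (Suc n) = South \<or> p (Suc n) = North"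
    using p[OF L1, of "Suc n"] Suc.prems by simp
  obtain q a where S: "cone_attached Z (discrete_topology {p (Suc n)}) (\<lambda>_. p (Suc n)) (X (Suc n)) id q a"
    unfolding Xj by (rule cone_attached_suspension[OF pj])
  have p0: "p 0 \<in> topspace (X 0)"
  proof (cases "k = 0")
    case True
    have "indicator {\<sigma>} \<in> clique_points R (Q 1)"
      using sigma[of 1] refl[of \<sigma> 1] L1 fin by (intro indicator_in_clique_points) auto
    then have "Base (indicator {\<sigma>}) \<in> topspace (base_space (level_space 1))"
      using equivalence_topspace[OF homotopy_equivalence_base_space, of "indicator {\<sigma>}" "level_space 1"] by simp
    moreover have "X 0 = base_space (level_space 1)"
      using X[OF L] True pres0 by (simp add: iter_suspension_def summand_def)
    ultimately show ?thesis using p[OF L1 L] True by simp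
  next
    case False
    then have "k = 1" using k by simp
    then have "X 0 = suspension (base_space (level_space 1))"
      using X[OF L] pres0 by (simp add: iter_suspension_def summand_def)
    then show ?thesis using p[OF L1 L] False by (auto simp: topspace_suspension)
  qed
  have LZ: "clique_space (\<bowtie>) ?L homotopy_equivalent_space Z" using link_type Z by simp
  have base_in: "(0, p 0) \<in> topspace (wedge n X p)" using path_component_in_topspace[OF base] by blast
  obtain \<Phi> where \<Phi>: "homotopy_equivalence (clique_space (\<bowtie>) ?W) (wedge (Suc n) X p) \<Phi>"
    "\<And>y. y \<in> topspace (clique_space (\<bowtie>) P) \<Longrightarrow> \<Phi> (id y) = id ((\<phi> \<circ> push_forward P r) y)"
    using cone_attached_equivalence[OF cone cone_attached_wedge[OF p0 S] base_in
        homotopy_equivalence_compose[OF retract \<phi>] null LZ] by blast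
  \<comment> \<open>The invariant for the next step: folding fixes the reference vertex, so there
    \<open>\<Phi>\<close> agrees with \<open>\<phi>\<close>.\<close>
  have "(1, Elem \<sigma>) \<in> ?T" using sigma[of 1] L1 j by (auto simp: levels_def)
  then have e: "(1, Elem \<sigma>) \<in> P" "r (1, Elem \<sigma>) = (1, Elem \<sigma>)" using TP r_T by blast+
  have "indicator {(1, Elem \<sigma>)} \<in> clique_points (\<bowtie>) P"
    using finP e(1) by (intro indicator_in_clique_points) auto
  then have "\<Phi> (indicator {(1, Elem \<sigma>)}) = \<phi> (indicator {(1, Elem \<sigma>)})"
    using \<Phi>(2)[of "indicator {(1, Elem \<sigma>)}"] push_forward_indicator[OF finP e(1), of r] e(2) by simp
  then have "path_component_of (wedge (Suc n) X p) (\<Phi> (indicator {(1, Elem \<sigma>)})) (0, p 0)"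
    using path_component_of_continuous_image[OF cone_attachedD(2)[OF cone_attached_wedge[OF p0 S]] base] by simp
  with \<Phi>(1) show ?case unfolding j_def by blast
qed

end

section \<open>Frobenius complexes as clique spaces\<close>

context affine_monoid_elem
begin

abbreviation dvd_rel :: "'a \<Rightarrow> 'a \<Rightarrow> bool" where "dvd_rel \<equiv> \<lambda>a b. a divides b"

text \<open>Every full multiple of \<open>r\<close> in the second coordinate is carried into the
  first as a copy of \<rho>. The generating relation preserves the result and links each pair to its
  own normal form, so normal forms decide equality of classes.\<close>

definition normal_form :: "nat \<Rightarrow> 'a \<times> nat \<Rightarrow> 'a \<times> nat" where
  "normal_form r p = (fst p \<otimes> \<rho> [^] (snd p div r), snd p mod r)"

lemma normal_form_frac_gen:
  assumes "frac_gen G \<rho> r p q" "0 < r"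
  shows "normal_form r p = normal_form r q"
proof -
  obtain x k where x: "x \<in> carrier G" "p = (x \<otimes> \<rho>, k)" "q = (x, r + k)"
    using assms(1) by (auto simp: frac_gen_def)
  have "\<rho> [^] Suc (k div r) = \<rho> \<otimes> \<rho> [^] (k div r)"
    using rho by (simp add: m_comm)
  then show ?thesis using x assms(2) rho by (simp add: normal_form_def m_assoc)
qed

lemma normal_form_equivclp:
  assumes "equivclp (frac_gen G \<rho> r) p q" "0 < r"
  shows "normal_form r p = normal_form r q"
  using assms(1)
proof (induction rule: equivclp_induct)
  case (step y z)
  then show ?case using normal_form_frac_gen[OF _ assms(2)] by metis
qed simp

lemma equivclp_normal_form:
  assumes x: "x \<in> carrier G" and r: "0 < r"
  shows "equivclp (frac_gen G \<rho> r) (x, k) (normal_form r (x, k))"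
proof -
  have "equivclp (frac_gen G \<rho> r) (x, d * r + i) (x \<otimes> \<rho> [^] d, i)" for d i :: nat
    using x
  proof (induction d arbitrary: x)
    case 0
    then show ?case by simp
  next
    case (Suc d)
    have "frac_gen G \<rho> r (x \<otimes> \<rho>, d * r + i) (x, Suc d * r + i)"
      using Suc.prems by (auto simp: frac_gen_def intro!: bexI[of _ x])
    then have "equivclp (frac_gen G \<rho> r) (x, Suc d * r + i) (x \<otimes> \<rho>, d * r + i)"
      by (blast intro: r_into_equivclp equivclp_sym)
    moreover have "equivclp (frac_gen G \<rho> r) (x \<otimes> \<rho>, d * r + i) ((x \<otimes> \<rho>) \<otimes> \<rho> [^] d, i)"
      using Suc.IH[of "x \<otimes> \<rho>"] Suc.prems rho by simp
    moreover have "(x \<otimes> \<rho>) \<otimes> \<rho> [^] d = x \<otimes> \<rho> [^] Suc d"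
      using Suc.prems rho by (simp add: m_ac)
    ultimately show ?case by (metis equivclp_trans)
  qed
  from this[of "k div r" "k mod r"] show ?thesis
    by (simp add: normal_form_def)
qed

lemma frac_elem_eq_iff:
  assumes "x \<in> carrier G" "y \<in> carrier G" "0 < r"
  shows "frac_elem G \<rho> r x i = frac_elem G \<rho> r y j \<longleftrightarrow> normal_form r (x, i) = normal_form r (y, j)"
proof -
  have "frac_elem G \<rho> r x i = frac_elem G \<rho> r y j \<longleftrightarrow> ((x, i), (y, j)) \<in> frac_rel G \<rho> r"
    unfolding frac_elem_def using assms by (intro eq_equiv_class_iff[OF equiv_frac_rel]) auto
  also have "\<dots> \<longleftrightarrow> equivclp (frac_gen G \<rho> r) (x, i) (y, j)"
    using assms by (simp add: frac_rel_def)
  also have "\<dots> \<longleftrightarrow> normal_form r (x, i) = normal_form r (y, j)"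
    using normal_form_equivclp[OF _ assms(3)] equivclp_normal_form[OF assms(1,3)] equivclp_normal_form[OF assms(2,3)]
    by (metis equivclp_sym equivclp_trans)
  finally show ?thesis .
qed

lemma frac_elem_inj:
  assumes "x \<in> carrier G" "y \<in> carrier G" "i < r" "j < r"
  shows "frac_elem G \<rho> r x i = frac_elem G \<rho> r y j \<longleftrightarrow> x = y \<and> i = j"
  using frac_elem_eq_iff[of x y r i j] assms by (simp add: normal_form_def)

lemma frac_elem_normal_form:
  assumes "x \<in> carrier G" "0 < r"
  shows "frac_elem G \<rho> r x i = frac_elem G \<rho> r (x \<otimes> \<rho> [^] (i div r)) (i mod r)"
  using assms rho by (subst frac_elem_eq_iff) (auto simp: normal_form_def)

lemma carrier_adjoin_frac:
  assumes "0 < r"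
  shows "carrier (adjoin_frac G \<rho> r) = {frac_elem G \<rho> r x i | x i. x \<in> carrier G \<and> i < r}"
proof (intro equalityI subsetI)
  fix A assume "A \<in> carrier (adjoin_frac G \<rho> r)"
  then obtain x i where "x \<in> carrier G" "A = frac_elem G \<rho> r x i"
    by (auto simp: adjoin_frac_def frac_elem_def elim!: quotientE)
  then have "A = frac_elem G \<rho> r (x \<otimes> \<rho> [^] (i div r)) (i mod r)" "x \<otimes> \<rho> [^] (i div r) \<in> carrier G" "i mod r < r"
    using frac_elem_normal_form[of x r i] assms rho by auto
  then show "A \<in> {frac_elem G \<rho> r x i | x i. x \<in> carrier G \<and> i < r}" by blast
next
  fix A assume "A \<in> {frac_elem G \<rho> r x i | x i. x \<in> carrier G \<and> i < r}"
  then show "A \<in> carrier (adjoin_frac G \<rho> r)"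
    by (auto simp: adjoin_frac_def frac_elem_def intro!: quotientI)
qed

lemma one_adjoin_frac: "\<one>\<^bsub>adjoin_frac G \<rho> r\<^esub> = frac_elem G \<rho> r \<one> 0"
  by (simp add: adjoin_frac_def frac_elem_def)

text \<open>A cofactor can be taken in normal form, so adding it causes at most one carry. None
  occurs if \<open>i \<le> j\<close>; if \<open>j < i\<close>, the fractional part can decrease only
  through a carry, which costs one \<rho>.\<close>

lemma divides_adjoin_frac:
  assumes x: "x \<in> carrier G" and y: "y \<in> carrier G" and ij: "i < r" "j < r"
  shows "frac_elem G \<rho> r x i divides\<^bsub>adjoin_frac G \<rho> r\<^esub> frac_elem G \<rho> r y j \<longleftrightarrow> (x, i) \<preceq> (y, j)"
proof -
  have r: "0 < r" using ij by simp
  have "frac_elem G \<rho> r x i divides\<^bsub>adjoin_frac G \<rho> r\<^esub> frac_elem G \<rho> r y j \<longleftrightarrow>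
      (\<exists>z\<in>carrier G. \<exists>l<r. normal_form r (y, j) = normal_form r (x \<otimes> z, i + l))"
  proof -
    have "frac_elem G \<rho> r y j = frac_elem G \<rho> r x i \<otimes>\<^bsub>adjoin_frac G \<rho> r\<^esub> frac_elem G \<rho> r z l \<longleftrightarrow>
        normal_form r (y, j) = normal_form r (x \<otimes> z, i + l)" if "z \<in> carrier G" for z l
      using that x y r rho by (simp add: mult_adjoin_frac frac_elem_eq_iff)
    then show ?thesis unfolding factor_def carrier_adjoin_frac[OF r] by blast
  qed
  also have "\<dots> \<longleftrightarrow> (\<exists>z\<in>carrier G. (i \<le> j \<and> y = x \<otimes> z) \<or> (j < i \<and> y = x \<otimes> z \<otimes> \<rho>))"
  proof (rule bex_cong[OF refl])
    fix z assume z: "z \<in> carrier G"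
    have nf: "normal_form r (y, j) = (y, j)" using y ij by (simp add: normal_form_def)
    have small: "normal_form r (x \<otimes> z, i + l) = (x \<otimes> z, i + l)" if "i + l < r" for l
      using that x z by (simp add: normal_form_def)
    \<comment> \<open>Both \<open>i\<close> and \<open>l\<close> are below \<open>r\<close>, so
      their sum is below \<open>2 * r\<close> and exactly one \<rho> is carried.\<close>
    have large: "normal_form r (x \<otimes> z, i + l) = (x \<otimes> z \<otimes> \<rho>, i + l - r)" if "r \<le> i + l" "l < r" for l
    proof -
      have "i + l = (i + l - r) + 1 * r" "i + l - r < r" using that ij by auto
      then have "(i + l) div r = 1" "(i + l) mod r = i + l - r"
        by (metis add.commute div_mult_self3 div_less add_cancel_left_left less_nat_zero_code neq0_conv r plus_1_eq_Suc One_nat_def)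
           (metis \<open>i + l = (i + l - r) + 1 * r\<close> \<open>i + l - r < r\<close> mod_less mod_mult_self1)
      then show ?thesis using x z rho by (simp add: normal_form_def)
    qed
    show "(\<exists>l<r. normal_form r (y, j) = normal_form r (x \<otimes> z, i + l)) \<longleftrightarrow>
        (i \<le> j \<and> y = x \<otimes> z) \<or> (j < i \<and> y = x \<otimes> z \<otimes> \<rho>)"
    proof
      assume "\<exists>l<r. normal_form r (y, j) = normal_form r (x \<otimes> z, i + l)"
      then obtain l where l: "l < r" "(y, j) = normal_form r (x \<otimes> z, i + l)" unfolding nf by blast
      then show "(i \<le> j \<and> y = x \<otimes> z) \<or> (j < i \<and> y = x \<otimes> z \<otimes> \<rho>)"
        using small[of l] large[of l] by (cases "i + l < r") auto
    next
      assume "(i \<le> j \<and> y = x \<otimes> z) \<or> (j < i \<and> y = x \<otimes> z \<otimes> \<rho>)"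
      then show "\<exists>l<r. normal_form r (y, j) = normal_form r (x \<otimes> z, i + l)"
      proof
        assume "i \<le> j \<and> y = x \<otimes> z"
        then show ?thesis unfolding nf using small[of "j - i"] ij by (intro exI[of _ "j - i"]) auto
      next
        assume "j < i \<and> y = x \<otimes> z \<otimes> \<rho>"
        then show ?thesis unfolding nf using large[of "j + r - i"] ij by (intro exI[of _ "j + r - i"]) auto
      qed
    qed
  qed
  also have "\<dots> \<longleftrightarrow> (x, i) \<preceq> (y, j)"
  proof -
    have "x \<otimes> z \<otimes> \<rho> = x \<otimes> \<rho> \<otimes> z" if "z \<in> carrier G" for z using that x rho by (simp add: m_ac)
    then show ?thesis by (auto simp: frac_le_def factor_def not_le)
  qed
  finally show ?thesis .
qed

lemma frobenius_complex_adjoin_frac: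
  assumes x: "x \<in> carrier G" and k: "k < r"
  shows "x = \<one> \<Longrightarrow> k = 0 \<Longrightarrow> frobenius_complex (adjoin_frac G \<rho> r) (frac_elem G \<rho> r x k) = SphereMinus2"
    and "x \<noteq> \<one> \<or> k \<noteq> 0 \<Longrightarrow> \<exists>T. frobenius_complex (adjoin_frac G \<rho> r) (frac_elem G \<rho> r x k) = Space T \<and>
           T homotopy_equivalent_space clique_space (\<preceq>) (frac_interval G \<rho> r x k)"
proof -
  let ?A = "adjoin_frac G \<rho> r"
  show "frobenius_complex ?A (frac_elem G \<rho> r x k) = SphereMinus2" if "x = \<one>" "k = 0"
    using that by (simp add: frobenius_complex_def one_adjoin_frac)
  assume xk: "x \<noteq> \<one> \<or> k \<noteq> 0"
  have r: "0 < r" using k by simp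
  let ?I = "frac_interval G \<rho> r x k"
  let ?P = "{y \<in> carrier ?A. less_mon ?A \<one>\<^bsub>?A\<^esub> y \<and> less_mon ?A y (frac_elem G \<rho> r x k)}"
  let ?f = "\<lambda>v. frac_elem G \<rho> r (fst v) (snd v)"
  let ?D = "\<lambda>a b. a divides\<^bsub>?A\<^esub> b"
  have less1: "less_mon ?A \<one>\<^bsub>?A\<^esub> (frac_elem G \<rho> r y i) \<longleftrightarrow> (y, i) \<noteq> (\<one>, 0)"
    if "y \<in> carrier G" "i < r" for y i
    using that r by (auto simp: less_mon_def one_adjoin_frac divides_adjoin_frac frac_elem_inj frac_le_def one_dvd)
  have less2: "less_mon ?A (frac_elem G \<rho> r y i) (frac_elem G \<rho> r x k) \<longleftrightarrow> (y, i) \<preceq> (x, k) \<and> (y, i) \<noteq> (x, k)"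
    if "y \<in> carrier G" "i < r" for y i
    using that x k by (auto simp: less_mon_def divides_adjoin_frac frac_elem_inj)
  have P: "?P = ?f ` ?I"
  proof (intro equalityI subsetI)
    fix A assume A: "A \<in> ?P"
    then obtain y i where yi: "y \<in> carrier G" "i < r" "A = frac_elem G \<rho> r y i"
      by (auto simp: carrier_adjoin_frac[OF r])
    then have "(y, i) \<in> ?I" using A less1[OF yi(1,2)] less2[OF yi(1,2)] by (simp add: frac_interval_def)
    then show "A \<in> ?f ` ?I" using yi(3) by force
  next
    fix A assume "A \<in> ?f ` ?I"
    then obtain y i where yi: "(y, i) \<in> ?I" "A = frac_elem G \<rho> r y i" by force
    then show "A \<in> ?P"
      using frac_intervalD[OF yi(1)] less1[of y i] less2[of y i] by (auto simp: carrier_adjoin_frac[OF r])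
  qed
  have finI: "finite ?I" by (rule finite_frac_interval[OF x])
  have finP: "finite ?P" unfolding P using finI by simp
  have inj: "inj_on ?f ?I"
  proof (rule inj_onI)
    fix v w assume v: "v \<in> ?I" and w: "w \<in> ?I" and eq: "?f v = ?f w"
    have "fst v = fst w \<and> snd v = snd w"
      using eq by (subst (asm) frac_elem_inj) (use frac_intervalD(1,2)[OF v] frac_intervalD(1,2)[OF w] in auto)
    then show "v = w" by (simp add: prod_eq_iff)
  qed
  have div: "?f v divides\<^bsub>?A\<^esub> ?f w \<longleftrightarrow> v \<preceq> w" if "v \<in> ?I" "w \<in> ?I" for v w
    using divides_adjoin_frac[of "fst v" "fst w" "snd v" r "snd w"] frac_intervalD(1,2)[OF that(1)] frac_intervalD(1,2)[OF that(2)]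
    by simp
  have "homotopy_equivalence (clique_space (\<preceq>) ?I) (clique_space ?D ?P) (push_forward ?I ?f)"
  proof (rule push_forward_isomorphism[OF finI finP, where g = "inv_into ?I ?f"])
    show "comparable ?D (?f v) (?f w)" if "v \<in> ?I" "w \<in> ?I" "v \<preceq> w" for v w
      using that div by blast
    show "comparable (\<preceq>) (inv_into ?I ?f a) (inv_into ?I ?f b)" if ab: "a \<in> ?P" "b \<in> ?P" "a divides\<^bsub>?A\<^esub> b" for a b
    proof -
      obtain v w where v: "v \<in> ?I" "a = ?f v" and w: "w \<in> ?I" "b = ?f w" using ab(1,2) unfolding P by blast
      then have "v \<preceq> w" using ab(3) div by blast
      then show ?thesis unfolding v(2) w(2) inv_into_f_f[OF inj v(1)] inv_into_f_f[OF inj w(1)] by blast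
    qed
    show "?f ` ?I \<subseteq> ?P" unfolding P ..
    show "inv_into ?I ?f ` ?P \<subseteq> ?I" using inv_into_into[of _ ?f ?I] unfolding P by blast
    show "inv_into ?I ?f (?f v) = v" if "v \<in> ?I" for v by (rule inv_into_f_f[OF inj that])
    show "?f (inv_into ?I ?f a) = a" if "a \<in> ?P" for a
      using that unfolding P by (rule f_inv_into_f)
  qed
  then have "clique_space ?D ?P homotopy_equivalent_space clique_space (\<preceq>) ?I"
    unfolding homotopy_equivalent_space_iff_equivalence[symmetric]
    using homotopy_equivalent_space_sym homotopy_equivalent_space_iff_equivalence by blast
  moreover have "frobenius_complex ?A (frac_elem G \<rho> r x k) = Space (clique_space ?D ?P)"
  proof -
    have "frac_elem G \<rho> r x k \<noteq> \<one>\<^bsub>?A\<^esub>"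
      using xk x k r by (simp add: one_adjoin_frac frac_elem_inj)
    then have "frobenius_complex ?A (frac_elem G \<rho> r x k) = Space (geom_realization (order_complex ?D ?P))"
      by (simp add: frobenius_complex_def)
    then show ?thesis by (simp only: geom_realization_order_complex[OF finP])
  qed
  ultimately show "\<exists>T. frobenius_complex ?A (frac_elem G \<rho> r x k) = Space T \<and>
      T homotopy_equivalent_space clique_space (\<preceq>) ?I" by blast
qed

lemma frobenius_complex_base:
  assumes "x \<in> carrier G"
  shows "frobenius_complex G x = (if x = \<one> then SphereMinus2 else Space (clique_space dvd_rel (open_interval G x)))"
proof -
  have "{y \<in> carrier G. less_mon G \<one> y \<and> less_mon G y x} = open_interval G x"
    by (auto simp: open_interval_def less_mon_def one_dvd)
  then show ?thesis
    by (simp add: frobenius_complex_def geom_realization_order_complex[OF finite_open_interval[OF assms]])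
qed


section \<open>The multiples of the distinguished element below a given one\<close>

lemma nat_pow_inj: "\<rho> [^] (m::nat) = \<rho> [^] (n::nat) \<Longrightarrow> m = n"
proof -
  have *: "m = n" if eq: "\<rho> [^] m = \<rho> [^] n" and le: "m \<le> n" for m n :: nat
  proof (rule ccontr)
    assume "m \<noteq> n"
    then have "m < n" using le by simp
    then obtain d where d: "n = m + Suc d" by (auto simp: less_iff_Suc_add)
    have "\<rho> [^] m = \<rho> [^] m \<otimes> \<rho> [^] Suc d"
      using nat_pow_mult[OF rho(1), of m "Suc d"] eq d by metis
    then have "\<rho> [^] Suc d = \<one>" using rho by (intro mult_eq_self[of "\<rho> [^] m"]) auto
    then show False using reduced[of "\<rho> [^] d" \<rho>] rho by simp
  qed
  show "\<rho> [^] m = \<rho> [^] n \<Longrightarrow> m = n"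
    using *[of m n] *[of n m] by (metis nat_le_linear)
qed

text \<open>Different multiples of \<rho> are different elements, so only finitely many lie below
  \<open>x\<close> and the maximum exists. The set is closed downwards, so comparison with the
  maximum decides membership.\<close>

lemma le_ell_iff:
  assumes x: "x \<in> carrier G"
  shows "l \<le> ell G \<rho> x \<longleftrightarrow> \<rho> [^] l divides x"
proof -
  let ?D = "{l::nat. \<rho> [^] l divides x}"
  have "(\<lambda>l::nat. \<rho> [^] l) ` ?D \<subseteq> {y \<in> carrier G. y divides x}" using rho by auto
  then have fin: "finite ?D"
    using finite_divisors[OF x] nat_pow_inj by (meson finite_imageD finite_subset inj_onI)
  have ne: "0 \<in> ?D" using x by (simp add: one_dvd)
  have "\<rho> [^] (ell G \<rho> x) divides x" using Max_in[OF fin] ne unfolding ell_def by blast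
  moreover have "\<rho> [^] l divides \<rho> [^] m" if "l \<le> m" for l m :: nat
  proof -
    have "\<rho> [^] m = \<rho> [^] l \<otimes> \<rho> [^] (m - l)" using that rho by (simp add: nat_pow_mult)
    then show ?thesis using rho by (auto simp: factor_def)
  qed
  ultimately have "\<rho> [^] l divides x" if "l \<le> ell G \<rho> x"
    using that dvd_trans rho by blast
  moreover have "l \<le> ell G \<rho> x" if "\<rho> [^] l divides x"
    unfolding ell_def using that fin by (intro Max_ge) auto
  ultimately show ?thesis by blast
qed

lemma diff_mon:
  assumes "y divides x" "x \<in> carrier G" "y \<in> carrier G"
  shows "diff_mon G x y \<in> carrier G" "y \<otimes> diff_mon G x y = x"
proof -
  obtain z where z: "z \<in> carrier G" "y \<otimes> z = x" using assms by (auto simp: factor_def)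
  have "diff_mon G x y = z"
    unfolding diff_mon_def
  proof (rule the_equality)
    fix w assume w: "w \<in> carrier G \<and> y \<otimes> w = x"
    then have "y \<otimes> w = y \<otimes> z" using z(2) by simp
    then show "w = z" by (rule l_cancel) (use w z assms in auto)
  qed (use z in simp)
  then show "diff_mon G x y \<in> carrier G" "y \<otimes> diff_mon G x y = x" using z by auto
qed

lemma diff_mon_Suc:
  assumes x: "x \<in> carrier G" and l: "Suc l \<le> ell G \<rho> x"
  shows "diff_mon G x (\<rho> [^] l) = diff_mon G x (\<rho> [^] Suc l) \<otimes> \<rho>"
proof -
  have 1: "diff_mon G x (\<rho> [^] l) \<in> carrier G" "\<rho> [^] l \<otimes> diff_mon G x (\<rho> [^] l) = x"
    using diff_mon[of "\<rho> [^] l" x] le_ell_iff[OF x, of l] x l rho by auto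
  have 2: "diff_mon G x (\<rho> [^] Suc l) \<in> carrier G" "\<rho> [^] Suc l \<otimes> diff_mon G x (\<rho> [^] Suc l) = x"
    using diff_mon[of "\<rho> [^] Suc l" x] le_ell_iff[OF x, of "Suc l"] x l rho by (auto simp del: nat_pow_Suc)
  have "\<rho> [^] l \<otimes> diff_mon G x (\<rho> [^] l) = \<rho> [^] l \<otimes> (diff_mon G x (\<rho> [^] Suc l) \<otimes> \<rho>)"
  proof -
    have "\<rho> [^] l \<otimes> (diff_mon G x (\<rho> [^] Suc l) \<otimes> \<rho>) = \<rho> [^] Suc l \<otimes> diff_mon G x (\<rho> [^] Suc l)"
      using 2(1) rho by (simp add: m_ac)
    then show ?thesis using 1 2 by simp
  qed
  then show ?thesis by (rule l_cancel) (use 1(1) 2(1) rho in auto)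
qed

lemma not_dvd_diff_mon_ell:
  assumes x: "x \<in> carrier G"
  shows "\<not> \<rho> divides diff_mon G x (\<rho> [^] ell G \<rho> x)"
proof
  let ?l = "ell G \<rho> x"
  have 1: "diff_mon G x (\<rho> [^] ?l) \<in> carrier G" "\<rho> [^] ?l \<otimes> diff_mon G x (\<rho> [^] ?l) = x"
    using diff_mon[of "\<rho> [^] ?l" x] le_ell_iff[OF x, of ?l] x rho by auto
  assume "\<rho> divides diff_mon G x (\<rho> [^] ?l)"
  then obtain c where c: "c \<in> carrier G" "diff_mon G x (\<rho> [^] ?l) = \<rho> \<otimes> c" by (auto simp: factor_def)
  then have "x = \<rho> [^] Suc ?l \<otimes> c" using 1 rho by (simp add: m_assoc)
  then have "\<rho> [^] Suc ?l divides x" using c by (auto simp: factor_def)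
  then have "Suc ?l \<le> ?l" using le_ell_iff[OF x, of "Suc ?l"] by blast
  then show False by simp
qed

end

context affine_monoid_elem
begin

text \<open>A positive fractional part requires a full \<rho> below \<open>x\<close>, so only
  elements of the original monoid occur here. This starts the comparison with the tower at its top
  level.\<close>

lemma frac_interval_not_dvd:
  assumes x: "x \<in> carrier G" and nd: "\<not> \<rho> divides x"
  shows "clique_space (\<preceq>) (frac_interval G \<rho> 2 x 0) homotopy_equivalent_space clique_space dvd_rel (open_interval G x)"
proof -
  have snd0: "snd v = 0" if "v \<in> frac_interval G \<rho> 2 x 0" for v
  proof (rule ccontr)
    assume "snd v \<noteq> 0"
    then have "fst v \<otimes> \<rho> divides x" using frac_intervalD(5)[OF that] by (simp add: frac_le_def)
    then have "\<rho> divides x"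
      using dvd_trans[OF dvd_mult'[of "fst v" \<rho>]] frac_intervalD(1)[OF that] rho by blast
    then show False using nd by simp
  qed
  have "homotopy_equivalence (clique_space (\<preceq>) (frac_interval G \<rho> 2 x 0)) (clique_space dvd_rel (open_interval G x))
      (push_forward (frac_interval G \<rho> 2 x 0) fst)"
  proof (rule push_forward_isomorphism[OF finite_frac_interval[OF x] finite_open_interval[OF x], where g = "\<lambda>y. (y, 0)"])
    show "fst ` frac_interval G \<rho> 2 x 0 \<subseteq> open_interval G x"
      using frac_intervalD snd0 by (fastforce simp: open_interval_def prod_eq_iff)
    show "(\<lambda>y. (y, 0)) ` open_interval G x \<subseteq> frac_interval G \<rho> 2 x 0"
      by (auto simp: open_interval_def frac_interval_def frac_le_def)
    show "comparable dvd_rel (fst v) (fst w)"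
      if "v \<in> frac_interval G \<rho> 2 x 0" "w \<in> frac_interval G \<rho> 2 x 0" "v \<preceq> w" for v w
      using that le_fst_dvd frac_intervalD(1) by blast
    show "(fst v, 0) = v" if "v \<in> frac_interval G \<rho> 2 x 0" for v
      using snd0[OF that] by (simp add: prod_eq_iff)
  qed (auto simp: frac_le_def)
  then show ?thesis unfolding homotopy_equivalent_space_iff_equivalence by blast
qed

text \<open>The levels of the tower are the intervals below \<open>x - l\<rho>\<close>; level \<open>l + 1\<close> belongs to \<open>l\<close>, level 0 being
  reserved for the pair of poles that accounts for \<open>k = 1\<close>.\<close>

definition tower_level :: "'a \<Rightarrow> nat \<Rightarrow> 'a set" where
  "tower_level x i = (if 0 < i \<and> i \<le> Suc (ell G \<rho> x) then open_interval G (diff_mon G x (\<rho> [^] (i - 1))) else {})"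

text \<open>Refers to the level with index \<open>Suc i\<close>: it fails exactly if the difference
  belonging to that level is \<open>\<one>\<close>, whose Frobenius complex is S^{-2}. Beyond
  \<open>ell G \<rho> x\<close> it is true by default.\<close>

definition tower_pres :: "'a \<Rightarrow> nat \<Rightarrow> bool" where
  "tower_pres x i \<longleftrightarrow> (i \<le> ell G \<rho> x \<longrightarrow> diff_mon G x (\<rho> [^] i) \<noteq> \<one>)"

lemma diff_mon_pow_closed: "x \<in> carrier G \<Longrightarrow> l \<le> ell G \<rho> x \<Longrightarrow> diff_mon G x (\<rho> [^] l) \<in> carrier G"
  using diff_mon(1)[of "\<rho> [^] l" x] le_ell_iff[of x l] rho by simp

lemma diff_mon_0: "x \<in> carrier G \<Longrightarrow> diff_mon G x (\<rho> [^] (0::nat)) = x"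
  using diff_mon[of "\<one>" x] one_dvd[of x] by simp

lemma tower_intro:
  assumes x: "x \<in> carrier G" and \<sigma>: "\<sigma> \<in> carrier G" "\<sigma> \<noteq> \<one>" and \<tau>: "\<tau> \<in> carrier G" "\<tau> \<noteq> \<one>" and \<rho>: "\<rho> = \<sigma> \<otimes> \<tau>"
  shows "tower dvd_rel (tower_level x) \<sigma> (tower_pres x) (Suc (ell G \<rho> x))"
proof
  note closed = diff_mon_pow_closed[OF x]
  show "finite (tower_level x i)" for i
    using closed[of "i - 1"] by (auto simp: tower_level_def intro: finite_open_interval)
  show "dvd_rel y y" if "y \<in> tower_level x i" for y i
    using that by (auto simp: tower_level_def open_interval_def dvd_refl split: if_splits)
  \<comment> \<open>In this range one more \<rho> can be subtracted, so the level lies below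
    \<open>y \<otimes> \<rho>\<close>, which exceeds \<sigma> by
    \<open>\<tau> \<otimes> y\<close>.\<close>
  show "\<sigma> \<in> tower_level x i" if "0 < i" "i < Suc (ell G \<rho> x)" for i
  proof -
    define y where "y = diff_mon G x (\<rho> [^] i)"
    have y: "y \<in> carrier G" using closed[of i] that by (simp add: y_def)
    have eq: "diff_mon G x (\<rho> [^] (i - 1)) = y \<otimes> \<rho>"
      using diff_mon_Suc[OF x, of "i - 1"] that by (simp add: y_def)
    have eq': "y \<otimes> \<rho> = \<sigma> \<otimes> (\<tau> \<otimes> y)" unfolding \<rho> using y \<sigma> \<tau> by (simp add: m_ac)
    have "\<sigma> \<noteq> y \<otimes> \<rho>"
    proof
      assume "\<sigma> = y \<otimes> \<rho>"
      from this eq' have "\<sigma> = \<sigma> \<otimes> (\<tau> \<otimes> y)" by (rule trans)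
      with y \<sigma> \<tau> have "\<tau> \<otimes> y = \<one>" by (intro mult_eq_self[of \<sigma>]) auto
      then show False using reduced[of \<tau> y] y \<tau> by simp
    qed
    moreover have "\<sigma> divides y \<otimes> \<rho>" using eq' y \<tau> by (auto simp: factor_def)
    ultimately show ?thesis using that \<sigma> by (simp add: tower_level_def open_interval_def eq del: One_nat_def)
  qed
  show "tower_pres x i" if "Suc i < Suc (ell G \<rho> x)" for i
  proof -
    have "diff_mon G x (\<rho> [^] i) = diff_mon G x (\<rho> [^] Suc i) \<otimes> \<rho>" "diff_mon G x (\<rho> [^] Suc i) \<in> carrier G"
      using diff_mon_Suc[OF x, of i] closed[of "Suc i"] that by auto
    then have "diff_mon G x (\<rho> [^] i) \<noteq> \<one>"
      using reduced[of "diff_mon G x (\<rho> [^] Suc i)" \<rho>] rho by metis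
    then show ?thesis by (simp add: tower_pres_def)
  qed
  show "tower_level x (Suc i) = {}" if "\<not> tower_pres x i" for i
    using that dvd_antisym[OF _ one_dvd] by (auto simp: tower_level_def tower_pres_def open_interval_def)
qed

text \<open>Both spaces are cones attached to the same level up to homotopy, with attaching maps
  that contract to the vertex \<sigma>; only the links have to be compared. These are suspensions of
  the two spaces for \<open>Suc i\<close>, apart from the case of the formal sphere, so the
  equivalence passes down from the top.\<close>

lemma frac_interval_tower:
  assumes x: "x \<in> carrier G" and \<sigma>: "\<sigma> \<in> carrier G" "\<sigma> \<noteq> \<one>" and \<tau>: "\<tau> \<in> carrier G" "\<tau> \<noteq> \<one>" and \<rho>: "\<rho> = \<sigma> \<otimes> \<tau>"
    and i: "i \<le> ell G \<rho> x"
  shows "clique_space (\<preceq>) (frac_interval G \<rho> 2 (diff_mon G x (\<rho> [^] i)) 0) homotopy_equivalent_space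
     clique_space (tower_adj dvd_rel \<sigma>) (tower.levels (tower_level x) (tower_pres x) (Suc i) (Suc (ell G \<rho> x)))"
proof -
  let ?n = "ell G \<rho> x"
  interpret T: tower dvd_rel "tower_level x" \<sigma> "tower_pres x" "Suc ?n"
    by (rule tower_intro[OF x \<sigma> \<tau> \<rho>])
  let ?K = "clique_space (tower_adj dvd_rel \<sigma>)"
  let ?d = "\<lambda>l::nat. diff_mon G x (\<rho> [^] l)"
  show ?thesis
    using i
  proof (induction i rule: inc_induct)
    case base
    have Q: "tower_level x (Suc ?n) = open_interval G (?d ?n)" by (simp add: tower_level_def)
    have 1: "clique_space (\<preceq>) (frac_interval G \<rho> 2 (?d ?n) 0) homotopy_equivalent_space clique_space dvd_rel (tower_level x (Suc ?n))"
      unfolding Q by (rule frac_interval_not_dvd[OF diff_mon_pow_closed[OF x] not_dvd_diff_mon_ell[OF x]]) simp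
    have "?K (T.levels (Suc ?n) (Suc ?n)) homotopy_equivalent_space clique_space dvd_rel (tower_level x (Suc ?n))"
      unfolding homotopy_equivalent_space_iff_equivalence by (rule exI, rule T.level_isomorphism)
    then show ?case
      unfolding homotopy_equivalent_space_sym[of "?K (T.levels (Suc ?n) (Suc ?n))"] by (rule homotopy_eqv_trans[OF 1])
  next
    case (step i)
    define y where "y = ?d (Suc i)"
    have y: "y \<in> carrier G" using diff_mon_pow_closed[OF x, of "Suc i"] step.hyps by (simp add: y_def del: nat_pow_Suc)
    have eq: "?d i = y \<otimes> \<rho>" unfolding y_def by (rule diff_mon_Suc[OF x]) (use step.hyps in simp)
    have Q: "tower_level x (Suc i) = open_interval G (y \<otimes> \<rho>)"
      using step.hyps eq by (simp add: tower_level_def)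
    let ?M = "?K (T.levels (Suc (Suc i)) (Suc ?n))"
    let ?N = "?K (T.poles (Suc i) \<union> T.levels (Suc (Suc i)) (Suc ?n))"
    have IH: "clique_space (\<preceq>) (frac_interval G \<rho> 2 y 0) homotopy_equivalent_space ?M"
      using step.IH by (simp add: y_def)
    have link: "clique_space (\<preceq>) (frac_interval G \<rho> 2 y 1) homotopy_equivalent_space ?N"
    proof (cases "y = \<one>")
      case False
      then have pr: "tower_pres x (Suc i)" by (simp add: tower_pres_def y_def)
      have M: "?M homotopy_equivalent_space base_space ?M"
        unfolding homotopy_equivalent_space_iff_equivalence by (rule exI, rule homotopy_equivalence_base_space)
      have "suspension (base_space ?M) homotopy_equivalent_space ?N"
        unfolding homotopy_equivalent_space_sym[of "suspension (base_space ?M)"] by (rule T.poles_join[OF M pr])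
      then show ?thesis
        by (rule homotopy_eqv_trans[OF frac_interval_1_suspension[OF y False order_refl homotopy_eqv_trans[OF IH M]]])
    next
      \<comment> \<open>Nothing is left after subtracting \<rho>, and the link is the empty space in
        the role of the suspension of S^{-2}. This occurs only at the last level, where the tower
        has no poles either.\<close>
      case True
      have npr: "\<not> tower_pres x (Suc i)" using True step.hyps by (simp add: tower_pres_def y_def del: nat_pow_Suc)
      then have n: "Suc i = ?n" using T.pres[of "Suc i"] step.hyps by fastforce
      have "v = (\<one>, 0) \<or> v = (\<one>, 1)" if "v \<in> frac_interval G \<rho> 2 \<one> 1" for v
        using frac_intervalD[OF that] dvd_antisym[OF _ one_dvd, of "fst v"] by (cases v) (auto simp: less_2_cases_iff)
      then have "frac_interval G \<rho> 2 y 1 = {}"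
        using frac_intervalD(3,4)[of _ 2 \<one> 1] True by blast
      moreover have "T.poles (Suc i) \<union> T.levels (Suc (Suc i)) (Suc ?n) = {}"
        using npr T.empty[OF npr] n by (simp add: T.poles_def T.levels_same)
      ultimately show ?thesis by (simp add: homotopy_equivalent_space_trivial)
    qed
    note C1 = frac_interval_0_cone[OF y \<sigma> \<tau> \<rho>, folded Q]
    have bounds: "0 < Suc i" "Suc i < Suc ?n" "Suc ?n \<le> Suc ?n" using step.hyps by auto
    note C2 = T.tower_bottom_cone[OF bounds]
    have "indicator {\<sigma>} \<in> clique_points dvd_rel (tower_level x (Suc i))"
      using T.sigma[OF bounds(1,2)] T.fin T.refl by (intro indicator_in_clique_points) auto
    then have "indicator {\<sigma>} \<in> topspace (clique_space dvd_rel (tower_level x (Suc i)))" by simp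
    from cone_attached_equivalent_spaces[OF C1(1) C2(1) this C1(2,3) C2(2,3) link homotopy_equivalent_space_refl]
    show ?case unfolding eq .
  qed
qed

end

section \<open>Assembly: exceptional cases and the choice of the factorization\<close>

theorem theorem3p1:
  fixes \<Lambda> :: "('a, 'b) monoid_scheme" and \<rho> lam :: 'a and r k :: nat
  assumes "affine_monoid \<Lambda>"
    and "reducible_mon \<Lambda> \<rho>"
    and "r \<ge> 2"
    and "lam \<in> carrier \<Lambda>"
    and "k < r"
  shows "(k \<le> 1 \<longrightarrow>
           (\<forall>p. (ell \<Lambda> \<rho> lam \<ge> 1 \<longrightarrow>
                  (\<forall>l \<le> ell \<Lambda> \<rho> lam. admissible_base_point \<Lambda> \<rho> (2 * l + k) (p l))) \<longrightarrow>
              frobenius_complex (adjoin_frac \<Lambda> \<rho> r) (frac_elem \<Lambda> \<rho> r lam k)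
              \<simeq>\<^sub>e ext_wedge (ell \<Lambda> \<rho> lam)
                   (\<lambda>l. iter_suspension (2 * l + k)
                          (frobenius_complex \<Lambda> (diff_mon \<Lambda> lam (\<rho> [^]\<^bsub>\<Lambda>\<^esub> l)))) p)) \<and>
         (k \<ge> 2 \<longrightarrow>
            frobenius_complex (adjoin_frac \<Lambda> \<rho> r) (frac_elem \<Lambda> \<rho> r lam k)
            \<simeq>\<^sub>e Space (discrete_topology {()}))"
proof -
  interpret affine_monoid \<Lambda> by fact
  obtain \<sigma>0 \<tau>0 where st0: "\<sigma>0 \<in> carrier \<Lambda>" "\<sigma>0 \<noteq> \<one>\<^bsub>\<Lambda>\<^esub>" "\<tau>0 \<in> carrier \<Lambda>" "\<tau>0 \<noteq> \<one>\<^bsub>\<Lambda>\<^esub>" "\<rho> = \<sigma>0 \<otimes>\<^bsub>\<Lambda>\<^esub> \<tau>0"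
    using assms(2) by (auto simp: reducible_mon_def)
  interpret affine_monoid_elem \<Lambda> \<rho>
  proof
    show "\<rho> \<in> carrier \<Lambda>" using assms(2) by (simp add: reducible_mon_def)
    show "\<rho> \<noteq> \<one>\<^bsub>\<Lambda>\<^esub>" using reduced[of \<sigma>0 \<tau>0] st0 by auto
  qed
  note lam = assms(4)
  let ?F = "frobenius_complex (adjoin_frac \<Lambda> \<rho> r) (frac_elem \<Lambda> \<rho> r lam k)"
  let ?n = "ell \<Lambda> \<rho> lam"
  let ?le = "frac_le \<Lambda> \<rho>"
  have F: "\<exists>T. ?F = Space T \<and> T homotopy_equivalent_space clique_space ?le (frac_interval \<Lambda> \<rho> r lam k)"
    if "lam \<noteq> \<one>\<^bsub>\<Lambda>\<^esub> \<or> k \<noteq> 0"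
    using frobenius_complex_adjoin_frac(2)[OF lam assms(5) that] .
  show ?thesis
  proof (intro conjI impI allI)
    assume k2: "2 \<le> k"
    then obtain T where T: "?F = Space T" "T homotopy_equivalent_space clique_space ?le (frac_interval \<Lambda> \<rho> r lam k)"
      using F by auto
    have "homotopy_equivalence (clique_space ?le (frac_interval \<Lambda> \<rho> r lam k)) (discrete_topology {()}) (\<lambda>_. ())"
      using contractible_frac_interval[OF lam k2 assms(5)]
      by (intro homotopy_equivalence_of_contractible) auto
    then have "clique_space ?le (frac_interval \<Lambda> \<rho> r lam k) homotopy_equivalent_space discrete_topology {()}"
      unfolding homotopy_equivalent_space_iff_equivalence by blast
    with T show "?F \<simeq>\<^sub>e Space (discrete_topology {()})"
      using homotopy_eqv_trans by auto
  next
    fix p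
    assume k1: "k \<le> 1" and adm: "1 \<le> ?n \<longrightarrow> (\<forall>l\<le>?n. admissible_base_point \<Lambda> \<rho> (2 * l + k) (p l))"
    let ?S = "\<lambda>l. iter_suspension (2 * l + k) (frobenius_complex \<Lambda> (diff_mon \<Lambda> lam (\<rho> [^]\<^bsub>\<Lambda>\<^esub> l)))"
    let ?X = "\<lambda>l. case ?S l of Space Y \<Rightarrow> Y"
    show "?F \<simeq>\<^sub>e ext_wedge ?n ?S p"
    proof (cases "lam = \<one>\<^bsub>\<Lambda>\<^esub>")
      \<comment> \<open>The only summand is S^{-2}, suspended \<open>k\<close> times: both sides are
        S^{-2} for \<open>k = 0\<close> and empty for \<open>k = 1\<close>.\<close>
      case True
      have n0: "?n = 0"
      proof (rule ccontr)
        assume "?n \<noteq> 0"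
        then have "\<rho> divides\<^bsub>\<Lambda>\<^esub> \<one>\<^bsub>\<Lambda>\<^esub>" using le_ell_iff[OF lam, of 1] True rho by simp
        then show False using dvd_antisym[OF _ one_dvd] rho by auto
      qed
      have S0: "?S 0 = iter_suspension k SphereMinus2"
        using True diff_mon_0[OF lam] lam by (simp add: frobenius_complex_base)
      show ?thesis
      proof (cases "k = 0")
        case k0: True
        have "?F = SphereMinus2" by (rule frobenius_complex_adjoin_frac(1)[OF lam assms(5) True k0])
        moreover have "ext_wedge ?n ?S p = SphereMinus2"
          using S0 k0 by (auto simp: ext_wedge_def n0 iter_suspension_def)
        ultimately show ?thesis by simp
      next
        case False
        then have k: "k = 1" using k1 by simp
        obtain T where T: "?F = Space T" "T homotopy_equivalent_space clique_space ?le (frac_interval \<Lambda> \<rho> r lam k)"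
          using F False by auto
        have "v = (\<one>\<^bsub>\<Lambda>\<^esub>, 0) \<or> v = (\<one>\<^bsub>\<Lambda>\<^esub>, 1)" if v: "v \<in> frac_interval \<Lambda> \<rho> r lam k" for v
        proof -
          have "fst v = \<one>\<^bsub>\<Lambda>\<^esub>" using frac_intervalD(1,6)[OF v] dvd_antisym[OF _ one_dvd] True by simp
          moreover have "snd v \<le> 1"
            using frac_intervalD(1,5)[OF v] not_rho_dvd_self[of "\<one>\<^bsub>\<Lambda>\<^esub>"] calculation True k
            by (auto simp: frac_le_def split: if_splits)
          ultimately show ?thesis by (cases v) auto
        qed
        then have empty: "frac_interval \<Lambda> \<rho> r lam k = {}"
          using frac_intervalD(3,4)[of _ r lam k] True k by blast
        have S: "?S 0 = Space trivial_topology" by (rule trans[OF S0]) (simp add: k iter_suspension_def)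
        have "ext_wedge ?n ?S p = Space (wedge 0 ?X p)" using S by (simp add: ext_wedge_def n0)
        moreover have "?X 0 homotopy_equivalent_space wedge 0 ?X p"
          unfolding homotopy_equivalent_space_iff_equivalence by (rule exI, rule homotopy_equivalence_wedge_0)
        then have "(trivial_topology :: ('a \<Rightarrow> real) susp_point topology) homotopy_equivalent_space wedge 0 ?X p"
          using S by simp
        ultimately show ?thesis
          using T homotopy_eqv_trans[OF _ homotopy_eqv_trans[OF homotopy_equivalent_space_trivial]]
          by (simp add: empty)
      qed
    next
      case False
      \<comment> \<open>The prescribed base point of the unsuspended summand is a vertex strictly
        between 0 and \<rho>. The factorization is chosen so that the tower is built with this very
        vertex; in the other cases any factorization will do.\<close>
      obtain \<sigma> \<tau> where st: "\<sigma> \<in> carrier \<Lambda>" "\<sigma> \<noteq> \<one>\<^bsub>\<Lambda>\<^esub>" "\<tau> \<in> carrier \<Lambda>" "\<tau> \<noteq> \<one>\<^bsub>\<Lambda>\<^esub>" "\<rho> = \<sigma> \<otimes>\<^bsub>\<Lambda>\<^esub> \<tau>"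
        and p0: "1 \<le> ?n \<Longrightarrow> k = 0 \<Longrightarrow> p 0 = Base (indicator {\<sigma>})"
      proof (cases "1 \<le> ?n \<and> k = 0")
        case True
        then obtain \<sigma> where \<sigma>: "\<sigma> \<in> carrier \<Lambda>" "less_mon \<Lambda> \<one>\<^bsub>\<Lambda>\<^esub> \<sigma>" "less_mon \<Lambda> \<sigma> \<rho>" "p 0 = Base (indicator {\<sigma>})"
        proof -
          have "admissible_base_point \<Lambda> \<rho> (2 * 0 + k) (p 0)" using adm True by blast
          then show thesis using that True unfolding admissible_base_point_def by auto
        qed
        then obtain \<tau> where \<tau>: "\<tau> \<in> carrier \<Lambda>" "\<rho> = \<sigma> \<otimes>\<^bsub>\<Lambda>\<^esub> \<tau>" by (auto simp: less_mon_def factor_def)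
        then have "\<tau> \<noteq> \<one>\<^bsub>\<Lambda>\<^esub>" using \<sigma> by (auto simp: less_mon_def)
        then show thesis using that \<sigma> \<tau> by (auto simp: less_mon_def)
      next
        case False
        then show thesis using that[OF st0] by blast
      qed
      interpret T: tower dvd_rel "tower_level lam" \<sigma> "tower_pres lam" "Suc ?n"
        by (rule tower_intro[OF lam st])
      let ?K = "clique_space (tower_adj dvd_rel \<sigma>)"
      have summand: "T.summand (Suc l) = frobenius_complex \<Lambda> (diff_mon \<Lambda> lam (\<rho> [^]\<^bsub>\<Lambda>\<^esub> l))" if "l \<le> ?n" for l
        using that diff_mon_pow_closed[OF lam that]
        by (simp add: T.summand_def tower_pres_def tower_level_def frobenius_complex_base)
      have pres0: "tower_pres lam 0" using False diff_mon_0[OF lam] by (simp add: tower_pres_def)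
      \<comment> \<open>As \<open>lam\<close> is not \<open>\<one>\<close>, the unsuspended summand
        is a space, and one suspension turns even S^{-2} into a space. So the dummy value of the
        wedge does not arise.\<close>
      have S_space: "?S l \<noteq> SphereMinus2" if "l \<le> ?n" for l
      proof (cases "2 * l + k")
        case 0
        then have "l = 0" "k = 0" by auto
        then show ?thesis using False diff_mon_0[OF lam] lam by (simp add: frobenius_complex_base iter_suspension_def)
      next
        case (Suc m)
        have "ext_suspension Y \<noteq> SphereMinus2" for Y :: "('a \<Rightarrow> real) susp_point ext_space" by (cases Y) auto
        then show ?thesis unfolding Suc by (simp add: iter_suspension_def)
      qed
      have X: "Space (?X l) = iter_suspension (2 * l + k) (T.summand (Suc l))" if "l < Suc ?n" for l
        using S_space[of l] summand[of l] that by (cases "?S l") auto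
      have rhs: "ext_wedge ?n ?S p = Space (wedge ?n ?X p)"
        using S_space by (auto simp: ext_wedge_def)
      have base: "if 2 * l + k = 0 then p l = Base (indicator {\<sigma>}) else p l = South \<or> p l = North"
        if "1 < Suc ?n" "l < Suc ?n" for l
        using adm p0 that by (cases "2 * l + k = 0") (auto simp: admissible_base_point_def)
      obtain \<phi> where "homotopy_equivalence (?K (T.bottom k \<union> T.levels 1 (Suc ?n))) (wedge ?n ?X p) \<phi>"
        using T.tower_wedge[where X = ?X and p = p and n = ?n, OF k1 _ pres0 X base] by auto
      then have W: "?K (T.bottom k \<union> T.levels 1 (Suc ?n)) homotopy_equivalent_space wedge ?n ?X p"
        unfolding homotopy_equivalent_space_iff_equivalence by blast
      obtain A where A: "?F = Space A" "A homotopy_equivalent_space clique_space ?le (frac_interval \<Lambda> \<rho> r lam k)"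
        using F False by auto
      have I0: "clique_space ?le (frac_interval \<Lambda> \<rho> r lam 0) homotopy_equivalent_space ?K (T.levels 1 (Suc ?n))"
        using homotopy_eqv_trans[OF frac_interval_0_equiv[OF lam assms(3)]] frac_interval_tower[OF lam st, of 0] diff_mon_0[OF lam]
        by simp
      have "clique_space ?le (frac_interval \<Lambda> \<rho> r lam k) homotopy_equivalent_space ?K (T.bottom k \<union> T.levels 1 (Suc ?n))"
      proof (cases "k = 0")
        case True
        then show ?thesis using I0 by (simp add: T.bottom_def)
      next
        \<comment> \<open>The extra suspension of the interval for \<open>k = 1\<close> is matched
          by the two poles at level 0, which are joined to the whole tower.\<close>
        case k: False
        let ?B = "base_space (?K (T.levels 1 (Suc ?n)))"
        have B: "?K (T.levels 1 (Suc ?n)) homotopy_equivalent_space ?B"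
          unfolding homotopy_equivalent_space_iff_equivalence by (rule exI, rule homotopy_equivalence_base_space)
        have 1: "clique_space ?le (frac_interval \<Lambda> \<rho> r lam 1) homotopy_equivalent_space suspension ?B"
          by (rule frac_interval_1_suspension[OF lam False assms(3) homotopy_eqv_trans[OF I0 B]])
        have "?K (insert (0, Pole1) (insert (0, Pole2) (T.levels 1 (Suc ?n)))) homotopy_equivalent_space suspension ?B"
          by (rule T.join_pair[OF T.finite_levels _ _ _ _ _ B]) (auto simp: T.levels_def tower_adj_def upper_def)
        moreover have ins: "insert (0, Pole1) (insert (0, Pole2) (T.levels 1 (Suc ?n))) = T.bottom k \<union> T.levels 1 (Suc ?n)"
          using k by (simp add: T.bottom_def)
        ultimately have 2: "suspension ?B homotopy_equivalent_space ?K (T.bottom k \<union> T.levels 1 (Suc ?n))"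
          unfolding ins homotopy_equivalent_space_sym[of "suspension ?B"] by blast
        have "k = 1" using k k1 by simp
        then show ?thesis using homotopy_eqv_trans[OF 1 2] by (simp only:)
      qed
      then have "A homotopy_equivalent_space wedge ?n ?X p"
        by (rule homotopy_eqv_trans[OF A(2) homotopy_eqv_trans[OF _ W]])
      then show ?thesis unfolding A(1) rhs by simp
    qed
  qed
qed

end
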